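(* Let $(\mathcal{S}_1\times\mathcal{S}_2,\mathbb{W}_{S_1S_2})$ be a pair of finite-alphabet sources and $(\mathcal{X}_1\times\mathcal{X}_2,\mathcal{Y},\mathbb{W}_{Y|X_1X_2})$ a discrete memoryless MAC. Suppose there exist (i) finite sets $\mathcal{K},\mathcal{U},\mathcal{V}_1,\mathcal{V}_2$; (ii) maps $f_j:\mathcal{S}_j\to\mathcal{K}$ with $K_j=f_j(S_j)$; (iii) $\alpha,\beta\ge0$, $\rho>0$, $\delta>0$; (iv) an integer $l\ge l^*(\mathcal{U},\mathcal{Y},\rho)$; (v) a pmf $p_Up_{V_1}p_{V_2}p_{X_1|UV_1}p_{X_2|UV_2}\mathbb{W}_{Y|X_1X_2}$ with $p_U$ a type of sequences in $\mathcal{U}^l$, such that for some $a\in\{1,2\}$, $$(1+\delta)H(K_a)<\alpha+\beta,$$ $$H(S_j\mid S_{\bar j},K_a)+\mathcal{L}_l(\phi,|\mathcal{S}_j|)<I(V_j;Y\mid U,V_{\bar j})-\mathcal{L}(\phi,|\mathcal{V}_j|)\quad(j\in\{1,2\}),$$ $$\beta+H(S_1,S_2\mid K_a)+\mathcal{L}_l(\phi,|\mathcal{S}_1||\mathcal{S}_2|)<I(V_1,V_2;Y\mid U)-\mathcal{L}(\phi,|\mathcal{V}_1||\mathcal{V}_2|),$$ and $\phi\in[0,0.5)$, where $\phi:=g(\alpha+\rho,l)+\xi^{[l]}(K_1,K_2)+\tau_{l,\delta}(K_a)$, $g(R,l):=(l+1)^{2|\mathcal{U}||\mathcal{Y}|}\exp\{-lE_r(R,p_U,p_{Y|U})\}$.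 Then $(S_1,S_2)$ is transmissible over the MAC.
   Context: $\bar j$ is the other index. Source entropies under $\mathbb{W}_{S_1S_2}$; mutual informations and $p_{Y|U}$ under the pmf in (v). Logs/exps share a base; $h_b$ is binary entropy. Transmissibility over the MAC: for every $\epsilon>0$ there is $N_\epsilon$ such that for every $n\ge N_\epsilon$ there exist encoders $e_j:\mathcal{S}_j^n\to\mathcal{X}_j^n$ and a decoder $d:\mathcal{Y}^n\to\mathcal{S}_1^n\times\mathcal{S}_2^n$ with $P(d(Y^n)\ne(S_1^n,S_2^n))\le\epsilon$, where $(S_1^n,S_2^n)\sim\mathbb{W}^n_{S_1S_2}$ and $Y^n$ is the memoryless MAC output for inputs $e_1(S_1^n),e_2(S_2^n)$. Definitions: $l^*(\mathcal{A},\mathcal{B},\rho):=\min\{l\in\mathbb{N}:\exp(l\rho/2)\ge2(l+1)^{2|\mathcal{A}|+2|\mathcal{A}||\mathcal{B}|}\}$; $p_U$ is a type in $\mathcal{U}^l$ if $lp_U(u)\in\mathbb{Z}$ for all $u$; $E_r(R,p_U,W_{Y|U}):=\min_{V_{Y|U}}\{D(V_{Y|U}\|W_{Y|U}|p_U)+|I(p_U;V_{Y|U})-R|^+\}$; $\mathcal{L}_l(\mu,N):=\frac1lh_b(\mu)+\mu\log N$, $\mathcal{L}=\mathcal{L}_1$; $\xi^{[l]}(K_1,K_2):=1-(1-P(K_1\ne K_2))^l$; $\tau_{l,\delta}(K_a):=2|\mathcal{K}|\exp\{-2\delta^2p_{K_a}(b^* )^2l\}$, $b^*$ a symbol of least positive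 probability under $p_{K_a}$. *)

theory Defs
  imports Complex_Main
begin

definition is_pmf :: "('a::finite \<Rightarrow> real) \<Rightarrow> bool" where
  "is_pmf p \<longleftrightarrow> (\<forall>x. 0 \<le> p x) \<and> sum p UNIV = 1"

text \<open>Entropy of the random variable f(X) where X has pmf P (with 0 ln 0 = 0).\<close>
definition ent :: "('a::finite \<Rightarrow> real) \<Rightarrow> ('a \<Rightarrow> 'b) \<Rightarrow> real" where
  "ent P f = - (\<Sum>b\<in>range f. (\<Sum>x\<in>{x. f x = b}. P x) * ln (\<Sum>x\<in>{x. f x = b}. P x))"

definition cent :: "('a::finite \<Rightarrow> real) \<Rightarrow> ('a \<Rightarrow> 'b) \<Rightarrow> ('a \<Rightarrow> 'c) \<Rightarrow> real" where
  "cent P fa fb = ent P (\<lambda>x. (fa x, fb x)) - ent P fb"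

definition cmi :: "('a::finite \<Rightarrow> real) \<Rightarrow> ('a \<Rightarrow> 'b) \<Rightarrow> ('a \<Rightarrow> 'c) \<Rightarrow> ('a \<Rightarrow> 'd) \<Rightarrow> real" where
  "cmi P fa fb fc = ent P (\<lambda>x. (fa x, fc x)) + ent P (\<lambda>x. (fb x, fc x))
                    - ent P (\<lambda>x. (fa x, fb x, fc x)) - ent P fc"

definition mi_ch :: "('u::finite \<Rightarrow> real) \<Rightarrow> ('u \<Rightarrow> 'y::finite \<Rightarrow> real) \<Rightarrow> real" where
  "mi_ch p V = (let J = (\<lambda>(u,y). p u * V u y) in ent J fst + ent J snd - ent J id)"

definition cdiv :: "('u::finite \<Rightarrow> 'y::finite \<Rightarrow> real) \<Rightarrow> ('u \<Rightarrow> 'y \<Rightarrow> real) \<Rightarrow> ('u \<Rightarrow> real) \<Rightarrow> real" where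
  "cdiv V W p = (\<Sum>u\<in>UNIV. p u * (\<Sum>y\<in>UNIV. V u y * ln (V u y / W u y)))"

text \<open>Random coding exponent. The minimum ranges over stochastic matrices V;
  those with D(V||W|p) = +infinity (V(y|u) > 0 = W(y|u) for some u with p(u) > 0)
  cannot attain the minimum and are excluded.\<close>
definition Er :: "real \<Rightarrow> ('u::finite \<Rightarrow> real) \<Rightarrow> ('u \<Rightarrow> 'y::finite \<Rightarrow> real) \<Rightarrow> real" where
  "Er R p W = Inf ((\<lambda>V. cdiv V W p + max 0 (mi_ch p V - R)) `
      {V. (\<forall>u. is_pmf (V u)) \<and> (\<forall>u y. 0 < p u \<and> W u y = 0 \<longrightarrow> V u y = 0)})"

definition lstar :: "nat \<Rightarrow> nat \<Rightarrow> real \<Rightarrow> nat" where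
  "lstar A B \<rho> = (LEAST l::nat. exp (real l * \<rho> / 2) \<ge> 2 * (real l + 1) ^ (2*A + 2*A*B))"

definition is_type :: "nat \<Rightarrow> ('u::finite \<Rightarrow> real) \<Rightarrow> bool" where
  "is_type l p \<longleftrightarrow> (\<forall>u. real l * p u \<in> \<int>)"

definition hb :: "real \<Rightarrow> real" where
  "hb \<mu> = - \<mu> * ln \<mu> - (1 - \<mu>) * ln (1 - \<mu>)"

definition LL :: "nat \<Rightarrow> real \<Rightarrow> nat \<Rightarrow> real" where
  "LL l \<mu> N = hb \<mu> / real l + \<mu> * ln (real N)"

definition xi :: "nat \<Rightarrow> ('s1::finite \<times> 's2::finite \<Rightarrow> real) \<Rightarrow> ('s1 \<Rightarrow> 'k) \<Rightarrow> ('s2 \<Rightarrow> 'k) \<Rightarrow> real" where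
  "xi l WS f1 f2 = 1 - (1 - (\<Sum>s\<in>{s. f1 (fst s) \<noteq> f2 (snd s)}. WS s)) ^ l"

definition tau :: "nat \<Rightarrow> real \<Rightarrow> ('a::finite \<Rightarrow> real) \<Rightarrow> ('a \<Rightarrow> 'k::finite) \<Rightarrow> real" where
  "tau l \<delta> P fK = (let pK = (\<lambda>k. \<Sum>s\<in>{s. fK s = k}. P s);
                        pmin = Min {q. 0 < q \<and> (\<exists>k. q = pK k)}
                    in 2 * real (card (UNIV::'k set)) * exp (- 2 * \<delta>^2 * pmin^2 * real l))"

definition err_prob ::
  "('s1::finite \<times> 's2::finite \<Rightarrow> real) \<Rightarrow> ('x1 \<Rightarrow> 'x2 \<Rightarrow> 'y::finite \<Rightarrow> real) \<Rightarrow> nat \<Rightarrow>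
   ('s1 list \<Rightarrow> 'x1 list) \<Rightarrow> ('s2 list \<Rightarrow> 'x2 list) \<Rightarrow> ('y list \<Rightarrow> 's1 list \<times> 's2 list) \<Rightarrow> real" where
  "err_prob WS W n e1 e2 d =
     (\<Sum>ss\<in>{ss. length ss = n}. (\<Prod>i<n. WS (ss ! i)) *
        (\<Sum>ys\<in>{ys. length ys = n}.
           (\<Prod>i<n. W (e1 (map fst ss) ! i) (e2 (map snd ss) ! i) (ys ! i)) *
           (if d ys \<noteq> (map fst ss, map snd ss) then 1 else 0)))"

definition transmissible ::
  "('s1::finite \<times> 's2::finite \<Rightarrow> real) \<Rightarrow> ('x1 \<Rightarrow> 'x2 \<Rightarrow> 'y::finite \<Rightarrow> real) \<Rightarrow> bool" where
  "transmissible WS W \<longleftrightarrow>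
     (\<forall>\<epsilon>>0. \<exists>N. \<forall>n\<ge>N. \<exists>(e1::'s1 list \<Rightarrow> 'x1 list) (e2::'s2 list \<Rightarrow> 'x2 list)
                                (d::'y list \<Rightarrow> 's1 list \<times> 's2 list).
        (\<forall>s. length s = n \<longrightarrow> length (e1 s) = n) \<and>
        (\<forall>s. length s = n \<longrightarrow> length (e2 s) = n) \<and>
        err_prob WS W n e1 e2 d \<le> \<epsilon>)"

definition joint6 ::
  "('u \<Rightarrow> real) \<Rightarrow> ('v1 \<Rightarrow> real) \<Rightarrow> ('v2 \<Rightarrow> real) \<Rightarrow> ('u \<Rightarrow> 'v1 \<Rightarrow> 'x1 \<Rightarrow> real) \<Rightarrow>
   ('u \<Rightarrow> 'v2 \<Rightarrow> 'x2 \<Rightarrow> real) \<Rightarrow> ('x1 \<Rightarrow> 'x2 \<Rightarrow> 'y \<Rightarrow> real) \<Rightarrow>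
   ('u \<times> 'v1 \<times> 'v2 \<times> 'x1 \<times> 'x2 \<times> 'y \<Rightarrow> real)" where
  "joint6 pU pV1 pV2 pX1 pX2 W = (\<lambda>(u,v1,v2,x1,x2,y).
      pU u * pV1 v1 * pV2 v2 * pX1 u v1 x1 * pX2 u v2 x2 * W x1 x2 y)"

text \<open>p_{Y|U} under the joint pmf (0 on rows with p_U(u) = 0, which carry no weight).\<close>
definition pYgU ::
  "('u::finite \<times> 'v1::finite \<times> 'v2::finite \<times> 'x1::finite \<times> 'x2::finite \<times> 'y::finite \<Rightarrow> real)
   \<Rightarrow> 'u \<Rightarrow> 'y \<Rightarrow> real" where
  "pYgU P u y = (\<Sum>z\<in>{z. fst z = u \<and> snd (snd (snd (snd (snd z)))) = y}. P z)
                / (\<Sum>z\<in>{z. fst z = u}. P z)"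

end

(*
  Blocks of l source letters are treated as super-letters of a multi-letter
  Cover-El Gamal-Salehi scheme.  Both encoders map their block of K-letters through the same
  fixed-block-length constant composition code, so with probability 1 - xi they produce the same
  u-block; given u, the letters (V_j, X_j) are drawn independently over the positions of the block.

  The joint decoder accepts a pair of source sequences if its three product weights are at least
  1/gamma.  A weight has mean at most 1 under independently drawn codewords, summed over the
  candidates, so wrong candidates cost gamma by Markov's inequality, while by a Chernoff bound the
  true pair is accepted with high probability as soon as the mean of ln(weight) is positive for a
  single block.  The weights contain guesses of Fano type: "K is the other user's K" for the
  one-user error events, "K lies in the list decoded from the u-layer" for the two-user event.
  With these guesses the mean of ln(weight) is a letterwise computation that yields the rate
  conditions: the terms hb phi and phi ln N pay for a wrong guess, beta pays for the size of the
  list, and the V-part is lost only when the two u-blocks differ.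
*)
theory Submission
  imports Defs "HOL-Probability.Hoeffding" "HOL-Combinatorics.Multiset_Permutations"
begin

section \<open>Random codebooks\<close>

text \<open>The block length \<open>l\<close> stays fixed while the number of blocks grows, so the
  probability that the K-blocks disagree, or that the inner list misses, does not vanish. A fraction
  of bad blocks must be tolerated, and in a bad block the codeword pair no longer follows the test
  channel; typicality with respect to the single-letter law would turn every such block into an
  error. A product weight survives because a bad block only has to contribute a finite logarithm:
  each weight is positive on the whole support, thanks to the summand that carries
  \<open>\<phi>\<close>, and drops its channel part when the K-blocks differ. Testing for this is
  legitimate, since it concerns the candidate pair and not the unknown truth. In the mean, good
  blocks gain information and bad ones cost a bounded amount. The condition
  \<open>\<phi> < 1/2\<close> makes the price of a guess monotone in its error probability, so that
  upper bounds on these probabilities suffice. The mean has to be positive for a single block, by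
  however little, because the number of blocks is free.\<close>

definition codebook_mean ::
  "'a set \<Rightarrow> 'b set \<Rightarrow> ('a \<Rightarrow> 'b \<Rightarrow> real) \<Rightarrow> (('a \<Rightarrow> 'b) \<Rightarrow> real) \<Rightarrow> real" where
  "codebook_mean A B p f = (\<Sum>c\<in>A \<rightarrow>\<^sub>E B. (\<Prod>a\<in>A. p a (c a)) * f c)"

lemma codebook_mean_sum:
  "codebook_mean A B p (\<lambda>c. \<Sum>i\<in>I. f i c) = (\<Sum>i\<in>I. codebook_mean A B p (f i))"
  unfolding codebook_mean_def sum_distrib_left by (rule sum.swap)

lemma codebook_mean_add:
  "codebook_mean A B p (\<lambda>c. f c + g c) = codebook_mean A B p f + codebook_mean A B p g"
  unfolding codebook_mean_def by (simp add: distrib_left sum.distrib)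

lemma codebook_mean_cmult:
  "codebook_mean A B p (\<lambda>c. r * f c) = r * codebook_mean A B p f"
  unfolding codebook_mean_def sum_distrib_left by (simp add: mult_ac)

lemma codebook_mean_mono:
  assumes "\<And>a b. a \<in> A \<Longrightarrow> b \<in> B \<Longrightarrow> 0 \<le> p a b" "\<And>c. c \<in> A \<rightarrow>\<^sub>E B \<Longrightarrow> f c \<le> g c"
  shows "codebook_mean A B p f \<le> codebook_mean A B p g"
  unfolding codebook_mean_def
  by (intro sum_mono mult_left_mono prod_nonneg) (use assms in auto)

text \<open>The weight of a codebook is a product over messages, so the sum over codebooks
  factorises; every factor except the one at \<open>a\<close> equals 1.\<close>

lemma codebook_mean_at:
  assumes "finite A" "finite B" "a \<in> A" "\<And>x. x \<in> A \<Longrightarrow> (\<Sum>b\<in>B. p x b) = 1"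
  shows "codebook_mean A B p (\<lambda>c. h (c a)) = (\<Sum>b\<in>B. p a b * h b)"
proof -
  have "codebook_mean A B p (\<lambda>c. h (c a))
      = (\<Sum>c\<in>A \<rightarrow>\<^sub>E B. \<Prod>x\<in>A. p x (c x) * (if x = a then h (c x) else 1))"
    unfolding codebook_mean_def prod.distrib using assms by simp
  also have "\<dots> = (\<Prod>x\<in>A. \<Sum>b\<in>B. p x b * (if x = a then h b else 1))"
    using assms by (intro prod_sum_PiE[symmetric]) auto
  also have "\<dots> = (\<Prod>x\<in>A. if x = a then (\<Sum>b\<in>B. p x b * h b) else 1)"
    using assms by (intro prod.cong) auto
  also have "\<dots> = (\<Sum>b\<in>B. p a b * h b)"
    using assms by simp
  finally show ?thesis .
qed

lemma codebook_mean_const: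
  assumes "finite A" "finite B" "\<And>x. x \<in> A \<Longrightarrow> (\<Sum>b\<in>B. p x b) = 1"
  shows "codebook_mean A B p (\<lambda>c. r) = r"
proof -
  have "(\<Sum>c\<in>A \<rightarrow>\<^sub>E B. \<Prod>x\<in>A. p x (c x)) = (\<Prod>x\<in>A. \<Sum>b\<in>B. p x b)"
    using assms by (intro prod_sum_PiE[symmetric]) auto
  then show ?thesis
    unfolding codebook_mean_def using assms by (simp flip: sum_distrib_right)
qed

text \<open>Here \<open>h\<close> couples two codewords and does not factorise. Splitting over the
  value \<open>b\<close> of \<open>c a\<close> with an indicator restores a product over messages
  for each fixed \<open>b\<close>.\<close>

lemma codebook_mean_at2:
  assumes "finite A" "finite B" "a \<in> A" "a' \<in> A" "a \<noteq> a'" "\<And>x. x \<in> A \<Longrightarrow> (\<Sum>b\<in>B. p x b) = 1"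
  shows "codebook_mean A B p (\<lambda>c. h (c a) (c a'))
    = (\<Sum>b\<in>B. p a b * (\<Sum>b'\<in>B. p a' b' * h b b'))"
proof -
  have "codebook_mean A B p (\<lambda>c. h (c a) (c a'))
      = (\<Sum>c\<in>A \<rightarrow>\<^sub>E B. \<Sum>b\<in>B. (\<Prod>x\<in>A. p x (c x) *
          ((if x = a then of_bool (c x = b) else 1) * (if x = a' then h b (c x) else 1))))"
    unfolding codebook_mean_def prod.distrib
  proof (intro sum.cong refl)
    fix c assume c: "c \<in> A \<rightarrow>\<^sub>E B"
    have "(\<Sum>b\<in>B. of_bool (c a = b) * h b (c a')) = (\<Sum>b\<in>B. if c a = b then h b (c a') else 0)"
      by (intro sum.cong) auto
    also have "\<dots> = h (c a) (c a')"
      using c assms by (subst sum.delta') (auto simp: PiE_iff)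
    finally have h: "(\<Sum>b\<in>B. of_bool (c a = b) * h b (c a')) = h (c a) (c a')" .
    show "(\<Prod>a\<in>A. p a (c a)) * h (c a) (c a') = (\<Sum>b\<in>B. (\<Prod>x\<in>A. p x (c x)) *
         ((\<Prod>x\<in>A. if x = a then of_bool (c x = b) else 1) * (\<Prod>x\<in>A. if x = a' then h b (c x) else 1)))"
      unfolding sum_distrib_left[symmetric] using assms by (simp add: h)
  qed
  also have "\<dots> = (\<Sum>b\<in>B. \<Sum>c\<in>A \<rightarrow>\<^sub>E B. (\<Prod>x\<in>A. p x (c x) *
          ((if x = a then of_bool (c x = b) else 1) * (if x = a' then h b (c x) else 1))))"
    by (rule sum.swap)
  also have "\<dots> = (\<Sum>b\<in>B. \<Prod>x\<in>A. \<Sum>b'\<in>B. p x b' *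
          ((if x = a then of_bool (b' = b) else 1) * (if x = a' then h b b' else 1)))"
    using assms by (intro sum.cong refl prod_sum_PiE[symmetric]) auto
  also have "\<dots> = (\<Sum>b\<in>B. \<Prod>x\<in>A. (if x = a then p x b else 1) * (if x = a' then (\<Sum>b'\<in>B. p x b' * h b b') else 1))"
  proof (intro sum.cong prod.cong refl)
    fix b x assume b: "b \<in> B" and x: "x \<in> A"
    have "(\<Sum>b'\<in>B. p x b' * of_bool (b' = b)) = (\<Sum>b'\<in>B. if b' = b then p x b' else 0)"
      by (intro sum.cong) auto
    also have "\<dots> = p x b" using b assms by simp
    finally have "(\<Sum>b'\<in>B. p x b' * of_bool (b' = b)) = p x b" .
    then show "(\<Sum>b'\<in>B. p x b' *
          ((if x = a then of_bool (b' = b) else 1) * (if x = a' then h b b' else 1)))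
      = (if x = a then p x b else 1) * (if x = a' then (\<Sum>b'\<in>B. p x b' * h b b') else 1)"
      using assms x by auto
  qed
  also have "\<dots> = (\<Sum>b\<in>B. p a b * (\<Sum>b'\<in>B. p a' b' * h b b'))"
    using assms unfolding prod.distrib by simp
  finally show ?thesis .
qed

lemma exists_le_codebook_mean:
  assumes "finite A" "finite B" "\<And>x. x \<in> A \<Longrightarrow> (\<Sum>b\<in>B. p x b) = 1"
    and "\<And>a b. a \<in> A \<Longrightarrow> b \<in> B \<Longrightarrow> 0 \<le> p a b"
  shows "\<exists>c\<in>A \<rightarrow>\<^sub>E B. f c \<le> codebook_mean A B p f"
proof (rule ccontr)
  let ?m = "codebook_mean A B p f"
  assume "\<not> ?thesis"
  then have gt: "?m < f c" if "c \<in> A \<rightarrow>\<^sub>E B" for c using that by force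
  have w1: "(\<Sum>c\<in>A \<rightarrow>\<^sub>E B. \<Prod>a\<in>A. p a (c a)) = 1"
    using codebook_mean_const[OF assms(1-3), where r = 1] unfolding codebook_mean_def by simp
  have w0: "0 \<le> (\<Prod>a\<in>A. p a (c a))" if "c \<in> A \<rightarrow>\<^sub>E B" for c
    using that assms by (intro prod_nonneg) auto
  \<comment> \<open>A codebook of positive weight is what makes the comparison of the two sums
    strict; with total weight 1 it must exist.\<close>
  have "\<exists>c\<in>A \<rightarrow>\<^sub>E B. (\<Prod>a\<in>A. p a (c a)) \<noteq> 0"
    using w1 by (metis (no_types, lifting) sum.neutral zero_neq_one)
  then obtain c where c: "c \<in> A \<rightarrow>\<^sub>E B" "(\<Prod>a\<in>A. p a (c a)) > 0"
    using w0 by (metis order_le_less)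
  have "(\<Sum>c\<in>A \<rightarrow>\<^sub>E B. (\<Prod>a\<in>A. p a (c a)) * ?m) < (\<Sum>c\<in>A \<rightarrow>\<^sub>E B. (\<Prod>a\<in>A. p a (c a)) * f c)"
  proof (rule sum_strict_mono_ex1)
    show "finite (A \<rightarrow>\<^sub>E B)" using assms by (intro finite_PiE) auto
    show "\<forall>x\<in>A \<rightarrow>\<^sub>E B. (\<Prod>a\<in>A. p a (x a)) * ?m \<le> (\<Prod>a\<in>A. p a (x a)) * f x"
      using gt w0 by (simp add: mult_left_mono less_imp_le)
    show "\<exists>x\<in>A \<rightarrow>\<^sub>E B. (\<Prod>a\<in>A. p a (x a)) * ?m < (\<Prod>a\<in>A. p a (x a)) * f x"
      using gt c by (intro bexI[of _ c]) auto
  qed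
  then have "codebook_mean A B p (\<lambda>_. ?m) < ?m"
    by (simp add: codebook_mean_def)
  then show False using codebook_mean_const[OF assms(1-3), where r = ?m] by simp
qed

lemma codebook_mean_swap:
  "codebook_mean A B p (\<lambda>c. codebook_mean A' B' p' (\<lambda>c'. f c c'))
    = codebook_mean A' B' p' (\<lambda>c'. codebook_mean A B p (\<lambda>c. f c c'))"
  unfolding codebook_mean_def sum_distrib_left
  by (subst sum.swap) (simp add: mult_ac)

lemma codebook_mean_others:
  assumes "finite A" "finite B" "a \<in> A" "\<And>x. x \<in> A \<Longrightarrow> (\<Sum>b\<in>B. p x b) = 1"
  shows "codebook_mean A B p (\<lambda>c. t (c a) * (\<Sum>x\<in>A - {a}. g x (c x)))
    = (\<Sum>b\<in>B. p a b * t b) * (\<Sum>x\<in>A - {a}. \<Sum>b\<in>B. p x b * g x b)"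
proof -
  have "codebook_mean A B p (\<lambda>c. t (c a) * (\<Sum>x\<in>A - {a}. g x (c x)))
      = (\<Sum>x\<in>A - {a}. codebook_mean A B p (\<lambda>c. t (c a) * g x (c x)))"
    by (simp add: sum_distrib_left codebook_mean_sum)
  also have "\<dots> = (\<Sum>x\<in>A - {a}. \<Sum>b\<in>B. p a b * (\<Sum>b'\<in>B. p x b' * (t b * g x b')))"
    using assms by (intro sum.cong refl codebook_mean_at2) auto
  also have "\<dots> = (\<Sum>x\<in>A - {a}. (\<Sum>b\<in>B. p a b * t b) * (\<Sum>b\<in>B. p x b * g x b))"
    unfolding sum_product by (simp add: sum_distrib_left mult_ac)
  finally show ?thesis by (simp add: sum_distrib_left)
qed

text \<open>The output \<open>z\<close> depends on the codeword of the sent message \<open>a\<close>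
  only, so the competing codewords are judged against \<open>z\<close> as if freshly drawn. Adding
  the missing term for \<open>a\<close> only enlarges the sum because \<open>g\<close> is
  nonnegative.\<close>

lemma codebook_mean_others_le:
  assumes "finite A" "finite B" "finite Z" "a \<in> A" "\<And>x. x \<in> A \<Longrightarrow> (\<Sum>b\<in>B. p x b) = 1"
    and p0: "\<And>a b. a \<in> A \<Longrightarrow> b \<in> B \<Longrightarrow> 0 \<le> p a b"
    and t: "\<And>b z. b \<in> B \<Longrightarrow> z \<in> Z \<Longrightarrow> 0 \<le> t b z" "\<And>b. b \<in> B \<Longrightarrow> (\<Sum>z\<in>Z. t b z) = 1"
    and g0: "\<And>x b z. x \<in> A \<Longrightarrow> b \<in> B \<Longrightarrow> z \<in> Z \<Longrightarrow> 0 \<le> g x b z"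
    and g: "\<And>z. z \<in> Z \<Longrightarrow> (\<Sum>x\<in>A. \<Sum>b\<in>B. p x b * g x b z) \<le> \<gamma>"
  shows "codebook_mean A B p (\<lambda>c. \<Sum>z\<in>Z. t (c a) z * (\<Sum>x\<in>A - {a}. g x (c x) z)) \<le> \<gamma>"
proof -
  have "codebook_mean A B p (\<lambda>c. \<Sum>z\<in>Z. t (c a) z * (\<Sum>x\<in>A - {a}. g x (c x) z))
      = (\<Sum>z\<in>Z. (\<Sum>b\<in>B. p a b * t b z) * (\<Sum>x\<in>A - {a}. \<Sum>b\<in>B. p x b * g x b z))"
    unfolding codebook_mean_sum using assms by (intro sum.cong refl codebook_mean_others) auto
  also have "\<dots> \<le> (\<Sum>z\<in>Z. (\<Sum>b\<in>B. p a b * t b z) * \<gamma>)"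
  proof (intro sum_mono mult_left_mono)
    fix z assume z: "z \<in> Z"
    have "(\<Sum>x\<in>A - {a}. \<Sum>b\<in>B. p x b * g x b z) \<le> (\<Sum>x\<in>A. \<Sum>b\<in>B. p x b * g x b z)"
      using assms z by (intro sum_mono2 sum_nonneg mult_nonneg_nonneg) auto
    then show "(\<Sum>x\<in>A - {a}. \<Sum>b\<in>B. p x b * g x b z) \<le> \<gamma>" using g[OF z] by simp
    show "0 \<le> (\<Sum>b\<in>B. p a b * t b z)"
      using assms z by (intro sum_nonneg mult_nonneg_nonneg) auto
  qed
  also have "\<dots> = (\<Sum>b\<in>B. p a b * (\<Sum>z\<in>Z. t b z)) * \<gamma>"
    unfolding sum_distrib_right[symmetric] by (subst sum.swap) (simp add: sum_distrib_left)
  also have "\<dots> = \<gamma>" using assms by simp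
  finally show ?thesis .
qed

text \<open>The decoder returns an arbitrary accepted pair. It errs only if the true pair is
  rejected, or if a pair that is wrong in the first, the second or both components is
  accepted.\<close>

lemma wrong_decoding_le:
  fixes G :: "'a1 \<Rightarrow> 'a2 \<Rightarrow> bool"
  assumes "finite A1" "finite A2" "a1 \<in> A1" "a2 \<in> A2"
    and d: "d = (SOME r. fst r \<in> A1 \<and> snd r \<in> A2 \<and> G (fst r) (snd r))"
  shows "of_bool (d \<noteq> (a1, a2)) \<le> (of_bool (\<not> G a1 a2) + (\<Sum>x\<in>A1 - {a1}. of_bool (G x a2))
      + (\<Sum>y\<in>A2 - {a2}. of_bool (G a1 y)) + (\<Sum>x\<in>A1 - {a1}. \<Sum>y\<in>A2 - {a2}. of_bool (G x y)) :: real)"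
proof (cases "G a1 a2 \<and> d \<noteq> (a1, a2)")
  case True
  obtain x y where xy: "d = (x, y)" by fastforce
  have "fst d \<in> A1 \<and> snd d \<in> A2 \<and> G (fst d) (snd d)"
    unfolding d by (rule someI[of _ "(a1, a2)"]) (use True assms in auto)
  then have xyG: "x \<in> A1" "y \<in> A2" "G x y" using xy by auto
  have 1: "0 \<le> (\<Sum>x\<in>A1 - {a1}. of_bool (G x a2) :: real)"
    "0 \<le> (\<Sum>y\<in>A2 - {a2}. of_bool (G a1 y) :: real)"
    "0 \<le> (\<Sum>x\<in>A1 - {a1}. \<Sum>y\<in>A2 - {a2}. of_bool (G x y) :: real)"
    by (auto intro!: sum_nonneg)
  consider "x \<noteq> a1" "y = a2" | "x = a1" "y \<noteq> a2" | "x \<noteq> a1" "y \<noteq> a2" using True xy by auto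
  then have "1 \<le> (\<Sum>x\<in>A1 - {a1}. of_bool (G x a2))
      + (\<Sum>y\<in>A2 - {a2}. of_bool (G a1 y)) + (\<Sum>x\<in>A1 - {a1}. \<Sum>y\<in>A2 - {a2}. of_bool (G x y) :: real)"
  proof cases
    case 1
    have "of_bool (G x a2) \<le> (\<Sum>x\<in>A1 - {a1}. of_bool (G x a2) :: real)"
      using 1 assms xyG by (intro member_le_sum) auto
    then show ?thesis using 1 xyG \<open>0 \<le> (\<Sum>y\<in>A2 - {a2}. of_bool (G a1 y) :: real)\<close>
      \<open>0 \<le> (\<Sum>x\<in>A1 - {a1}. \<Sum>y\<in>A2 - {a2}. of_bool (G x y) :: real)\<close> by simp
  next
    case 2
    have "of_bool (G a1 y) \<le> (\<Sum>y\<in>A2 - {a2}. of_bool (G a1 y) :: real)"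
      using 2 assms xyG by (intro member_le_sum) auto
    then show ?thesis using 2 xyG 1 by simp
  next
    case 3
    have "of_bool (G x y) \<le> (\<Sum>y\<in>A2 - {a2}. of_bool (G x y) :: real)"
      using 3 assms xyG by (intro member_le_sum) auto
    also have "\<dots> \<le> (\<Sum>x\<in>A1 - {a1}. \<Sum>y\<in>A2 - {a2}. of_bool (G x y) :: real)"
      using 3 assms xyG by (intro member_le_sum[where f = "\<lambda>x. \<Sum>y\<in>A2 - {a2}. of_bool (G x y) :: real"])
        (auto intro!: sum_nonneg)
    finally show ?thesis using xyG 1 by simp
  qed
  then show ?thesis using True by simp
next
  case False
  have 1: "0 \<le> (\<Sum>x\<in>A1 - {a1}. of_bool (G x a2) :: real)"
    "0 \<le> (\<Sum>y\<in>A2 - {a2}. of_bool (G a1 y) :: real)"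
    "0 \<le> (\<Sum>x\<in>A1 - {a1}. \<Sum>y\<in>A2 - {a2}. of_bool (G x y) :: real)"
    by (auto intro!: sum_nonneg)
  then show ?thesis using False by auto
qed

text \<open>\<open>T\<close> is the channel from codeword pairs to outputs and \<open>G\<close> the
  acceptance test. \<open>G1\<close> to \<open>G3\<close> bound, for every fixed output, the mean
  number of accepted candidates when one or both codewords are redrawn, so each kind of wrong pair
  costs \<open>\<gamma>\<close> whatever was sent. What remains is the rejection of the true pair,
  which involves its own two codewords only.\<close>

lemma random_coding_bound:
  fixes Q :: "'a1 \<Rightarrow> 'a2 \<Rightarrow> real" and T :: "'b1 \<Rightarrow> 'b2 \<Rightarrow> 'z \<Rightarrow> real"
    and G :: "'a1 \<Rightarrow> 'a2 \<Rightarrow> 'b1 \<Rightarrow> 'b2 \<Rightarrow> 'z \<Rightarrow> bool"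
  assumes fin: "finite A1" "finite A2" "finite B1" "finite B2" "finite Z"
    and Q: "\<And>a1 a2. a1 \<in> A1 \<Longrightarrow> a2 \<in> A2 \<Longrightarrow> 0 \<le> Q a1 a2" "(\<Sum>a1\<in>A1. \<Sum>a2\<in>A2. Q a1 a2) = 1"
    and p1: "\<And>a b. a \<in> A1 \<Longrightarrow> b \<in> B1 \<Longrightarrow> 0 \<le> p1 a b" "\<And>a. a \<in> A1 \<Longrightarrow> (\<Sum>b\<in>B1. p1 a b) = 1"
    and p2: "\<And>a b. a \<in> A2 \<Longrightarrow> b \<in> B2 \<Longrightarrow> 0 \<le> p2 a b" "\<And>a. a \<in> A2 \<Longrightarrow> (\<Sum>b\<in>B2. p2 a b) = 1"
    and T: "\<And>b1 b2 z. b1 \<in> B1 \<Longrightarrow> b2 \<in> B2 \<Longrightarrow> z \<in> Z \<Longrightarrow> 0 \<le> T b1 b2 z"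
      "\<And>b1 b2. b1 \<in> B1 \<Longrightarrow> b2 \<in> B2 \<Longrightarrow> (\<Sum>z\<in>Z. T b1 b2 z) = 1"
    and G1: "\<And>a2 b2 z. a2 \<in> A2 \<Longrightarrow> b2 \<in> B2 \<Longrightarrow> z \<in> Z \<Longrightarrow>
      (\<Sum>a1\<in>A1. \<Sum>b1\<in>B1. p1 a1 b1 * of_bool (G a1 a2 b1 b2 z)) \<le> \<gamma>"
    and G2: "\<And>a1 b1 z. a1 \<in> A1 \<Longrightarrow> b1 \<in> B1 \<Longrightarrow> z \<in> Z \<Longrightarrow>
      (\<Sum>a2\<in>A2. \<Sum>b2\<in>B2. p2 a2 b2 * of_bool (G a1 a2 b1 b2 z)) \<le> \<gamma>"
    and G3: "\<And>z. z \<in> Z \<Longrightarrow> (\<Sum>a1\<in>A1. \<Sum>b1\<in>B1. p1 a1 b1 *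
      (\<Sum>a2\<in>A2. \<Sum>b2\<in>B2. p2 a2 b2 * of_bool (G a1 a2 b1 b2 z))) \<le> \<gamma>"
  shows "\<exists>c1\<in>A1 \<rightarrow>\<^sub>E B1. \<exists>c2\<in>A2 \<rightarrow>\<^sub>E B2. \<exists>d.
    (\<Sum>a1\<in>A1. \<Sum>a2\<in>A2. Q a1 a2 * (\<Sum>z\<in>Z. T (c1 a1) (c2 a2) z * of_bool (d z \<noteq> (a1, a2))))
    \<le> (\<Sum>a1\<in>A1. \<Sum>a2\<in>A2. Q a1 a2 * (\<Sum>b1\<in>B1. p1 a1 b1 * (\<Sum>b2\<in>B2. p2 a2 b2 *
        (\<Sum>z\<in>Z. T b1 b2 z * of_bool (\<not> G a1 a2 b1 b2 z))))) + 3 * \<gamma>"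
proof -
  let ?M1 = "codebook_mean A1 B1 p1" and ?M2 = "codebook_mean A2 B2 p2"
  define f0 where "f0 a1 a2 c1 c2 = (\<Sum>z\<in>Z. T (c1 a1) (c2 a2) z *
      of_bool (\<not> G a1 a2 (c1 a1) (c2 a2) z))" for a1 a2 c1 c2
  define f1 where "f1 a1 a2 c1 c2 = (\<Sum>z\<in>Z. T (c1 a1) (c2 a2) z *
      (\<Sum>x\<in>A1 - {a1}. of_bool (G x a2 (c1 x) (c2 a2) z)))" for a1 a2 c1 c2
  define f2 where "f2 a1 a2 c1 c2 = (\<Sum>z\<in>Z. T (c1 a1) (c2 a2) z *
      (\<Sum>y\<in>A2 - {a2}. of_bool (G a1 y (c1 a1) (c2 y) z)))" for a1 a2 c1 c2
  define f3 where "f3 a1 a2 c1 c2 = (\<Sum>z\<in>Z. T (c1 a1) (c2 a2) z *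
      (\<Sum>x\<in>A1 - {a1}. \<Sum>y\<in>A2 - {a2}. of_bool (G x y (c1 x) (c2 y) z)))" for a1 a2 c1 c2
  define F where "F c1 c2 = (\<Sum>a1\<in>A1. \<Sum>a2\<in>A2. Q a1 a2 *
      (f0 a1 a2 c1 c2 + f1 a1 a2 c1 c2 + f2 a1 a2 c1 c2 + f3 a1 a2 c1 c2))" for c1 c2
  define e0 where "e0 a1 a2 = (\<Sum>b1\<in>B1. p1 a1 b1 * (\<Sum>b2\<in>B2. p2 a2 b2 *
        (\<Sum>z\<in>Z. T b1 b2 z * of_bool (\<not> G a1 a2 b1 b2 z))))" for a1 a2
  have m0: "?M1 (\<lambda>c1. ?M2 (f0 a1 a2 c1)) = e0 a1 a2" if "a1 \<in> A1" "a2 \<in> A2" for a1 a2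
  proof -
    let ?h = "\<lambda>b1 b2. \<Sum>z\<in>Z. T b1 b2 z * of_bool (\<not> G a1 a2 b1 b2 z)"
    have "?M2 (f0 a1 a2 c1) = (\<Sum>b2\<in>B2. p2 a2 b2 * ?h (c1 a1) b2)" for c1
      unfolding f0_def using codebook_mean_at[of A2 B2 a2 p2 "?h (c1 a1)"] fin p2 that by simp
    then have "?M1 (\<lambda>c1. ?M2 (f0 a1 a2 c1)) = ?M1 (\<lambda>c1. \<Sum>b2\<in>B2. p2 a2 b2 * ?h (c1 a1) b2)"
      by simp
    also have "\<dots> = e0 a1 a2"
      unfolding e0_def
      using codebook_mean_at[of A1 B1 a1 p1 "\<lambda>b1. \<Sum>b2\<in>B2. p2 a2 b2 * ?h b1 b2"] fin p1 that by simp
    finally show ?thesis .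
  qed
  have m2: "?M1 (\<lambda>c1. ?M2 (f2 a1 a2 c1)) \<le> \<gamma>" if a: "a1 \<in> A1" "a2 \<in> A2" for a1 a2
  proof -
    have "?M1 (\<lambda>c1. ?M2 (f2 a1 a2 c1)) \<le> ?M1 (\<lambda>c1. \<gamma>)"
    proof (rule codebook_mean_mono)
      fix c1 assume "c1 \<in> A1 \<rightarrow>\<^sub>E B1"
      then have c1: "c1 a1 \<in> B1" using a by auto
      show "?M2 (f2 a1 a2 c1) \<le> \<gamma>"
        unfolding f2_def
        by (rule codebook_mean_others_le[where t = "T (c1 a1)" and g = "\<lambda>y b2 z. of_bool (G a1 y (c1 a1) b2 z)"])
          (use fin a c1 p2 T G2[OF a(1) c1] in auto)
    qed (use p1 in auto)
    then show ?thesis using codebook_mean_const[of A1 B1 p1 \<gamma>] fin p1 by simp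
  qed
  \<comment> \<open>With only the first component wrong, user 2's codeword is the one that was sent.
    The average over user 1's codebook has to be taken first, with \<open>c2\<close> fixed.\<close>
  have m1: "?M1 (\<lambda>c1. ?M2 (f1 a1 a2 c1)) \<le> \<gamma>" if a: "a1 \<in> A1" "a2 \<in> A2" for a1 a2
  proof -
    have "?M1 (\<lambda>c1. ?M2 (f1 a1 a2 c1)) = ?M2 (\<lambda>c2. ?M1 (\<lambda>c1. f1 a1 a2 c1 c2))"
      by (rule codebook_mean_swap)
    also have "\<dots> \<le> ?M2 (\<lambda>c2. \<gamma>)"
    proof (rule codebook_mean_mono)
      fix c2 assume "c2 \<in> A2 \<rightarrow>\<^sub>E B2"
      then have c2: "c2 a2 \<in> B2" using a by auto
      show "?M1 (\<lambda>c1. f1 a1 a2 c1 c2) \<le> \<gamma>"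
        unfolding f1_def
        by (rule codebook_mean_others_le[where t = "\<lambda>b. T b (c2 a2)" and g = "\<lambda>x b1 z. of_bool (G x a2 b1 (c2 a2) z)"])
          (use fin a c2 p1 T G1[OF a(2) c2] in auto)
    qed (use p2 in auto)
    finally show ?thesis using codebook_mean_const[of A2 B2 p2 \<gamma>] fin p2 by simp
  qed
  \<comment> \<open>Averaging over \<open>c2\<close> turns both the law of the output
    (\<open>?t\<close>) and the number of accepted pairs (\<open>?g\<close>) into functions of user
    1's codewords alone, so the bound for one codebook applies once more.\<close>
  have m3: "?M1 (\<lambda>c1. ?M2 (f3 a1 a2 c1)) \<le> \<gamma>" if a: "a1 \<in> A1" "a2 \<in> A2" for a1 a2
  proof -
    let ?t = "\<lambda>b1 z. \<Sum>b2\<in>B2. p2 a2 b2 * T b1 b2 z"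
    let ?g = "\<lambda>x b1 z. \<Sum>y\<in>A2 - {a2}. \<Sum>b2\<in>B2. p2 y b2 * of_bool (G x y b1 b2 z)"
    have "?M2 (f3 a1 a2 c1) = (\<Sum>z\<in>Z. ?t (c1 a1) z * (\<Sum>x\<in>A1 - {a1}. ?g x (c1 x) z))" for c1
    proof -
      have "?M2 (f3 a1 a2 c1) = (\<Sum>z\<in>Z. ?M2 (\<lambda>c2. T (c1 a1) (c2 a2) z *
          (\<Sum>y\<in>A2 - {a2}. \<Sum>x\<in>A1 - {a1}. of_bool (G x y (c1 x) (c2 y) z))))"
        unfolding f3_def codebook_mean_sum[of A2 B2 p2 _ Z, symmetric] by (subst sum.swap) simp
      also have "\<dots> = (\<Sum>z\<in>Z. ?t (c1 a1) z * (\<Sum>y\<in>A2 - {a2}. \<Sum>b2\<in>B2. p2 y b2 *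
          (\<Sum>x\<in>A1 - {a1}. of_bool (G x y (c1 x) b2 z))))"
        using fin a p2
        by (intro sum.cong refl codebook_mean_others[where t = "\<lambda>b2. T (c1 a1) b2 z" and
              g = "\<lambda>y b2. \<Sum>x\<in>A1 - {a1}. of_bool (G x y (c1 x) b2 z)" for z]) auto
      also have "\<dots> = (\<Sum>z\<in>Z. ?t (c1 a1) z * (\<Sum>x\<in>A1 - {a1}. ?g x (c1 x) z))"
      proof (intro sum.cong refl arg_cong2[where f = "(*)"])
        fix z
        have "(\<Sum>y\<in>A2 - {a2}. \<Sum>b2\<in>B2. p2 y b2 * (\<Sum>x\<in>A1 - {a1}. of_bool (G x y (c1 x) b2 z)))
          = (\<Sum>y\<in>A2 - {a2}. \<Sum>x\<in>A1 - {a1}. \<Sum>b2\<in>B2. p2 y b2 * of_bool (G x y (c1 x) b2 z))"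
          unfolding sum_distrib_left by (intro sum.cong refl sum.swap)
        also have "\<dots> = (\<Sum>x\<in>A1 - {a1}. ?g x (c1 x) z)" by (rule sum.swap)
        finally show "(\<Sum>y\<in>A2 - {a2}. \<Sum>b2\<in>B2. p2 y b2 * (\<Sum>x\<in>A1 - {a1}. of_bool (G x y (c1 x) b2 z)))
          = (\<Sum>x\<in>A1 - {a1}. ?g x (c1 x) z)" .
      qed
      finally show ?thesis .
    qed
    then have "?M1 (\<lambda>c1. ?M2 (f3 a1 a2 c1))
        = ?M1 (\<lambda>c1. \<Sum>z\<in>Z. ?t (c1 a1) z * (\<Sum>x\<in>A1 - {a1}. ?g x (c1 x) z))"
      by simp
    also have "\<dots> \<le> \<gamma>"
    proof (rule codebook_mean_others_le[where t = ?t and g = ?g])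
      show "(\<Sum>z\<in>Z. ?t b z) = 1" if "b \<in> B1" for b
      proof -
        have "(\<Sum>z\<in>Z. ?t b z) = (\<Sum>b2\<in>B2. p2 a2 b2 * (\<Sum>z\<in>Z. T b b2 z))"
          by (subst sum.swap) (simp add: sum_distrib_left)
        then show ?thesis using T p2 a that by simp
      qed
      show "(\<Sum>x\<in>A1. \<Sum>b\<in>B1. p1 x b * ?g x b z) \<le> \<gamma>" if z: "z \<in> Z" for z
      proof -
        have "(\<Sum>x\<in>A1. \<Sum>b\<in>B1. p1 x b * ?g x b z)
           \<le> (\<Sum>a1\<in>A1. \<Sum>b1\<in>B1. p1 a1 b1 * (\<Sum>a2\<in>A2. \<Sum>b2\<in>B2. p2 a2 b2 * of_bool (G a1 a2 b1 b2 z)))"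
          by (intro sum_mono mult_left_mono sum_mono2 sum_nonneg) (use fin p1 p2 in auto)
        then show ?thesis using G3[OF z] by simp
      qed
    qed (use fin a p1 p2 T in \<open>auto intro!: sum_nonneg\<close>)
    finally show ?thesis .
  qed
  have "?M1 (\<lambda>c1. ?M2 (F c1)) = (\<Sum>a1\<in>A1. \<Sum>a2\<in>A2. Q a1 a2 * (?M1 (\<lambda>c1. ?M2 (f0 a1 a2 c1))
      + ?M1 (\<lambda>c1. ?M2 (f1 a1 a2 c1)) + ?M1 (\<lambda>c1. ?M2 (f2 a1 a2 c1)) + ?M1 (\<lambda>c1. ?M2 (f3 a1 a2 c1))))"
    unfolding F_def codebook_mean_sum codebook_mean_cmult codebook_mean_add ..
  also have "\<dots> \<le> (\<Sum>a1\<in>A1. \<Sum>a2\<in>A2. Q a1 a2 * (e0 a1 a2 + \<gamma> + \<gamma> + \<gamma>))"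
    by (intro sum_mono mult_left_mono add_mono) (use m0 m1 m2 m3 Q in auto)
  also have "\<dots> = (\<Sum>a1\<in>A1. \<Sum>a2\<in>A2. Q a1 a2 * e0 a1 a2) + (\<Sum>a1\<in>A1. \<Sum>a2\<in>A2. Q a1 a2) * (3 * \<gamma>)"
    by (simp add: sum_distrib_right distrib_left sum.distrib)
  finally have le: "?M1 (\<lambda>c1. ?M2 (F c1)) \<le> (\<Sum>a1\<in>A1. \<Sum>a2\<in>A2. Q a1 a2 * e0 a1 a2) + 3 * \<gamma>"
    using Q by simp
  obtain c1 where c1: "c1 \<in> A1 \<rightarrow>\<^sub>E B1" "?M2 (F c1) \<le> ?M1 (\<lambda>c1. ?M2 (F c1))"
    using exists_le_codebook_mean[of A1 B1 p1 "\<lambda>c1. ?M2 (F c1)"] fin p1 by blast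
  obtain c2 where c2: "c2 \<in> A2 \<rightarrow>\<^sub>E B2" "F c1 c2 \<le> ?M2 (F c1)"
    using exists_le_codebook_mean[of A2 B2 p2 "F c1"] fin p2 by blast
  define d where "d z = (SOME r. fst r \<in> A1 \<and> snd r \<in> A2 \<and>
      G (fst r) (snd r) (c1 (fst r)) (c2 (snd r)) z)" for z
  have c: "c1 a1 \<in> B1" "c2 a2 \<in> B2" if "a1 \<in> A1" "a2 \<in> A2" for a1 a2
    using c1 c2 that by auto
  have "(\<Sum>a1\<in>A1. \<Sum>a2\<in>A2. Q a1 a2 * (\<Sum>z\<in>Z. T (c1 a1) (c2 a2) z * of_bool (d z \<noteq> (a1, a2))))
     \<le> F c1 c2"
    unfolding F_def
  proof (intro sum_mono mult_left_mono)
    fix a1 a2 assume a: "a1 \<in> A1" "a2 \<in> A2"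
    have "(\<Sum>z\<in>Z. T (c1 a1) (c2 a2) z * of_bool (d z \<noteq> (a1, a2))) \<le> (\<Sum>z\<in>Z. T (c1 a1) (c2 a2) z *
       (of_bool (\<not> G a1 a2 (c1 a1) (c2 a2) z) + (\<Sum>x\<in>A1 - {a1}. of_bool (G x a2 (c1 x) (c2 a2) z))
      + (\<Sum>y\<in>A2 - {a2}. of_bool (G a1 y (c1 a1) (c2 y) z))
      + (\<Sum>x\<in>A1 - {a1}. \<Sum>y\<in>A2 - {a2}. of_bool (G x y (c1 x) (c2 y) z))))"
      using T(1)[OF c[OF a]]
      by (intro sum_mono mult_left_mono
          wrong_decoding_le[of A1 A2 a1 a2 "d z" "\<lambda>x y. G x y (c1 x) (c2 y) z" for z])
        (use fin a in \<open>auto simp: d_def\<close>)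
    also have "\<dots> = f0 a1 a2 c1 c2 + f1 a1 a2 c1 c2 + f2 a1 a2 c1 c2 + f3 a1 a2 c1 c2"
      unfolding f0_def f1_def f2_def f3_def by (simp only: distrib_left sum.distrib)
    finally show "(\<Sum>z\<in>Z. T (c1 a1) (c2 a2) z * of_bool (d z \<noteq> (a1, a2)))
      \<le> f0 a1 a2 c1 c2 + f1 a1 a2 c1 c2 + f2 a1 a2 c1 c2 + f3 a1 a2 c1 c2" .
  qed (use Q in auto)
  then show ?thesis using c1 c2 le unfolding e0_def by (intro bexI[of _ c1] bexI[of _ c2] exI[of _ d]) auto
qed

section \<open>Products of block channels\<close>

lemma prod_sum_PiE2:
  assumes "finite I" "\<And>i. i \<in> I \<Longrightarrow> finite (A i)" "\<And>i. i \<in> I \<Longrightarrow> finite (B i)"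
  shows "(\<Sum>a\<in>Pi\<^sub>E I A. \<Sum>b\<in>Pi\<^sub>E I B. \<Prod>i\<in>I. F i (a i) (b i))
    = (\<Prod>i\<in>I. \<Sum>x\<in>A i. \<Sum>y\<in>B i. (F i x y :: real))"
  using assms by (simp add: prod_sum_PiE cong: prod.cong)

lemma prod_sum_PiE5:
  assumes "finite I" "\<And>i. i \<in> I \<Longrightarrow> finite (A i)" "\<And>i. i \<in> I \<Longrightarrow> finite (B i)"
    "\<And>i. i \<in> I \<Longrightarrow> finite (C i)" "\<And>i. i \<in> I \<Longrightarrow> finite (D i)" "\<And>i. i \<in> I \<Longrightarrow> finite (E i)"
  shows "(\<Sum>a\<in>Pi\<^sub>E I A. \<Sum>b\<in>Pi\<^sub>E I B. \<Sum>c\<in>Pi\<^sub>E I C. \<Sum>d\<in>Pi\<^sub>E I D. \<Sum>e\<in>Pi\<^sub>E I E.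
      \<Prod>i\<in>I. F i (a i) (b i) (c i) (d i) (e i))
    = (\<Prod>i\<in>I. \<Sum>x\<in>A i. \<Sum>y\<in>B i. \<Sum>z\<in>C i. \<Sum>u\<in>D i. \<Sum>v\<in>E i. (F i x y z u v :: real))"
  using assms by (simp add: prod_sum_PiE cong: prod.cong)

text \<open>Chernoff's form of Markov's inequality: on the event, the product of \<open>L\<close>
  and \<open>\<gamma>\<close> is at most 1, hence its negative power at least 1.\<close>

lemma of_bool_less_le_powr:
  assumes "0 < L" "0 < \<gamma>" "0 < (t::real)"
  shows "of_bool (L < 1 / \<gamma>) \<le> \<gamma> powr (- t) * L powr (- t)"
proof (cases "L < 1 / \<gamma>")
  case True
  then have "L * \<gamma> \<le> 1" using assms by (simp add: field_simps)
  then have "(L * \<gamma>) powr t \<le> 1" using assms powr_mono2[of t "L * \<gamma>" 1] by simp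
  then have "1 \<le> (L * \<gamma>) powr (- t)" using assms by (simp add: powr_minus field_simps)
  then show ?thesis using True assms by (simp add: powr_mult mult_ac)
qed (use assms in simp)

text \<open>\<open>H1\<close> to \<open>H3\<close> say that each block weight has total mean at most
  1 over redrawn candidates; this multiplies over the blocks, and the threshold
  \<open>1 / \<gamma>\<close> then lets through at most \<open>\<gamma>\<close> wrong candidates on
  average. Rejection of the true pair is bounded by negative moments, which also multiply. Alphabets
  depend on the index so that a shorter last block with dummy codewords fits in.\<close>

lemma product_coding_bound:
  fixes Q :: "'i \<Rightarrow> 'a1 \<Rightarrow> 'a2 \<Rightarrow> real" and T :: "'i \<Rightarrow> 'b1 \<Rightarrow> 'b2 \<Rightarrow> 'z \<Rightarrow> real"
    and L1 L2 L3 :: "'i \<Rightarrow> 'a1 \<Rightarrow> 'a2 \<Rightarrow> 'b1 \<Rightarrow> 'b2 \<Rightarrow> 'z \<Rightarrow> real"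
    and A1 A2 B1 B2 Z p1 p2
  defines "E \<equiv> \<lambda>i f. \<Sum>a1\<in>A1 i. \<Sum>a2\<in>A2 i. \<Sum>b1\<in>B1 i. \<Sum>b2\<in>B2 i. \<Sum>z\<in>Z i.
      Q i a1 a2 * p1 i a1 b1 * p2 i a2 b2 * T i b1 b2 z * f a1 a2 b1 b2 z"
  assumes I: "finite I"
    and fin: "\<And>i. i \<in> I \<Longrightarrow> finite (A1 i)" "\<And>i. i \<in> I \<Longrightarrow> finite (A2 i)"
      "\<And>i. i \<in> I \<Longrightarrow> finite (B1 i)" "\<And>i. i \<in> I \<Longrightarrow> finite (B2 i)" "\<And>i. i \<in> I \<Longrightarrow> finite (Z i)"
    and Q: "\<And>i a1 a2. i \<in> I \<Longrightarrow> a1 \<in> A1 i \<Longrightarrow> a2 \<in> A2 i \<Longrightarrow> 0 \<le> Q i a1 a2"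
      "\<And>i. i \<in> I \<Longrightarrow> (\<Sum>a1\<in>A1 i. \<Sum>a2\<in>A2 i. Q i a1 a2) = 1"
    and p1: "\<And>i a b. i \<in> I \<Longrightarrow> a \<in> A1 i \<Longrightarrow> b \<in> B1 i \<Longrightarrow> 0 \<le> p1 i a b"
      "\<And>i a. i \<in> I \<Longrightarrow> a \<in> A1 i \<Longrightarrow> (\<Sum>b\<in>B1 i. p1 i a b) = 1"
    and p2: "\<And>i a b. i \<in> I \<Longrightarrow> a \<in> A2 i \<Longrightarrow> b \<in> B2 i \<Longrightarrow> 0 \<le> p2 i a b"
      "\<And>i a. i \<in> I \<Longrightarrow> a \<in> A2 i \<Longrightarrow> (\<Sum>b\<in>B2 i. p2 i a b) = 1"
    and T: "\<And>i b1 b2 z. i \<in> I \<Longrightarrow> b1 \<in> B1 i \<Longrightarrow> b2 \<in> B2 i \<Longrightarrow> z \<in> Z i \<Longrightarrow> 0 \<le> T i b1 b2 z"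
      "\<And>i b1 b2. i \<in> I \<Longrightarrow> b1 \<in> B1 i \<Longrightarrow> b2 \<in> B2 i \<Longrightarrow> (\<Sum>z\<in>Z i. T i b1 b2 z) = 1"
    and L0: "\<And>i a1 a2 b1 b2 z. i \<in> I \<Longrightarrow> a1 \<in> A1 i \<Longrightarrow> a2 \<in> A2 i \<Longrightarrow> b1 \<in> B1 i \<Longrightarrow> b2 \<in> B2 i \<Longrightarrow> z \<in> Z i
      \<Longrightarrow> 0 \<le> L1 i a1 a2 b1 b2 z \<and> 0 \<le> L2 i a1 a2 b1 b2 z \<and> 0 \<le> L3 i a1 a2 b1 b2 z"
    and Lpos: "\<And>i a1 a2 b1 b2 z. i \<in> I \<Longrightarrow> a1 \<in> A1 i \<Longrightarrow> a2 \<in> A2 i \<Longrightarrow> b1 \<in> B1 i \<Longrightarrow> b2 \<in> B2 i \<Longrightarrow> z \<in> Z i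
      \<Longrightarrow> Q i a1 a2 \<noteq> 0 \<Longrightarrow> p1 i a1 b1 \<noteq> 0 \<Longrightarrow> p2 i a2 b2 \<noteq> 0 \<Longrightarrow> T i b1 b2 z \<noteq> 0
      \<Longrightarrow> L1 i a1 a2 b1 b2 z \<noteq> 0 \<and> L2 i a1 a2 b1 b2 z \<noteq> 0 \<and> L3 i a1 a2 b1 b2 z \<noteq> 0"
    and H1: "\<And>i a2 b2 z. i \<in> I \<Longrightarrow> a2 \<in> A2 i \<Longrightarrow> b2 \<in> B2 i \<Longrightarrow> z \<in> Z i \<Longrightarrow>
      (\<Sum>a1\<in>A1 i. \<Sum>b1\<in>B1 i. p1 i a1 b1 * L1 i a1 a2 b1 b2 z) \<le> 1"
    and H2: "\<And>i a1 b1 z. i \<in> I \<Longrightarrow> a1 \<in> A1 i \<Longrightarrow> b1 \<in> B1 i \<Longrightarrow> z \<in> Z i \<Longrightarrow>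
      (\<Sum>a2\<in>A2 i. \<Sum>b2\<in>B2 i. p2 i a2 b2 * L2 i a1 a2 b1 b2 z) \<le> 1"
    and H3: "\<And>i z. i \<in> I \<Longrightarrow> z \<in> Z i \<Longrightarrow>
      (\<Sum>a1\<in>A1 i. \<Sum>b1\<in>B1 i. \<Sum>a2\<in>A2 i. \<Sum>b2\<in>B2 i. p1 i a1 b1 * p2 i a2 b2 * L3 i a1 a2 b1 b2 z) \<le> 1"
    and \<gamma>: "0 < \<gamma>" and t: "0 < t"
  shows "\<exists>c1\<in>Pi\<^sub>E I A1 \<rightarrow>\<^sub>E Pi\<^sub>E I B1. \<exists>c2\<in>Pi\<^sub>E I A2 \<rightarrow>\<^sub>E Pi\<^sub>E I B2. \<exists>d.
    (\<Sum>a1\<in>Pi\<^sub>E I A1. \<Sum>a2\<in>Pi\<^sub>E I A2. (\<Prod>i\<in>I. Q i (a1 i) (a2 i)) *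
      (\<Sum>z\<in>Pi\<^sub>E I Z. (\<Prod>i\<in>I. T i (c1 a1 i) (c2 a2 i) (z i)) * of_bool (d z \<noteq> (a1, a2))))
    \<le> \<gamma> powr (- t) * ((\<Prod>i\<in>I. E i (\<lambda>a1 a2 b1 b2 z. L1 i a1 a2 b1 b2 z powr (- t)))
      + (\<Prod>i\<in>I. E i (\<lambda>a1 a2 b1 b2 z. L2 i a1 a2 b1 b2 z powr (- t)))
      + (\<Prod>i\<in>I. E i (\<lambda>a1 a2 b1 b2 z. L3 i a1 a2 b1 b2 z powr (- t)))) + 3 * \<gamma>"
    (is "\<exists>c1\<in>_. \<exists>c2\<in>_. \<exists>d. ?err c1 c2 d \<le> ?tails + _")
proof -
  let ?PL = "\<lambda>L a1 a2 b1 b2 z. \<Prod>i\<in>I. L i (a1 i) (a2 i) (b1 i) (b2 i) (z i) :: real"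
  define G where "G a1 a2 b1 b2 z \<longleftrightarrow> 1 / \<gamma> \<le> ?PL L1 a1 a2 b1 b2 z \<and> 1 / \<gamma> \<le> ?PL L2 a1 a2 b1 b2 z
    \<and> 1 / \<gamma> \<le> ?PL L3 a1 a2 b1 b2 z" for a1 a2 b1 b2 z
  have G_le: "of_bool (G a1 a2 b1 b2 z) \<le> \<gamma> * ?PL L a1 a2 b1 b2 z"
    if "a1 \<in> Pi\<^sub>E I A1" "a2 \<in> Pi\<^sub>E I A2" "b1 \<in> Pi\<^sub>E I B1" "b2 \<in> Pi\<^sub>E I B2" "z \<in> Pi\<^sub>E I Z"
      "L = L1 \<or> L = L2 \<or> L = L3" for a1 a2 b1 b2 z L
  proof (cases "G a1 a2 b1 b2 z")
    case True
    then have "1 / \<gamma> \<le> ?PL L a1 a2 b1 b2 z" using that unfolding G_def by auto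
    then show ?thesis using True \<gamma> by (simp add: field_simps)
  next
    case False
    have "0 \<le> ?PL L a1 a2 b1 b2 z"
      using that L0 by (intro prod_nonneg) (auto simp: PiE_iff)
    then show ?thesis using False \<gamma> by simp
  qed
  define J where "J a1 a2 b1 b2 z = (\<Prod>i\<in>I. Q i (a1 i) (a2 i)) * (\<Prod>i\<in>I. p1 i (a1 i) (b1 i))
    * (\<Prod>i\<in>I. p2 i (a2 i) (b2 i)) * (\<Prod>i\<in>I. T i (b1 i) (b2 i) (z i))" for a1 a2 b1 b2 z
  define S where "S f = (\<Sum>a1\<in>Pi\<^sub>E I A1. \<Sum>a2\<in>Pi\<^sub>E I A2. \<Sum>b1\<in>Pi\<^sub>E I B1. \<Sum>b2\<in>Pi\<^sub>E I B2. \<Sum>z\<in>Pi\<^sub>E I Z.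
      J a1 a2 b1 b2 z * f a1 a2 b1 b2 z)" for f :: "_ \<Rightarrow> _ \<Rightarrow> _ \<Rightarrow> _ \<Rightarrow> _ \<Rightarrow> real"
  have J0: "0 \<le> J a1 a2 b1 b2 z"
    if "a1 \<in> Pi\<^sub>E I A1" "a2 \<in> Pi\<^sub>E I A2" "b1 \<in> Pi\<^sub>E I B1" "b2 \<in> Pi\<^sub>E I B2" "z \<in> Pi\<^sub>E I Z"
    for a1 a2 b1 b2 z
    unfolding J_def using that Q p1 p2 T by (intro mult_nonneg_nonneg prod_nonneg) (auto simp: PiE_iff)
  have tail: "S (\<lambda>a1 a2 b1 b2 z. of_bool (?PL L a1 a2 b1 b2 z < 1 / \<gamma>))
     \<le> \<gamma> powr (- t) * (\<Prod>i\<in>I. E i (\<lambda>a1 a2 b1 b2 z. L i a1 a2 b1 b2 z powr (- t)))"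
    if L: "L = L1 \<or> L = L2 \<or> L = L3" for L
  proof -
    have "S (\<lambda>a1 a2 b1 b2 z. of_bool (?PL L a1 a2 b1 b2 z < 1 / \<gamma>))
      \<le> S (\<lambda>a1 a2 b1 b2 z. \<gamma> powr (- t) * (\<Prod>i\<in>I. L i (a1 i) (a2 i) (b1 i) (b2 i) (z i) powr (- t)))"
      unfolding S_def
    proof (intro sum_mono)
      fix a1 a2 b1 b2 z
      assume m: "a1 \<in> Pi\<^sub>E I A1" "a2 \<in> Pi\<^sub>E I A2" "b1 \<in> Pi\<^sub>E I B1" "b2 \<in> Pi\<^sub>E I B2" "z \<in> Pi\<^sub>E I Z"
      have nn: "0 \<le> L i (a1 i) (a2 i) (b1 i) (b2 i) (z i)" if "i \<in> I" for i
        using m L L0 that by (auto simp: PiE_iff)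
      show "J a1 a2 b1 b2 z * of_bool (?PL L a1 a2 b1 b2 z < 1 / \<gamma>) \<le> J a1 a2 b1 b2 z *
         (\<gamma> powr (- t) * (\<Prod>i\<in>I. L i (a1 i) (a2 i) (b1 i) (b2 i) (z i) powr (- t)))"
      proof (cases "J a1 a2 b1 b2 z = 0")
        case False
        \<comment> \<open>\<open>powr\<close> is 0 at base 0, so a vanishing weight would be
          rejected without being charged on the right-hand side. \<open>Lpos\<close> rules this out
          on the support.\<close>
        have "L i (a1 i) (a2 i) (b1 i) (b2 i) (z i) \<noteq> 0" if i: "i \<in> I" for i
        proof -
          have "Q i (a1 i) (a2 i) \<noteq> 0" "p1 i (a1 i) (b1 i) \<noteq> 0" "p2 i (a2 i) (b2 i) \<noteq> 0"
            "T i (b1 i) (b2 i) (z i) \<noteq> 0"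
            using False i I unfolding J_def by auto
          then show ?thesis using Lpos[of i "a1 i" "a2 i" "b1 i" "b2 i" "z i"] m L i by (auto simp: PiE_iff)
        qed
        then have "0 < ?PL L a1 a2 b1 b2 z" using nn by (intro prod_pos) (simp add: order_less_le)
        moreover have "(?PL L a1 a2 b1 b2 z) powr (- t)
          = (\<Prod>i\<in>I. L i (a1 i) (a2 i) (b1 i) (b2 i) (z i) powr (- t))"
          using nn by (intro prod_powr_distrib)
        ultimately show ?thesis
          using of_bool_less_le_powr[of "?PL L a1 a2 b1 b2 z" \<gamma> t] \<gamma> t J0[OF m]
          by (intro mult_left_mono) auto
      qed simp
    qed
    also have "\<dots> = \<gamma> powr (- t) * (\<Sum>a1\<in>Pi\<^sub>E I A1. \<Sum>a2\<in>Pi\<^sub>E I A2. \<Sum>b1\<in>Pi\<^sub>E I B1.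
      \<Sum>b2\<in>Pi\<^sub>E I B2. \<Sum>z\<in>Pi\<^sub>E I Z. \<Prod>i\<in>I. Q i (a1 i) (a2 i) * p1 i (a1 i) (b1 i) * p2 i (a2 i) (b2 i)
        * T i (b1 i) (b2 i) (z i) * L i (a1 i) (a2 i) (b1 i) (b2 i) (z i) powr (- t))"
      unfolding S_def J_def sum_distrib_left by (simp add: prod.distrib mult_ac)
    also have "\<dots> = \<gamma> powr (- t) * (\<Prod>i\<in>I. E i (\<lambda>a1 a2 b1 b2 z. L i a1 a2 b1 b2 z powr (- t)))"
      unfolding E_def using I fin by (subst prod_sum_PiE5) auto
    finally show ?thesis .
  qed
  have H1': "(\<Sum>a1\<in>Pi\<^sub>E I A1. \<Sum>b1\<in>Pi\<^sub>E I B1. (\<Prod>i\<in>I. p1 i (a1 i) (b1 i)) * of_bool (G a1 a2 b1 b2 z)) \<le> \<gamma>"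
    if m: "a2 \<in> Pi\<^sub>E I A2" "b2 \<in> Pi\<^sub>E I B2" "z \<in> Pi\<^sub>E I Z" for a2 b2 z
  proof -
    have "(\<Sum>a1\<in>Pi\<^sub>E I A1. \<Sum>b1\<in>Pi\<^sub>E I B1. (\<Prod>i\<in>I. p1 i (a1 i) (b1 i)) * of_bool (G a1 a2 b1 b2 z))
      \<le> (\<Sum>a1\<in>Pi\<^sub>E I A1. \<Sum>b1\<in>Pi\<^sub>E I B1. (\<Prod>i\<in>I. p1 i (a1 i) (b1 i)) * (\<gamma> * ?PL L1 a1 a2 b1 b2 z))"
      by (intro sum_mono mult_left_mono G_le prod_nonneg) (use m p1 in \<open>auto simp: PiE_iff\<close>)
    also have "\<dots> = \<gamma> * (\<Sum>a1\<in>Pi\<^sub>E I A1. \<Sum>b1\<in>Pi\<^sub>E I B1.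
        \<Prod>i\<in>I. p1 i (a1 i) (b1 i) * L1 i (a1 i) (a2 i) (b1 i) (b2 i) (z i))"
      by (simp add: sum_distrib_left prod.distrib mult_ac)
    also have "\<dots> = \<gamma> * (\<Prod>i\<in>I. \<Sum>x\<in>A1 i. \<Sum>y\<in>B1 i. p1 i x y * L1 i x (a2 i) y (b2 i) (z i))"
      using I fin by (subst prod_sum_PiE2) auto
    also have "\<dots> \<le> \<gamma> * 1"
      using m \<gamma> by (intro mult_left_mono prod_le_1 conjI H1 sum_nonneg mult_nonneg_nonneg)
        (auto simp: PiE_iff p1 L0)
    finally show ?thesis by simp
  qed
  have H2': "(\<Sum>a2\<in>Pi\<^sub>E I A2. \<Sum>b2\<in>Pi\<^sub>E I B2. (\<Prod>i\<in>I. p2 i (a2 i) (b2 i)) * of_bool (G a1 a2 b1 b2 z)) \<le> \<gamma>"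
    if m: "a1 \<in> Pi\<^sub>E I A1" "b1 \<in> Pi\<^sub>E I B1" "z \<in> Pi\<^sub>E I Z" for a1 b1 z
  proof -
    have "(\<Sum>a2\<in>Pi\<^sub>E I A2. \<Sum>b2\<in>Pi\<^sub>E I B2. (\<Prod>i\<in>I. p2 i (a2 i) (b2 i)) * of_bool (G a1 a2 b1 b2 z))
      \<le> (\<Sum>a2\<in>Pi\<^sub>E I A2. \<Sum>b2\<in>Pi\<^sub>E I B2. (\<Prod>i\<in>I. p2 i (a2 i) (b2 i)) * (\<gamma> * ?PL L2 a1 a2 b1 b2 z))"
      by (intro sum_mono mult_left_mono G_le prod_nonneg) (use m p2 in \<open>auto simp: PiE_iff\<close>)
    also have "\<dots> = \<gamma> * (\<Sum>a2\<in>Pi\<^sub>E I A2. \<Sum>b2\<in>Pi\<^sub>E I B2.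
        \<Prod>i\<in>I. p2 i (a2 i) (b2 i) * L2 i (a1 i) (a2 i) (b1 i) (b2 i) (z i))"
      by (simp add: sum_distrib_left prod.distrib mult_ac)
    also have "\<dots> = \<gamma> * (\<Prod>i\<in>I. \<Sum>x\<in>A2 i. \<Sum>y\<in>B2 i. p2 i x y * L2 i (a1 i) x (b1 i) y (z i))"
      using I fin by (subst prod_sum_PiE2) auto
    also have "\<dots> \<le> \<gamma> * 1"
      using m \<gamma> by (intro mult_left_mono prod_le_1 conjI H2 sum_nonneg mult_nonneg_nonneg)
        (auto simp: PiE_iff p2 L0)
    finally show ?thesis by simp
  qed
  have H3': "(\<Sum>a1\<in>Pi\<^sub>E I A1. \<Sum>b1\<in>Pi\<^sub>E I B1. (\<Prod>i\<in>I. p1 i (a1 i) (b1 i)) *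
      (\<Sum>a2\<in>Pi\<^sub>E I A2. \<Sum>b2\<in>Pi\<^sub>E I B2. (\<Prod>i\<in>I. p2 i (a2 i) (b2 i)) * of_bool (G a1 a2 b1 b2 z))) \<le> \<gamma>"
    if m: "z \<in> Pi\<^sub>E I Z" for z
  proof -
    have "(\<Sum>a1\<in>Pi\<^sub>E I A1. \<Sum>b1\<in>Pi\<^sub>E I B1. (\<Prod>i\<in>I. p1 i (a1 i) (b1 i)) *
      (\<Sum>a2\<in>Pi\<^sub>E I A2. \<Sum>b2\<in>Pi\<^sub>E I B2. (\<Prod>i\<in>I. p2 i (a2 i) (b2 i)) * of_bool (G a1 a2 b1 b2 z)))
      \<le> (\<Sum>a1\<in>Pi\<^sub>E I A1. \<Sum>b1\<in>Pi\<^sub>E I B1. (\<Prod>i\<in>I. p1 i (a1 i) (b1 i)) *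
      (\<Sum>a2\<in>Pi\<^sub>E I A2. \<Sum>b2\<in>Pi\<^sub>E I B2. (\<Prod>i\<in>I. p2 i (a2 i) (b2 i)) * (\<gamma> * ?PL L3 a1 a2 b1 b2 z)))"
      by (intro sum_mono mult_left_mono G_le prod_nonneg) (use m p1 p2 in \<open>auto simp: PiE_iff\<close>)
    also have "\<dots> = \<gamma> * (\<Sum>a1\<in>Pi\<^sub>E I A1. \<Sum>b1\<in>Pi\<^sub>E I B1. \<Sum>a2\<in>Pi\<^sub>E I A2. \<Sum>b2\<in>Pi\<^sub>E I B2.
        \<Prod>i\<in>I. p1 i (a1 i) (b1 i) * p2 i (a2 i) (b2 i) * L3 i (a1 i) (a2 i) (b1 i) (b2 i) (z i))"
      by (simp add: sum_distrib_left prod.distrib mult_ac)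
    also have "\<dots> = \<gamma> * (\<Prod>i\<in>I. \<Sum>x\<in>A1 i. \<Sum>y\<in>B1 i. \<Sum>x'\<in>A2 i. \<Sum>y'\<in>B2 i.
        p1 i x y * p2 i x' y' * L3 i x x' y y' (z i))"
      using I fin by (simp add: prod_sum_PiE cong: prod.cong)
    also have "\<dots> \<le> \<gamma> * 1"
      using m \<gamma> by (intro mult_left_mono prod_le_1 conjI H3 sum_nonneg mult_nonneg_nonneg)
        (auto simp: PiE_iff p1 p2 L0)
    finally show ?thesis by simp
  qed
  let ?bad = "\<Sum>a1\<in>Pi\<^sub>E I A1. \<Sum>a2\<in>Pi\<^sub>E I A2. (\<Prod>i\<in>I. Q i (a1 i) (a2 i)) * (\<Sum>b1\<in>Pi\<^sub>E I B1. (\<Prod>i\<in>I. p1 i (a1 i) (b1 i))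
      * (\<Sum>b2\<in>Pi\<^sub>E I B2. (\<Prod>i\<in>I. p2 i (a2 i) (b2 i)) * (\<Sum>z\<in>Pi\<^sub>E I Z. (\<Prod>i\<in>I. T i (b1 i) (b2 i) (z i)) *
        of_bool (\<not> G a1 a2 b1 b2 z))))"
  have "?bad
     = S (\<lambda>a1 a2 b1 b2 z. of_bool (\<not> G a1 a2 b1 b2 z))"
    unfolding S_def J_def by (simp add: sum_distrib_left mult_ac)
  also have "\<dots> \<le> S (\<lambda>a1 a2 b1 b2 z. of_bool (?PL L1 a1 a2 b1 b2 z < 1 / \<gamma>)
     + of_bool (?PL L2 a1 a2 b1 b2 z < 1 / \<gamma>) + of_bool (?PL L3 a1 a2 b1 b2 z < 1 / \<gamma>))"
    unfolding S_def by (intro sum_mono mult_left_mono J0) (auto simp: G_def)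
  also have "\<dots> = S (\<lambda>a1 a2 b1 b2 z. of_bool (?PL L1 a1 a2 b1 b2 z < 1 / \<gamma>))
     + S (\<lambda>a1 a2 b1 b2 z. of_bool (?PL L2 a1 a2 b1 b2 z < 1 / \<gamma>))
     + S (\<lambda>a1 a2 b1 b2 z. of_bool (?PL L3 a1 a2 b1 b2 z < 1 / \<gamma>))"
    unfolding S_def by (simp only: distrib_left sum.distrib)
  also have "\<dots> \<le> ?tails"
    using tail[of L1] tail[of L2] tail[of L3] by (simp add: distrib_left)
  finally have bad: "?bad \<le> ?tails" .
  have sum1: "(\<Sum>b\<in>Pi\<^sub>E I B. \<Prod>i\<in>I. p i (b i)) = 1"
    if "\<And>i. i \<in> I \<Longrightarrow> finite (B i)" "\<And>i. i \<in> I \<Longrightarrow> (\<Sum>b\<in>B i. p i b) = (1::real)"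
    for B :: "'i \<Rightarrow> 'c set" and p
    using prod_sum_PiE[of I B p, symmetric] that I by simp
  have "\<exists>c1\<in>Pi\<^sub>E I A1 \<rightarrow>\<^sub>E Pi\<^sub>E I B1. \<exists>c2\<in>Pi\<^sub>E I A2 \<rightarrow>\<^sub>E Pi\<^sub>E I B2. \<exists>d. ?err c1 c2 d \<le> ?bad + 3 * \<gamma>"
  proof (rule random_coding_bound)
    show "(\<Sum>a1\<in>Pi\<^sub>E I A1. \<Sum>a2\<in>Pi\<^sub>E I A2. \<Prod>i\<in>I. Q i (a1 i) (a2 i)) = 1"
      using Q I fin by (subst prod_sum_PiE2) auto
  qed (use I fin H1' H2' H3' Q p1 p2 T in \<open>auto intro!: finite_PiE prod_nonneg sum1 simp: PiE_iff\<close>)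
  then show ?thesis using bad by (meson add_mono order.refl order.trans)
qed

text \<open>The moment is 1 at exponent 0, and its derivative there is minus the mean of
  \<open>ln (L x)\<close>. A positive mean therefore pushes it below 1 for small \<open>t\<close>,
  which becomes exponential decay in the number of blocks.\<close>

lemma exists_negative_moment_less_1:
  fixes J L :: "'a \<Rightarrow> real"
  assumes "finite \<Omega>" "(\<Sum>x\<in>\<Omega>. J x) = 1" "\<And>x. x \<in> \<Omega> \<Longrightarrow> J x \<noteq> 0 \<Longrightarrow> 0 < L x"
    and "0 < (\<Sum>x\<in>\<Omega>. J x * ln (L x))"
  shows "\<exists>t0>0. \<forall>t>0. t < t0 \<longrightarrow> (\<Sum>x\<in>\<Omega>. J x * L x powr (- t)) < 1"
proof -
  define f where "f t = (\<Sum>x\<in>\<Omega>. J x * exp (- t * ln (L x)))" for t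
  have f: "(\<Sum>x\<in>\<Omega>. J x * L x powr (- t)) = f t" for t
    unfolding f_def using assms(3) less_irrefl by (intro sum.cong refl) (fastforce simp: powr_def)
  have "(f has_real_derivative (\<Sum>x\<in>\<Omega>. J x * (- ln (L x)))) (at 0)"
    unfolding f_def by (auto intro!: derivative_eq_intros sum.cong)
  moreover have "(\<Sum>x\<in>\<Omega>. J x * (- ln (L x))) < 0"
    using assms(4) by (simp add: sum_negf)
  ultimately obtain t0 where "t0 > 0" "\<forall>h>0. h < t0 \<longrightarrow> f (0 + h) < f 0"
    using DERIV_neg_dec_right by blast
  moreover have "f 0 = 1" using assms by (simp add: f_def)
  ultimately show ?thesis unfolding f by auto
qed

text \<open>Extensional functions rather than lists: they are finitely many, equal as functions when
  equal on the block, and sums of products over them factorise by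
  \<open>prod_sum_PiE\<close>.\<close>

definition blocks :: "nat \<Rightarrow> (nat \<Rightarrow> 'a) set" where
  "blocks l = ({..<l} \<rightarrow>\<^sub>E UNIV)"

lemma finite_blocks [simp]: "finite (blocks l :: (nat \<Rightarrow> 'a::finite) set)"
  unfolding blocks_def by (intro finite_PiE) auto

lemma card_blocks: "card (blocks l :: (nat \<Rightarrow> 'a::finite) set) = CARD('a) ^ l"
  unfolding blocks_def by (simp add: card_PiE)

lemma sum_blocks_prod:
  "(\<Sum>a\<in>blocks l. \<Prod>t<l. f t (a t)) = (\<Prod>t<l. \<Sum>x\<in>(UNIV::'a::finite set). f t x :: real)"
  unfolding blocks_def by (rule prod_sum_PiE[symmetric]) auto

lemma sum_blocks2_prod:
  "(\<Sum>a\<in>blocks l. \<Sum>b\<in>blocks l. \<Prod>t<l. f t (a t) (b t))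
    = (\<Prod>t<l. \<Sum>x\<in>(UNIV::'a::finite set). \<Sum>y\<in>(UNIV::'b::finite set). f t x y :: real)"
  unfolding blocks_def by (rule prod_sum_PiE2) auto

lemma sum_UNIV_pair:
  "(\<Sum>x\<in>UNIV. \<Sum>y\<in>UNIV. f x y) = (\<Sum>s\<in>UNIV. f (fst s) (snd s))"
  by (simp add: sum.cartesian_product case_prod_unfold)

text \<open>The remainder is treated as one more block, of index \<open>n div l\<close> and length
  \<open>n mod l\<close>, possibly empty.\<close>

lemma prod_lessThan_blocks:
  fixes h :: "nat \<Rightarrow> real"
  shows "(\<Prod>i<n. h i) = (\<Prod>k<Suc (n div l). \<Prod>t<(if k < n div l then l else n mod l). h (k * l + t))"
proof -
  let ?m = "n div l" and ?r = "n mod l"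
  have shift: "(\<Prod>i\<in>{k * l..<k * l + r}. h i) = (\<Prod>t<r. h (k * l + t))" for k r
    using prod.shift_bounds_nat_ivl[of h 0 "k * l" r] by (simp add: add.commute atLeast0LessThan)
  have "{..<q + r} = {..<q} \<union> {q..<q + r}" for q r :: nat by auto
  from this[of "?m * l" ?r]
  have "(\<Prod>i<n. h i) = (\<Prod>i\<in>{..<?m * l} \<union> {?m * l..<?m * l + ?r}. h i)" by simp
  also have "\<dots> = (\<Prod>i<?m * l. h i) * (\<Prod>i\<in>{?m * l..<?m * l + ?r}. h i)"
    by (rule prod.union_disjoint) auto
  also have "\<dots> = (\<Prod>k<?m. \<Prod>t<l. h (k * l + t)) * (\<Prod>t<?r. h (?m * l + t))"
    unfolding prod.nat_group[symmetric] shift ..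
  also have "\<dots> = (\<Prod>k<Suc ?m. \<Prod>t<(if k < ?m then l else ?r). h (k * l + t))"
    by simp
  finally show ?thesis .
qed

section \<open>Cutting a sequence of length n into blocks and pasting it together again\<close>

lemma sum_le_sum_inj:
  fixes h :: "'b \<Rightarrow> real"
  assumes "finite B" "inj_on f A" "f ` A \<subseteq> B" "\<And>y. y \<in> B \<Longrightarrow> 0 \<le> h y"
  shows "(\<Sum>x\<in>A. h (f x)) \<le> sum h B"
proof -
  have "(\<Sum>x\<in>A. h (f x)) = sum h (f ` A)" using assms(2) by (simp add: sum.reindex)
  also have "\<dots> \<le> sum h B" using assms by (intro sum_mono2) auto
  finally show ?thesis .
qed

text \<open>Restricting on both levels places the result in the product of block spaces, which is
  the message set of \<open>product_coding_bound\<close>.\<close>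

definition cut :: "nat \<Rightarrow> nat \<Rightarrow> 'a list \<Rightarrow> nat \<Rightarrow> nat \<Rightarrow> 'a" where
  "cut n l s = (\<lambda>k\<in>{..<Suc (n div l)}. \<lambda>t\<in>{..<(if k < n div l then l else n mod l)}. s ! (k * l + t))"

definition paste :: "nat \<Rightarrow> nat \<Rightarrow> (nat \<Rightarrow> nat \<Rightarrow> 'a) \<Rightarrow> 'a list" where
  "paste n l f = map (\<lambda>i. f (i div l) (i mod l)) [0..<n]"

lemma cut_in: "cut n l s \<in> (\<Pi>\<^sub>E k\<in>{..<Suc (n div l)}. blocks (if k < n div l then l else n mod l))"
  unfolding cut_def blocks_def by (intro restrict_PiE_iff[THEN iffD2] ballI) auto

lemma block_index_less:
  assumes "k < Suc (n div l)" "t < (if k < n div l then l else n mod l)"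
  shows "k * l + t < (n::nat)"
proof (cases "k < n div l")
  case True
  then have "k * l + t < Suc k * l" using assms by simp
  also have "\<dots> \<le> n div l * l" using True by (intro mult_right_mono) auto
  also have "\<dots> \<le> n" by simp
  finally show ?thesis .
next
  case False
  then have "k = n div l" "t < n mod l" using assms by auto
  then show ?thesis by (metis div_mult_mod_eq nat_add_left_cancel_less)
qed

lemma cut_nth:
  "k < Suc (n div l) \<Longrightarrow> t < (if k < n div l then l else n mod l) \<Longrightarrow> cut n l s k t = s ! (k * l + t)"
  by (simp add: cut_def)

lemma paste_cut:
  assumes "length s = n" "0 < l"
  shows "paste n l (cut n l s) = s"
proof (rule nth_equalityI)
  fix i assume "i < length (paste n l (cut n l s))"
  then have i: "i < n" by (simp add: paste_def)
  have 1: "i div l < Suc (n div l)" using i by (simp add: div_le_mono le_imp_less_Suc)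
  have "i mod l < n mod l" if "\<not> i div l < n div l"
  proof -
    have "i div l = n div l" using 1 that by simp
    then show ?thesis using i by (metis div_mult_mod_eq nat_add_left_cancel_less)
  qed
  then have 2: "i mod l < (if i div l < n div l then l else n mod l)" using assms by auto
  show "paste n l (cut n l s) ! i = s ! i"
    using i cut_nth[OF 1 2, of s] by (simp add: paste_def)
qed (use assms in \<open>simp add: paste_def\<close>)

lemma inj_on_cut: "0 < l \<Longrightarrow> inj_on (cut n l) {s. length s = n}"
  by (rule inj_on_inverseI[where g = "paste n l"]) (simp add: paste_cut)

text \<open>Transfers an error bound for families of blocks to the list codes in
  \<open>transmissible\<close>. Cutting is injective on sequences of length \<open>n\<close> and all
  summands are nonnegative, so the sums over lists embed into the sums over blocks, and an
  inequality is enough.\<close>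

lemma err_prob_paste_le:
  fixes WS :: "'s1::finite \<times> 's2::finite \<Rightarrow> real" and W :: "'x1 \<Rightarrow> 'x2 \<Rightarrow> 'y::finite \<Rightarrow> real"
    and n l :: nat and X1 :: "(nat \<Rightarrow> nat \<Rightarrow> 's1) \<Rightarrow> nat \<Rightarrow> nat \<Rightarrow> 'x1" and X2 :: "(nat \<Rightarrow> nat \<Rightarrow> 's2) \<Rightarrow> nat \<Rightarrow> nat \<Rightarrow> 'x2"
    and d
  defines "I \<equiv> {..<Suc (n div l)}" and "len \<equiv> \<lambda>k. if k < n div l then l else n mod l"
  assumes "0 < l" and WS: "\<And>s. 0 \<le> WS s" and W: "\<And>x1 x2 y. 0 \<le> W x1 x2 y"
  shows "err_prob WS W n (\<lambda>s. paste n l (X1 (cut n l s))) (\<lambda>s. paste n l (X2 (cut n l s)))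
      (\<lambda>y. map_prod (paste n l) (paste n l) (d (cut n l y)))
    \<le> (\<Sum>a1\<in>(\<Pi>\<^sub>E k\<in>I. blocks (len k)). \<Sum>a2\<in>(\<Pi>\<^sub>E k\<in>I. blocks (len k)). (\<Prod>k\<in>I. \<Prod>t<len k. WS (a1 k t, a2 k t)) *
      (\<Sum>z\<in>(\<Pi>\<^sub>E k\<in>I. blocks (len k)). (\<Prod>k\<in>I. \<Prod>t<len k. W (X1 a1 k t) (X2 a2 k t) (z k t))
        * of_bool (d z \<noteq> (a1, a2))))"
    (is "?err \<le> _")
proof -
  let ?P = "\<lambda>k. blocks (len k)"
  define h where "h a1 a2 z = (\<Prod>k\<in>I. \<Prod>t<len k. W (X1 a1 k t) (X2 a2 k t) (z k t)) * of_bool (d z \<noteq> (a1, a2))" for a1 a2 z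
  define g where "g a = (\<Prod>k\<in>I. \<Prod>t<len k. WS (fst a k t, snd a k t)) * (\<Sum>z\<in>Pi\<^sub>E I ?P. h (fst a) (snd a) z)" for a
  have h0: "0 \<le> h a1 a2 z" for a1 a2 z
    unfolding h_def using W by (intro mult_nonneg_nonneg prod_nonneg) auto
  have g0: "0 \<le> g a" for a
    unfolding g_def using WS h0 by (intro mult_nonneg_nonneg prod_nonneg sum_nonneg) auto
  have fin: "finite (Pi\<^sub>E I (\<lambda>k. blocks (len k) :: (nat \<Rightarrow> 'a::finite) set))"
    unfolding I_def by (intro finite_PiE) auto
  have regroup: "(\<Prod>i<n. f i) = (\<Prod>k\<in>I. \<Prod>t<len k. f (k * l + t))" for f :: "nat \<Rightarrow> real"
    unfolding I_def len_def by (rule prod_lessThan_blocks)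
  have lt: "k * l + t < n" if "k \<in> I" "t < len k" for k t
    using block_index_less[of k n l t] that unfolding I_def len_def by auto
  have cutn: "cut n l s k t = s ! (k * l + t)" if "k \<in> I" "t < len k" for k t and s :: "'a list"
    using cut_nth[of k n l t s] that unfolding I_def len_def by auto
  have t_less: "t < l" if "t < len k" for k t
    using that \<open>0 < l\<close> mod_less_divisor[of l n] less_trans unfolding len_def
    by (fastforce split: if_splits)
  have "?err \<le> (\<Sum>ss\<in>{ss. length ss = n}. g (cut n l (map fst ss), cut n l (map snd ss)))"
    unfolding err_prob_def
  proof (intro sum_mono)
    fix ss :: "('s1 \<times> 's2) list" assume "ss \<in> {ss. length ss = n}"
    then have ss: "length ss = n" by simp
    let ?a1 = "cut n l (map fst ss)" and ?a2 = "cut n l (map snd ss)"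
    have "(\<Prod>i<n. WS (ss ! i)) = (\<Prod>k\<in>I. \<Prod>t<len k. WS (?a1 k t, ?a2 k t))"
      unfolding regroup by (intro prod.cong refl) (simp add: lt cutn ss)
    moreover have "(\<Sum>ys\<in>{ys. length ys = n}. (\<Prod>i<n. W (paste n l (X1 ?a1) ! i) (paste n l (X2 ?a2) ! i) (ys ! i)) *
       (if map_prod (paste n l) (paste n l) (d (cut n l ys)) \<noteq> (map fst ss, map snd ss) then 1 else 0))
      \<le> (\<Sum>ys\<in>{ys. length ys = n}. h ?a1 ?a2 (cut n l ys))"
    proof (intro sum_mono)
      fix ys :: "'y list" assume "ys \<in> {ys. length ys = n}"
      then have ys: "length ys = n" by simp
      have 1: "(\<Prod>i<n. W (paste n l (X1 ?a1) ! i) (paste n l (X2 ?a2) ! i) (ys ! i))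
         = (\<Prod>k\<in>I. \<Prod>t<len k. W (X1 ?a1 k t) (X2 ?a2 k t) (cut n l ys k t))"
        unfolding regroup by (intro prod.cong refl) (simp add: lt cutn ys t_less \<open>0 < l\<close> paste_def)
      have "(if map_prod (paste n l) (paste n l) (d (cut n l ys)) \<noteq> (map fst ss, map snd ss) then 1 else 0 :: real)
          \<le> of_bool (d (cut n l ys) \<noteq> (?a1, ?a2))"
        using ss \<open>0 < l\<close> by (auto simp: paste_cut)
      then show "(\<Prod>i<n. W (paste n l (X1 ?a1) ! i) (paste n l (X2 ?a2) ! i) (ys ! i)) *
       (if map_prod (paste n l) (paste n l) (d (cut n l ys)) \<noteq> (map fst ss, map snd ss) then 1 else 0)
       \<le> h ?a1 ?a2 (cut n l ys)"
        unfolding 1 h_def using W by (intro mult_left_mono prod_nonneg) auto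
    qed
    moreover have "(\<Sum>ys\<in>{ys. length ys = n}. h ?a1 ?a2 (cut n l ys)) \<le> (\<Sum>z\<in>Pi\<^sub>E I ?P. h ?a1 ?a2 z)"
      using cut_in[of n l] fin h0 inj_on_cut[OF \<open>0 < l\<close>]
      by (intro sum_le_sum_inj) (auto simp: I_def len_def)
    ultimately show "(\<Prod>i<n. WS (ss ! i)) * (\<Sum>ys\<in>{ys. length ys = n}. (\<Prod>i<n. W (paste n l (X1 ?a1) ! i) (paste n l (X2 ?a2) ! i) (ys ! i)) *
       (if map_prod (paste n l) (paste n l) (d (cut n l ys)) \<noteq> (map fst ss, map snd ss) then 1 else 0))
       \<le> g (?a1, ?a2)"
      unfolding g_def using WS by (auto intro!: mult_left_mono prod_nonneg)
  qed
  also have "\<dots> \<le> sum g (Pi\<^sub>E I ?P \<times> Pi\<^sub>E I ?P)"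
  proof (rule sum_le_sum_inj)
    show "inj_on (\<lambda>ss :: ('s1 \<times> 's2) list. (cut n l (map fst ss), cut n l (map snd ss))) {ss. length ss = n}"
    proof (rule inj_on_inverseI[where g = "\<lambda>(x, y). zip (paste n l x) (paste n l y)"])
      fix ss :: "('s1 \<times> 's2) list" assume "ss \<in> {ss. length ss = n}"
      then show "(case (cut n l (map fst ss), cut n l (map snd ss)) of
          (x, y) \<Rightarrow> zip (paste n l x) (paste n l y)) = ss"
        using \<open>0 < l\<close> by (simp add: paste_cut zip_map_fst_snd)
    qed
    show "finite (Pi\<^sub>E I ?P \<times> Pi\<^sub>E I ?P :: ((nat \<Rightarrow> nat \<Rightarrow> 's1) \<times> (nat \<Rightarrow> nat \<Rightarrow> 's2)) set)"
      by (intro finite_cartesian_product fin)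
    show "(\<lambda>ss :: ('s1 \<times> 's2) list. (cut n l (map fst ss), cut n l (map snd ss))) ` {ss. length ss = n}
        \<subseteq> Pi\<^sub>E I ?P \<times> Pi\<^sub>E I ?P"
      unfolding I_def len_def by (intro image_subsetI SigmaI cut_in)
  qed (rule g0)
  also have "\<dots> = (\<Sum>a1\<in>Pi\<^sub>E I ?P. \<Sum>a2\<in>Pi\<^sub>E I ?P. g (a1, a2))"
    by (simp add: sum.cartesian_product)
  finally show ?thesis unfolding g_def h_def by simp
qed

text \<open>A multi-letter coding theorem: it suffices to exhibit, for one block length, three
  weights with mean at most 1 on redrawn candidates and with positive mean logarithm on the true
  pair. For all lengths \<open>n\<close>, the error then consists of three geometric terms in
  \<open>n div l\<close> and a constant chosen at will.\<close>

theorem block_coding: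
  fixes WS :: "'s1::finite \<times> 's2::finite \<Rightarrow> real" and W :: "'x1 \<Rightarrow> 'x2 \<Rightarrow> 'y::finite \<Rightarrow> real"
    and l :: nat and B1 :: "'b1 set" and B2 :: "'b2 set"
    and in1 :: "'b1 \<Rightarrow> nat \<Rightarrow> 'x1" and in2 :: "'b2 \<Rightarrow> nat \<Rightarrow> 'x2" and p1 p2
    and L1 L2 L3 :: "(nat \<Rightarrow> 's1) \<Rightarrow> (nat \<Rightarrow> 's2) \<Rightarrow> 'b1 \<Rightarrow> 'b2 \<Rightarrow> (nat \<Rightarrow> 'y) \<Rightarrow> real"
  defines "Q \<equiv> \<lambda>l a1 a2. \<Prod>t<l. WS (a1 t, a2 t)"
    and "T \<equiv> \<lambda>l b1 b2 z. \<Prod>t<l. W (in1 b1 t) (in2 b2 t) (z t)"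
  defines "E \<equiv> \<lambda>f. \<Sum>a1\<in>blocks l. \<Sum>a2\<in>blocks l. \<Sum>b1\<in>B1. \<Sum>b2\<in>B2. \<Sum>z\<in>blocks l.
      Q l a1 a2 * p1 a1 b1 * p2 a2 b2 * T l b1 b2 z * (f a1 a2 b1 b2 z :: real)"
  assumes l: "0 < l" and WS: "is_pmf WS" and W: "\<And>x1 x2. is_pmf (W x1 x2)"
    and fin: "finite B1" "finite B2"
    and p1: "\<And>a b. a \<in> blocks l \<Longrightarrow> b \<in> B1 \<Longrightarrow> 0 \<le> p1 a b" "\<And>a. a \<in> blocks l \<Longrightarrow> (\<Sum>b\<in>B1. p1 a b) = 1"
    and p2: "\<And>a b. a \<in> blocks l \<Longrightarrow> b \<in> B2 \<Longrightarrow> 0 \<le> p2 a b" "\<And>a. a \<in> blocks l \<Longrightarrow> (\<Sum>b\<in>B2. p2 a b) = 1"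
    and L0: "\<And>a1 a2 b1 b2 z. a1 \<in> blocks l \<Longrightarrow> a2 \<in> blocks l \<Longrightarrow> b1 \<in> B1 \<Longrightarrow> b2 \<in> B2 \<Longrightarrow> z \<in> blocks l
      \<Longrightarrow> 0 \<le> L1 a1 a2 b1 b2 z \<and> 0 \<le> L2 a1 a2 b1 b2 z \<and> 0 \<le> L3 a1 a2 b1 b2 z"
    and Lpos: "\<And>a1 a2 b1 b2 z. a1 \<in> blocks l \<Longrightarrow> a2 \<in> blocks l \<Longrightarrow> b1 \<in> B1 \<Longrightarrow> b2 \<in> B2 \<Longrightarrow> z \<in> blocks l
      \<Longrightarrow> Q l a1 a2 \<noteq> 0 \<Longrightarrow> p1 a1 b1 \<noteq> 0 \<Longrightarrow> p2 a2 b2 \<noteq> 0 \<Longrightarrow> T l b1 b2 z \<noteq> 0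
      \<Longrightarrow> L1 a1 a2 b1 b2 z \<noteq> 0 \<and> L2 a1 a2 b1 b2 z \<noteq> 0 \<and> L3 a1 a2 b1 b2 z \<noteq> 0"
    and H1: "\<And>a2 b2 z. a2 \<in> blocks l \<Longrightarrow> b2 \<in> B2 \<Longrightarrow> z \<in> blocks l \<Longrightarrow>
      (\<Sum>a1\<in>blocks l. \<Sum>b1\<in>B1. p1 a1 b1 * L1 a1 a2 b1 b2 z) \<le> 1"
    and H2: "\<And>a1 b1 z. a1 \<in> blocks l \<Longrightarrow> b1 \<in> B1 \<Longrightarrow> z \<in> blocks l \<Longrightarrow>
      (\<Sum>a2\<in>blocks l. \<Sum>b2\<in>B2. p2 a2 b2 * L2 a1 a2 b1 b2 z) \<le> 1"
    and H3: "\<And>z. z \<in> blocks l \<Longrightarrow>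
      (\<Sum>a1\<in>blocks l. \<Sum>b1\<in>B1. \<Sum>a2\<in>blocks l. \<Sum>b2\<in>B2. p1 a1 b1 * p2 a2 b2 * L3 a1 a2 b1 b2 z) \<le> 1"
    and E: "0 < E (\<lambda>a1 a2 b1 b2 z. ln (L1 a1 a2 b1 b2 z))" "0 < E (\<lambda>a1 a2 b1 b2 z. ln (L2 a1 a2 b1 b2 z))"
      "0 < E (\<lambda>a1 a2 b1 b2 z. ln (L3 a1 a2 b1 b2 z))"
  shows "transmissible WS W"
proof -
  have WS0: "0 \<le> WS s" and W0: "0 \<le> W x1 x2 y" for s x1 x2 y
    using WS W unfolding is_pmf_def by blast+
  have Q0: "0 \<le> Q r a1 a2" and T0: "0 \<le> T r b1 b2 z" for r a1 a2 b1 b2 z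
    unfolding Q_def T_def using WS0 W0 by (auto intro!: prod_nonneg)
  have Q1: "(\<Sum>a1\<in>blocks r. \<Sum>a2\<in>blocks r. Q r a1 a2) = 1" for r
    unfolding Q_def sum_blocks2_prod[where f = "\<lambda>t x y. WS (x, y)"] sum_UNIV_pair
    using WS by (simp add: is_pmf_def)
  have T1: "(\<Sum>z\<in>blocks r. T r b1 b2 z) = 1" for r b1 b2
    unfolding T_def sum_blocks_prod[where f = "\<lambda>t. W (in1 b1 t) (in2 b2 t)"] using W by (simp add: is_pmf_def)
  define \<Omega> :: "((nat \<Rightarrow> 's1) \<times> (nat \<Rightarrow> 's2) \<times> 'b1 \<times> 'b2 \<times> (nat \<Rightarrow> 'y)) set"
    where "\<Omega> = blocks l \<times> blocks l \<times> B1 \<times> B2 \<times> blocks l"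
  define J where "J = (\<lambda>(a1, a2, b1, b2, z). Q l a1 a2 * p1 a1 b1 * p2 a2 b2 * T l b1 b2 z)"
  have fin\<Omega>: "finite \<Omega>" unfolding \<Omega>_def using fin by simp
  have E_eq: "E f = (\<Sum>x\<in>\<Omega>. J x * (\<lambda>(a1, a2, b1, b2, z). f a1 a2 b1 b2 z) x)" for f
    unfolding E_def \<Omega>_def J_def by (simp add: sum.cartesian_product case_prod_unfold)
  have E1: "E (\<lambda>_ _ _ _ _. c) = c" for c
  proof -
    have "E (\<lambda>_ _ _ _ _. c) = (\<Sum>a1\<in>blocks l. \<Sum>a2\<in>blocks l. Q l a1 a2 * ((\<Sum>b1\<in>B1. p1 a1 b1)
       * ((\<Sum>b2\<in>B2. p2 a2 b2) * c)))"
      unfolding E_def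
    proof (intro sum.cong refl)
      fix a1 :: "nat \<Rightarrow> 's1" and a2 :: "nat \<Rightarrow> 's2" assume "a1 \<in> blocks l" "a2 \<in> blocks l"
      have "(\<Sum>b1\<in>B1. \<Sum>b2\<in>B2. \<Sum>z\<in>blocks l. Q l a1 a2 * p1 a1 b1 * p2 a2 b2 * T l b1 b2 z * c)
         = (\<Sum>b1\<in>B1. \<Sum>b2\<in>B2. Q l a1 a2 * p1 a1 b1 * p2 a2 b2 * c)"
        unfolding sum_distrib_left[symmetric] sum_distrib_right[symmetric] T1 by simp
      also have "\<dots> = Q l a1 a2 * c * ((\<Sum>b1\<in>B1. p1 a1 b1) * (\<Sum>b2\<in>B2. p2 a2 b2))"
        unfolding sum_product by (simp add: sum_distrib_left mult_ac)
      also have "\<dots> = Q l a1 a2 * ((\<Sum>b1\<in>B1. p1 a1 b1) * ((\<Sum>b2\<in>B2. p2 a2 b2) * c))"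
        by simp
      finally show "(\<Sum>b1\<in>B1. \<Sum>b2\<in>B2. \<Sum>z\<in>blocks l. Q l a1 a2 * p1 a1 b1 * p2 a2 b2 * T l b1 b2 z * c)
        = Q l a1 a2 * ((\<Sum>b1\<in>B1. p1 a1 b1) * ((\<Sum>b2\<in>B2. p2 a2 b2) * c))" .
    qed
    also have "\<dots> = (\<Sum>a1\<in>blocks l. \<Sum>a2\<in>blocks l. Q l a1 a2) * c"
      using p1 p2 by (simp add: sum_distrib_right)
    finally show ?thesis using Q1 by simp
  qed
  have moment: "\<exists>t0>0. \<forall>t>0. t < t0 \<longrightarrow> E (\<lambda>a1 a2 b1 b2 z. L a1 a2 b1 b2 z powr (- t)) < 1"
    if "L = L1 \<or> L = L2 \<or> L = L3" for L
  proof -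
    have "\<exists>t0>0. \<forall>t>0. t < t0 \<longrightarrow> (\<Sum>x\<in>\<Omega>. J x * (\<lambda>(a1, a2, b1, b2, z). L a1 a2 b1 b2 z) x powr (- t)) < 1"
    proof (rule exists_negative_moment_less_1[OF fin\<Omega>])
      show "sum J \<Omega> = 1" using E_eq[of "\<lambda>_ _ _ _ _. 1"] E1[of 1] by (simp add: case_prod_unfold)
      show "0 < (\<lambda>(a1, a2, b1, b2, z). L a1 a2 b1 b2 z) x" if x: "x \<in> \<Omega>" "J x \<noteq> 0" for x
      proof -
        obtain a1 a2 b1 b2 z where [simp]: "x = (a1, a2, b1, b2, z)" by (metis prod_cases5)
        show ?thesis
          using x Lpos[of a1 a2 b1 b2 z] L0[of a1 a2 b1 b2 z] \<open>L = L1 \<or> L = L2 \<or> L = L3\<close>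
          by (auto simp: \<Omega>_def J_def order_less_le)
      qed
      have "0 < E (\<lambda>a1 a2 b1 b2 z. ln (L a1 a2 b1 b2 z))" using that E by auto
      then show "0 < (\<Sum>x\<in>\<Omega>. J x * ln ((\<lambda>(a1, a2, b1, b2, z). L a1 a2 b1 b2 z) x))"
        unfolding E_eq by (simp add: case_prod_unfold)
    qed
    then show ?thesis unfolding E_eq by (simp add: case_prod_unfold)
  qed
  obtain t1 where t1: "t1 > 0" "\<And>t. 0 < t \<Longrightarrow> t < t1 \<Longrightarrow> E (\<lambda>a1 a2 b1 b2 z. L1 a1 a2 b1 b2 z powr (- t)) < 1"
    using moment[of L1] by auto
  obtain t2 where t2: "t2 > 0" "\<And>t. 0 < t \<Longrightarrow> t < t2 \<Longrightarrow> E (\<lambda>a1 a2 b1 b2 z. L2 a1 a2 b1 b2 z powr (- t)) < 1"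
    using moment[of L2] by auto
  obtain t3 where t3: "t3 > 0" "\<And>t. 0 < t \<Longrightarrow> t < t3 \<Longrightarrow> E (\<lambda>a1 a2 b1 b2 z. L3 a1 a2 b1 b2 z powr (- t)) < 1"
    using moment[of L3] by auto
  \<comment> \<open>One exponent must serve all three weights, since
    \<open>product_coding_bound\<close> uses a single \<open>t\<close>.\<close>
  define t where "t = min t1 (min t2 t3) / 2"
  define e1 where "e1 = E (\<lambda>a1 a2 b1 b2 z. L1 a1 a2 b1 b2 z powr (- t))"
  define e2 where "e2 = E (\<lambda>a1 a2 b1 b2 z. L2 a1 a2 b1 b2 z powr (- t))"
  define e3 where "e3 = E (\<lambda>a1 a2 b1 b2 z. L3 a1 a2 b1 b2 z powr (- t))"
  have t: "0 < t" "t < t1" "t < t2" "t < t3" unfolding t_def using t1 t2 t3 by auto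
  have e_less: "e1 < 1" "e2 < 1" "e3 < 1"
    unfolding e1_def e2_def e3_def using t1 t2 t3 t by auto
  have Epowr0: "0 \<le> E (\<lambda>a1 a2 b1 b2 z. L a1 a2 b1 b2 z powr (- t))" for L
    unfolding E_def using p1 p2 Q0 T0 by (intro sum_nonneg mult_nonneg_nonneg) auto
  then have e0: "0 \<le> e1" "0 \<le> e2" "0 \<le> e3" unfolding e1_def e2_def e3_def by auto
  \<comment> \<open>A probability distribution on \<open>B1\<close> shows that it is nonempty; any
    element can serve as dummy codeword for the remainder.\<close>
  have "B1 \<noteq> {}" using p1(2)[of "\<lambda>t\<in>{..<l}. undefined"] by (auto simp: blocks_def)
  then obtain \<beta>1 where \<beta>1: "\<beta>1 \<in> B1" by blast
  have "B2 \<noteq> {}" using p2(2)[of "\<lambda>t\<in>{..<l}. undefined"] by (auto simp: blocks_def)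
  then obtain \<beta>2 where \<beta>2: "\<beta>2 \<in> B2" by blast
  \<comment> \<open>The last \<open>n mod l\<close> letters are sent with dummy inputs; guessing them uniformly costs the constant weight \<open>\<kappa>\<close>.\<close>
  define \<kappa> :: real where "\<kappa> = 1 / real ((CARD('s1) * CARD('s2)) ^ l)"
  have \<kappa>: "0 < \<kappa>" unfolding \<kappa>_def by simp
  have \<kappa>_le: "real (CARD('s1) ^ r1) * real (CARD('s2) ^ r2) * \<kappa> \<le> 1" if "r1 \<le> l" "r2 \<le> l" for r1 r2
  proof -
    have "CARD('s1) ^ r1 * CARD('s2) ^ r2 \<le> CARD('s1) ^ l * CARD('s2) ^ l"
      using that by (intro mult_mono power_increasing) (auto simp: Suc_leI)
    then show ?thesis unfolding \<kappa>_def by (simp add: power_mult_distrib flip: of_nat_mult of_nat_power)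
  qed
  show ?thesis
    unfolding transmissible_def
  proof (intro allI impI)
    fix \<epsilon> :: real assume \<epsilon>: "0 < \<epsilon>"
    \<comment> \<open>Makes the wrong candidates cost \<open>3 * \<gamma> = \<epsilon> / 2\<close>;
      the other half is left to the rejection of the true pair.\<close>
    define \<gamma> where "\<gamma> = \<epsilon> / 6"
    have \<gamma>: "0 < \<gamma>" using \<epsilon> by (simp add: \<gamma>_def)
    define c where "c = \<gamma> powr (- t) * \<kappa> powr (- t)"
    have "(\<lambda>m. c * (e1 ^ m + e2 ^ m + e3 ^ m)) \<longlonglongrightarrow> c * (0 + 0 + 0)"
      using e0 e_less by (intro tendsto_intros LIMSEQ_realpow_zero)
    then have "\<forall>\<^sub>F m in sequentially. c * (e1 ^ m + e2 ^ m + e3 ^ m) < \<epsilon> / 2"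
      using \<epsilon> by (intro order_tendstoD) auto
    then obtain M where M: "\<And>m. M \<le> m \<Longrightarrow> c * (e1 ^ m + e2 ^ m + e3 ^ m) < \<epsilon> / 2"
      by (auto simp: eventually_sequentially)
    show "\<exists>N. \<forall>n\<ge>N. \<exists>(en1::'s1 list \<Rightarrow> 'x1 list) (en2::'s2 list \<Rightarrow> 'x2 list)
        (d::'y list \<Rightarrow> 's1 list \<times> 's2 list).
        (\<forall>s. length s = n \<longrightarrow> length (en1 s) = n) \<and> (\<forall>s. length s = n \<longrightarrow> length (en2 s) = n) \<and>
        err_prob WS W n en1 en2 d \<le> \<epsilon>"
    proof (intro exI[of _ "M * l"] allI impI)
      fix n assume n: "M * l \<le> n"
      define m where "m = n div l"
      define len where "len = (\<lambda>k. if k < n div l then l else n mod l)"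
      have len_le: "len k \<le> l" for k
        unfolding len_def using l by (simp add: less_imp_le)
      have Mm: "M \<le> m" unfolding m_def using n l by (simp add: less_eq_div_iff_mult_less_eq)
      define I where "I = {..<Suc (n div l)}"
      let ?B1 = "\<lambda>k. if k < m then B1 else {\<beta>1}" and ?B2 = "\<lambda>k. if k < m then B2 else {\<beta>2}"
      let ?p1 = "\<lambda>k a b. if k < m then p1 a b else 1" and ?p2 = "\<lambda>k a b. if k < m then p2 a b else 1"
      let ?L = "\<lambda>L k a1 a2 b1 b2 z. if k < m then L a1 a2 b1 b2 z else \<kappa>"
      let ?A = "\<lambda>k. blocks (len k)"
      let ?E = "\<lambda>k f. \<Sum>a1\<in>?A k. \<Sum>a2\<in>?A k. \<Sum>b1\<in>?B1 k. \<Sum>b2\<in>?B2 k. \<Sum>z\<in>?A k.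
        Q (len k) a1 a2 * ?p1 k a1 b1 * ?p2 k a2 b2 * T (len k) b1 b2 z * f a1 a2 b1 b2 z"
      have len_m: "len k = l" if "k < m" for k using that by (simp add: len_def m_def)
      have finI: "finite I" by (simp add: I_def)
      have H1r: "(\<Sum>a1\<in>?A k. \<Sum>b1\<in>?B1 k. ?p1 k a1 b1 * ?L L1 k a1 a2 b1 b2 z) \<le> 1"
        if "a2 \<in> ?A k" "b2 \<in> ?B2 k" "z \<in> ?A k" for k b2 and a2 :: "nat \<Rightarrow> 's2" and z :: "nat \<Rightarrow> 'y"
      proof (cases "k < m")
        case True
        then show ?thesis using that H1[of a2 b2 z] by (simp add: len_m)
      next
        case False
        then show ?thesis using \<kappa>_le[of "len k" 0] len_le[of k] by (simp add: card_blocks)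
      qed
      have H2r: "(\<Sum>a2\<in>?A k. \<Sum>b2\<in>?B2 k. ?p2 k a2 b2 * ?L L2 k a1 a2 b1 b2 z) \<le> 1"
        if "a1 \<in> ?A k" "b1 \<in> ?B1 k" "z \<in> ?A k" for k b1 and a1 :: "nat \<Rightarrow> 's1" and z :: "nat \<Rightarrow> 'y"
      proof (cases "k < m")
        case True
        then show ?thesis using that H2[of a1 b1 z] by (simp add: len_m)
      next
        case False
        then show ?thesis using \<kappa>_le[of 0 "len k"] len_le[of k] by (simp add: card_blocks)
      qed
      have H3r: "(\<Sum>a1\<in>?A k. \<Sum>b1\<in>?B1 k. \<Sum>a2\<in>?A k. \<Sum>b2\<in>?B2 k.
          ?p1 k a1 b1 * ?p2 k a2 b2 * ?L L3 k a1 a2 b1 b2 z) \<le> 1"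
        if "z \<in> ?A k" for k and z :: "nat \<Rightarrow> 'y"
      proof (cases "k < m")
        case True
        then show ?thesis using that H3[of z] by (simp add: len_m)
      next
        case False
        then show ?thesis using \<kappa>_le[of "len k" "len k"] len_le[of k] by (simp add: card_blocks mult_ac)
      qed
      have L0r: "0 \<le> ?L L1 k a1 a2 b1 b2 z \<and> 0 \<le> ?L L2 k a1 a2 b1 b2 z \<and> 0 \<le> ?L L3 k a1 a2 b1 b2 z"
        if "a1 \<in> ?A k" "a2 \<in> ?A k" "b1 \<in> ?B1 k" "b2 \<in> ?B2 k" "z \<in> ?A k" for k a1 a2 b1 b2 z
        using that L0[of a1 a2 b1 b2 z] \<kappa> by (auto simp: len_m)
      have Lposr: "?L L1 k a1 a2 b1 b2 z \<noteq> 0 \<and> ?L L2 k a1 a2 b1 b2 z \<noteq> 0 \<and> ?L L3 k a1 a2 b1 b2 z \<noteq> 0"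
        if "a1 \<in> ?A k" "a2 \<in> ?A k" "b1 \<in> ?B1 k" "b2 \<in> ?B2 k" "z \<in> ?A k" "Q (len k) a1 a2 \<noteq> 0"
          "?p1 k a1 b1 \<noteq> 0" "?p2 k a2 b2 \<noteq> 0" "T (len k) b1 b2 z \<noteq> 0" for k a1 a2 b1 b2 z
      proof (cases "k < m")
        case True
        then show ?thesis using that Lpos[of a1 a2 b1 b2 z] by (simp add: len_m)
      next
        case False
        then show ?thesis using \<kappa> by simp
      qed
      have p10: "0 \<le> ?p1 k a b" if "a \<in> ?A k" "b \<in> ?B1 k" for k a b
        using that p1(1)[of a b] by (cases "k < m") (auto simp: len_m)
      have p20: "0 \<le> ?p2 k a b" if "a \<in> ?A k" "b \<in> ?B2 k" for k a b
        using that p2(1)[of a b] by (cases "k < m") (auto simp: len_m)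
      have p11: "(\<Sum>b\<in>?B1 k. ?p1 k a b) = 1" if "a \<in> ?A k" for k a
        using that p1(2)[of a] by (cases "k < m") (auto simp: len_m)
      have p21: "(\<Sum>b\<in>?B2 k. ?p2 k a b) = 1" if "a \<in> ?A k" for k a
        using that p2(2)[of a] by (cases "k < m") (auto simp: len_m)
      have finr: "finite (?B1 k)" "finite (?B2 k)" for k using fin by auto
      let ?err = "\<lambda>c1 c2 d. (\<Sum>a1\<in>Pi\<^sub>E I ?A. \<Sum>a2\<in>Pi\<^sub>E I ?A. (\<Prod>k\<in>I. Q (len k) (a1 k) (a2 k)) *
        (\<Sum>z\<in>Pi\<^sub>E I ?A. (\<Prod>k\<in>I. T (len k) (c1 a1 k) (c2 a2 k) (z k)) * of_bool (d z \<noteq> (a1, a2))))"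
      let ?tails = "\<gamma> powr (- t) * ((\<Prod>k\<in>I. ?E k (\<lambda>a1 a2 b1 b2 z. ?L L1 k a1 a2 b1 b2 z powr (- t)))
          + (\<Prod>k\<in>I. ?E k (\<lambda>a1 a2 b1 b2 z. ?L L2 k a1 a2 b1 b2 z powr (- t)))
          + (\<Prod>k\<in>I. ?E k (\<lambda>a1 a2 b1 b2 z. ?L L3 k a1 a2 b1 b2 z powr (- t))))"
      have "\<exists>c1\<in>Pi\<^sub>E I ?A \<rightarrow>\<^sub>E Pi\<^sub>E I ?B1. \<exists>c2\<in>Pi\<^sub>E I ?A \<rightarrow>\<^sub>E Pi\<^sub>E I ?B2. \<exists>d. ?err c1 c2 d \<le> ?tails + 3 * \<gamma>"
        by (rule product_coding_bound)
          (rule \<gamma> t(1) Q0 Q1 T0 T1 finI finr finite_blocks | (rule p10 p11 p20 p21 L0r Lposr H1r H2r H3r; assumption))+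
      then obtain c1 c2 d where err: "?err c1 c2 d \<le> ?tails + 3 * \<gamma>"
        by (elim bexE exE) (rule that)
      \<comment> \<open>The full blocks give \<open>m\<close> equal factors. In the remainder the
        weight is the constant \<open>\<kappa>\<close>, so that block contributes a factor
        independent of \<open>n\<close>.\<close>
      have prodE: "(\<Prod>k\<in>I. ?E k (\<lambda>a1 a2 b1 b2 z. ?L L k a1 a2 b1 b2 z powr (- t)))
          = E (\<lambda>a1 a2 b1 b2 z. L a1 a2 b1 b2 z powr (- t)) ^ m * \<kappa> powr (- t)" for L
      proof -
        let ?F = "\<lambda>k. ?E k (\<lambda>a1 a2 b1 b2 z. ?L L k a1 a2 b1 b2 z powr (- t))"
        have "(\<Prod>k\<in>I. ?F k) = (\<Prod>k<m. ?F k) * ?F m"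
          unfolding I_def m_def by simp
        also have "(\<Prod>k<m. ?F k) = (\<Prod>k<m. E (\<lambda>a1 a2 b1 b2 z. L a1 a2 b1 b2 z powr (- t)))"
          by (intro prod.cong refl) (simp add: E_def len_m)
        also have "?F m = \<kappa> powr (- t)"
        proof -
          have "?F m = (\<Sum>a1\<in>?A m. \<Sum>a2\<in>?A m. Q (len m) a1 a2 * (\<Sum>z\<in>?A m. T (len m) \<beta>1 \<beta>2 z)) * \<kappa> powr (- t)"
            by (simp add: sum_distrib_right sum_distrib_left)
          then show ?thesis using Q1 T1 by simp
        qed
        finally show ?thesis by simp
      qed
      let ?X1 = "\<lambda>a k. in1 (c1 a k)" and ?X2 = "\<lambda>a k. in2 (c2 a k)"
      let ?e1 = "\<lambda>s. paste n l (?X1 (cut n l s))" and ?e2 = "\<lambda>s. paste n l (?X2 (cut n l s))"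
      let ?d = "\<lambda>y. map_prod (paste n l) (paste n l) (d (cut n l y))"
      have "err_prob WS W n ?e1 ?e2 ?d \<le> ?err c1 c2 d"
        unfolding Q_def T_def I_def len_def
        using err_prob_paste_le[OF l WS0 W0, where ?X1.0 = ?X1 and ?X2.0 = ?X2 and d = d and n = n]
        by simp
      also have "\<dots> \<le> \<gamma> powr (- t) * (e1 ^ m * \<kappa> powr (- t) + e2 ^ m * \<kappa> powr (- t) + e3 ^ m * \<kappa> powr (- t)) + 3 * \<gamma>"
        using err unfolding prodE e1_def e2_def e3_def .
      also have "\<dots> = c * (e1 ^ m + e2 ^ m + e3 ^ m) + \<epsilon> / 2"
        by (simp add: c_def \<gamma>_def algebra_simps)
      also have "\<dots> \<le> \<epsilon>" using M[OF Mm] by simp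
      finally have "err_prob WS W n ?e1 ?e2 ?d \<le> \<epsilon>" .
      then show "\<exists>(en1::'s1 list \<Rightarrow> 'x1 list) (en2::'s2 list \<Rightarrow> 'x2 list)
        (d::'y list \<Rightarrow> 's1 list \<times> 's2 list).
        (\<forall>s. length s = n \<longrightarrow> length (en1 s) = n) \<and> (\<forall>s. length s = n \<longrightarrow> length (en2 s) = n) \<and>
        err_prob WS W n en1 en2 d \<le> \<epsilon>"
        by (intro exI[of _ ?e1] exI[of _ ?e2] exI[of _ ?d]) (simp add: paste_def)
    qed
  qed
qed

section \<open>Types and the random coding exponent\<close>

text \<open>Types are kept as integer counts: zero counts stay exact, and the number of possible
  joint counts is a plain power of \<open>l + 1\<close>.\<close>

definition cnt :: "nat \<Rightarrow> (nat \<Rightarrow> 'a) \<Rightarrow> 'a \<Rightarrow> nat" where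
  "cnt l x u = card {t. t < l \<and> x t = u}"

definition cnt2 :: "nat \<Rightarrow> (nat \<Rightarrow> 'a) \<Rightarrow> (nat \<Rightarrow> 'b) \<Rightarrow> 'a \<Rightarrow> 'b \<Rightarrow> nat" where
  "cnt2 l x y u v = card {t. t < l \<and> x t = u \<and> y t = v}"

lemma cnt2_swap: "cnt2 l y x v u = cnt2 l x y u v"
  by (simp add: cnt2_def conj_ac)

lemma cnt_pos: "t < l \<Longrightarrow> 0 < cnt l x (x t)"
  unfolding cnt_def by (subst card_gt_0_iff) auto

lemma cnt2_pos: "t < l \<Longrightarrow> 0 < cnt2 l x y (x t) (y t)"
  unfolding cnt2_def by (subst card_gt_0_iff) auto

lemma cnt_le: "cnt l x u \<le> l"
  unfolding cnt_def using card_mono[of "{..<l}" "{t. t < l \<and> x t = u}"] by auto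

lemma cnt2_le: "cnt2 l x y u v \<le> cnt l x u"
  unfolding cnt_def cnt2_def by (intro card_mono) auto

lemma sum_cnt:
  fixes x :: "nat \<Rightarrow> 'a::finite"
  shows "(\<Sum>t<l. f (x t)) = (\<Sum>u\<in>UNIV. real (cnt l x u) * f u)"
proof -
  have "(\<Sum>u\<in>UNIV. real (cnt l x u) * f u) = (\<Sum>u\<in>UNIV. \<Sum>t<l. if x t = u then f u else 0)"
    by (intro sum.cong refl) (simp add: cnt_def sum.If_cases Collect_conj_eq lessThan_def)
  also have "\<dots> = (\<Sum>t<l. \<Sum>u\<in>UNIV. if x t = u then f u else 0)" by (rule sum.swap)
  finally show ?thesis by simp
qed

lemma sum_cnt2:
  fixes x :: "nat \<Rightarrow> 'a::finite" and y :: "nat \<Rightarrow> 'b::finite"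
  shows "(\<Sum>t<l. f (x t) (y t)) = (\<Sum>u\<in>UNIV. \<Sum>v\<in>UNIV. real (cnt2 l x y u v) * f u v)"
proof -
  have "cnt l (\<lambda>t. (x t, y t)) w = cnt2 l x y (fst w) (snd w)" for w
    by (cases w) (simp add: cnt_def cnt2_def)
  then show ?thesis
    using sum_cnt[of "\<lambda>(u, v). f u v" "\<lambda>t. (x t, y t)" l]
    by (simp add: sum.cartesian_product case_prod_unfold)
qed

lemma sum_cnt2_right:
  fixes x :: "nat \<Rightarrow> 'a::finite" and y :: "nat \<Rightarrow> 'b::finite"
  shows "(\<Sum>v\<in>UNIV. cnt2 l x y u v) = cnt l x u"
proof -
  have "(\<Sum>v\<in>UNIV. cnt2 l x y u v) = card (\<Union>v\<in>UNIV. {t. t < l \<and> x t = u \<and> y t = v})"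
    unfolding cnt2_def by (subst card_UN_disjoint) auto
  also have "(\<Union>v\<in>UNIV. {t. t < l \<and> x t = u \<and> y t = v}) = {t. t < l \<and> x t = u}" by auto
  finally show ?thesis by (simp add: cnt_def)
qed

text \<open>A Shtarkov sum: all \<open>y\<close> with the same joint type with \<open>x\<close> use the same conditional
  distribution, hence contribute at most 1 together, and there are polynomially many types.\<close>
lemma normalized_likelihood_sum:
  fixes x :: "nat \<Rightarrow> 'a::finite"
  shows "(\<Sum>y\<in>(blocks l :: (nat \<Rightarrow> 'b::finite) set).
      \<Prod>t<l. real (cnt2 l x y (x t) (y t)) / real (cnt l x (x t)))
    \<le> (real l + 1) ^ (CARD('a) * CARD('b))"
proof -
  define g :: "(nat \<Rightarrow> 'b) \<Rightarrow> 'a \<times> 'b \<Rightarrow> nat" where "g y = (\<lambda>(u, v). cnt2 l x y u v)" for y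
  define F :: "('a \<times> 'b \<Rightarrow> nat) \<Rightarrow> (nat \<Rightarrow> 'b) \<Rightarrow> real"
    where "F M y = (\<Prod>t<l. real (M (x t, y t)) / real (cnt l x (x t)))" for M y
  define T :: "('a \<times> 'b \<Rightarrow> nat) set" where "T = (UNIV \<rightarrow>\<^sub>E {0..l})"
  have finT: "finite T" unfolding T_def by (intro finite_PiE) auto
  have F0: "0 \<le> F M y" for M y unfolding F_def by (intro prod_nonneg) auto
  have gT: "g ` blocks l \<subseteq> T"
    unfolding T_def g_def by (auto intro: order_trans[OF cnt2_le cnt_le])
  have "(\<Sum>y\<in>blocks l. F (g y) y) = (\<Sum>M\<in>T. \<Sum>y\<in>{y \<in> blocks l. g y = M}. F (g y) y)"
    using finT gT by (intro sum.group[symmetric]) auto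
  also have "\<dots> \<le> (\<Sum>M\<in>T. 1)"
  proof (intro sum_mono)
    fix M assume "M \<in> T"
    show "(\<Sum>y\<in>{y \<in> blocks l. g y = M}. F (g y) y) \<le> 1"
    proof (cases "\<exists>y0\<in>blocks l. g y0 = M")
      case True
      then obtain y0 where y0: "y0 \<in> blocks l" "g y0 = M" by auto
      have "(\<Sum>y\<in>{y \<in> blocks l. g y = M}. F (g y) y) \<le> (\<Sum>y\<in>blocks l. F M y)"
        using F0 by (subst sum.cong[where h = "F M"]) (auto intro!: sum_mono2)
      also have "\<dots> = (\<Prod>t<l. \<Sum>v\<in>UNIV. real (M (x t, v)) / real (cnt l x (x t)))"
        unfolding F_def by (rule sum_blocks_prod)
      also have "\<dots> = (\<Prod>t<l. real (\<Sum>v\<in>UNIV. cnt2 l x y0 (x t) v) / real (cnt l x (x t)))"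
        using y0(2)[symmetric] by (simp add: g_def sum_divide_distrib)
      also have "\<dots> = 1"
        unfolding sum_cnt2_right using cnt_pos[of _ l x] by (intro prod.neutral) auto
      finally show ?thesis .
    next
      case False
      then have "{y \<in> blocks l. g y = M} = {}" by auto
      then show ?thesis by (simp only: sum.empty zero_le_one)
    qed
  qed
  also have "\<dots> = real (card T)" by simp
  also have "card T = (l + 1) ^ (CARD('a) * CARD('b))"
    unfolding T_def by (simp add: card_PiE)
  finally show ?thesis by (simp add: F_def g_def add.commute)
qed

section \<open>Factorial bounds and the size of a type class\<close>

lemma fact_le_power_self: "(fact c :: real) \<le> (real c + 1)\<^sup>2 * real c ^ c / exp (real c)"
proof (cases "c = 0")
  case False
  \<comment> \<open>The induction starts at 1, where \<open>exp 1 \<le> 3\<close> dictates the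
    constant 3. The factor \<open>(real c + 1)\<^sup>2\<close> of the claim dominates
    \<open>3 * real c\<close> and also gives the correct value 1 at \<open>c = 0\<close>.\<close>
  have "(fact c :: real) \<le> 3 * real c * real c ^ c / exp (real c)" if "c \<noteq> 0"
    using that
  proof (induction c)
    case (Suc c)
    show ?case
    proof (cases "c = 0")
      case True
      then show ?thesis using exp_le by (simp add: field_simps)
    next
      case False
      \<comment> \<open>The bound 1 + x <= exp x at x = -1/(c+1), raised to the power c + 1, is
        exactly the growth from c to c + 1 that the induction needs.\<close>
      have "real c / (real c + 1) \<le> exp (- 1 / (real c + 1))"
        using exp_ge_add_one_self[of "- 1 / (real c + 1)"] by (simp add: field_simps)
      then have "(real c / (real c + 1)) ^ (c + 1) \<le> exp (- 1 / (real c + 1)) ^ (c + 1)"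
        by (intro power_mono) auto
      also have "\<dots> = exp (- 1)"
        by (subst exp_of_nat_mult[symmetric]) (simp add: field_simps)
      finally have "real c ^ (c + 1) / (real c + 1) ^ (c + 1) \<le> exp (- 1)"
        unfolding power_divide .
      then have "real c ^ (c + 1) \<le> exp (- 1) * (real c + 1) ^ (c + 1)"
        by (subst (asm) pos_divide_le_eq) auto
      then have "real c ^ (c + 1) * exp 1 \<le> exp (- 1) * (real c + 1) ^ (c + 1) * exp 1"
        by (intro mult_right_mono) auto
      also have "\<dots> = (real c + 1) ^ (c + 1)" by (simp add: exp_minus)
      finally have step: "real c ^ (c + 1) * exp 1 \<le> (real c + 1) ^ (c + 1)" .
      have "(fact (Suc c) :: real) = (real c + 1) * fact c" by (simp add: algebra_simps)
      also have "\<dots> \<le> (real c + 1) * (3 * real c * real c ^ c / exp (real c))"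
        using Suc.IH[OF False] by (intro mult_left_mono) auto
      also have "\<dots> = 3 * (real c + 1) * (real c ^ (c + 1) * exp 1) / exp (real c + 1)"
        by (simp add: exp_add field_simps)
      also have "\<dots> \<le> 3 * (real c + 1) * (real c + 1) ^ (c + 1) / exp (real c + 1)"
        using step by (intro divide_right_mono mult_left_mono) auto
      finally show ?thesis by (simp add: add.commute)
    qed
  qed simp
  also have "3 * real c * real c ^ c / exp (real c) \<le> (real c + 1)\<^sup>2 * real c ^ c / exp (real c)"
  proof (intro divide_right_mono mult_right_mono)
    have "0 \<le> (real c - 1)\<^sup>2 + real c" by simp
    then show "3 * real c \<le> (real c + 1)\<^sup>2" by (simp add: power2_eq_square algebra_simps)
  qed auto
  finally show ?thesis using False by simp
qed simp

text \<open>A single term of the exponential series at \<open>real l\<close> is at most the whole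
  series.\<close>

lemma power_self_le_fact: "real l ^ l / exp (real l) \<le> fact l"
proof -
  have "(\<Sum>n\<in>{l}. real l ^ n /\<^sub>R fact n) \<le> exp (real l)"
    unfolding exp_def by (intro sum_le_suminf summable_exp_generic) auto
  then show ?thesis by (simp add: field_simps)
qed

definition type_seqs :: "nat \<Rightarrow> ('u \<Rightarrow> real) \<Rightarrow> (nat \<Rightarrow> 'u) set" where
  "type_seqs l p = {x \<in> blocks l. \<forall>u. real (cnt l x u) = real l * p u}"

lemma prod_type_seqs:
  fixes p :: "'u::finite \<Rightarrow> real"
  assumes "x \<in> type_seqs l p"
  shows "(\<Prod>t<l. p (x t)) = (\<Prod>u\<in>UNIV. p u ^ cnt l x u)"
proof -
  have "(\<Prod>u\<in>UNIV. p u ^ cnt l x u) = (\<Prod>u\<in>UNIV. \<Prod>t<l. if x t = u then p u else 1)"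
    by (intro prod.cong refl) (simp add: cnt_def prod.If_cases Collect_conj_eq lessThan_def)
  also have "\<dots> = (\<Prod>t<l. \<Prod>u\<in>UNIV. if x t = u then p u else 1)" by (rule prod.swap)
  finally show ?thesis by simp
qed

text \<open>The product law of \<open>p\<close> gives every sequence of its own type the same
  probability \<open>h\<close>, and this type class carries at least an inverse polynomial share of
  the total mass. The share is a multinomial coefficient times \<open>h\<close>; each factorial in
  the denominator costs one factor \<open>(real l + 1)\<^sup>2\<close>, whence the exponent
  \<open>2 * CARD('u)\<close>.\<close>

lemma card_type_seqs_ge:
  fixes p :: "'u::finite \<Rightarrow> real"
  assumes p: "is_pmf p" "is_type l p" and l: "0 < l"
  obtains h where "0 < h" "\<And>x. x \<in> type_seqs l p \<Longrightarrow> (\<Prod>t<l. p (x t)) = h"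
    and "1 \<le> (real l + 1) ^ (2 * CARD('u)) * (h * real (card (type_seqs l p)))"
proof -
  have p0: "0 \<le> p u" for u using p by (simp add: is_pmf_def)
  define c where "c u = nat \<lfloor>real l * p u\<rfloor>" for u
  have c: "real (c u) = real l * p u" for u
  proof -
    have "real l * p u \<in> \<int>" using p by (simp add: is_type_def)
    then show ?thesis using p0[of u] unfolding c_def by (auto elim!: Ints_cases)
  qed
  have sum_c: "(\<Sum>u\<in>UNIV. c u) = l"
  proof -
    have "real (\<Sum>u\<in>UNIV. c u) = real l" using p by (simp add: c sum_distrib_left[symmetric] is_pmf_def)
    then show ?thesis by (simp only: of_nat_eq_iff)
  qed
  have c_le: "c u \<le> l" for u
    unfolding sum_c[symmetric] by (rule member_le_sum) auto
  \<comment> \<open>The arrangements of this multiset are the sequences of the given type, so the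
    counting formula for multiset permutations supplies the multinomial coefficient. An injection
    into \<open>type_seqs\<close> suffices for a lower bound.\<close>
  define A where "A = (\<Sum>u\<in>UNIV. replicate_mset (c u) u)"
  have countA: "count A u = c u" for u
    unfolding A_def by (simp add: count_sum)
  have "size A = (\<Sum>u\<in>UNIV. count A u)"
    unfolding size_multiset_overloaded_eq by (rule sum.mono_neutral_left) (auto simp: not_in_iff)
  then have sizeA: "size A = l" by (simp add: countA sum_c)
  define h where "h = (\<Prod>u\<in>UNIV. p u ^ c u)"
  have h_pos: "0 < h"
    unfolding h_def
  proof (intro prod_pos)
    fix u show "0 < p u ^ c u"
    proof (cases "c u = 0")
      case False
      then have "0 < real l * p u" using c[of u] by simp
      then show ?thesis using l by (simp add: zero_less_mult_iff)
    qed simp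
  qed
  have h: "(\<Prod>t<l. p (x t)) = h" if "x \<in> type_seqs l p" for x
  proof -
    have "cnt l x u = c u" for u
      using that c[of u] by (simp add: type_seqs_def flip: of_nat_eq_iff[where 'a = real])
    then show ?thesis using prod_type_seqs[OF that] by (simp add: h_def)
  qed
  have h_eq: "h = (\<Prod>u\<in>UNIV. real (c u) ^ c u) / real l ^ l"
  proof -
    have "h = (\<Prod>u\<in>UNIV. (real (c u) / real l) ^ c u)" unfolding h_def c using l by simp
    also have "\<dots> = (\<Prod>u\<in>UNIV. real (c u) ^ c u) / (\<Prod>u\<in>UNIV. real l ^ c u)"
      by (simp add: power_divide prod_dividef)
    also have "(\<Prod>u\<in>UNIV. real l ^ c u) = real l ^ l" by (simp flip: power_sum add: sum_c)
    finally show ?thesis .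
  qed
  have "(fact l :: real) = real (card (permutations_of_multiset A)) * (\<Prod>u\<in>UNIV. fact (c u))"
  proof -
    have 1: "card (permutations_of_multiset A) * (\<Prod>x\<in>set_mset A. fact (count A x)) = fact (size A)"
      using card_permutations_of_multiset[of A] by simp
    have 2: "(\<Prod>x\<in>set_mset A. fact (count A x) :: nat) = (\<Prod>u\<in>UNIV. fact (c u))"
      by (rule prod.mono_neutral_cong_left) (auto simp: countA not_in_iff)
    have "real (card (permutations_of_multiset A) * (\<Prod>u\<in>UNIV. fact (c u))) = real (fact l)"
      using 1 unfolding 2 sizeA by (rule arg_cong)
    then show ?thesis by simp
  qed
  also have "\<dots> \<le> real (card (type_seqs l p)) * (\<Prod>u\<in>UNIV. fact (c u))"
  proof (intro mult_right_mono of_nat_mono prod_nonneg)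
    let ?f = "\<lambda>xs :: 'u list. \<lambda>t\<in>{..<l}. xs ! t"
    show "card (permutations_of_multiset A) \<le> card (type_seqs l p)"
    proof (rule card_inj_on_le[where f = ?f])
      show "inj_on ?f (permutations_of_multiset A)"
      proof (rule inj_onI)
        fix xs ys assume a: "xs \<in> permutations_of_multiset A" "ys \<in> permutations_of_multiset A"
          and e: "?f xs = ?f ys"
        have len: "length xs = l" "length ys = l"
          using a sizeA by (auto simp: permutations_of_multiset_def simp flip: size_mset)
        show "xs = ys"
        proof (rule nth_equalityI)
          fix i assume "i < length xs"
          then show "xs ! i = ys ! i" using fun_cong[OF e, of i] len by simp
        qed (use len in simp)
      qed
      show "?f ` permutations_of_multiset A \<subseteq> type_seqs l p"
      proof (intro image_subsetI)
        fix xs assume "xs \<in> permutations_of_multiset A"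
        then have m: "mset xs = A" by (simp add: permutations_of_multiset_def)
        then have len: "length xs = l" using sizeA by (simp flip: size_mset)
        have "cnt l (?f xs) u = c u" for u
        proof -
          have "cnt l (?f xs) u = card {t. t < length xs \<and> u = xs ! t}"
            unfolding cnt_def by (rule arg_cong[where f = card]) (auto simp: len)
          also have "\<dots> = count (mset xs) u" unfolding count_mset count_list_eq_length_filter length_filter_conv_card ..
          finally show ?thesis using m countA by simp
        qed
        then show "?f xs \<in> type_seqs l p"
          by (simp add: type_seqs_def c blocks_def)
      qed
      show "finite (type_seqs l p)" unfolding type_seqs_def by simp
    qed
  qed simp
  also have "\<dots> \<le> real (card (type_seqs l p)) * (\<Prod>u\<in>UNIV. (real l + 1)\<^sup>2 * (real (c u) ^ c u / exp (real (c u))))"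
  proof (intro mult_left_mono prod_mono conjI)
    fix u
    have "(fact (c u) :: real) \<le> (real (c u) + 1)\<^sup>2 * (real (c u) ^ c u / exp (real (c u)))"
      using fact_le_power_self[of "c u"] by simp
    also have "\<dots> \<le> (real l + 1)\<^sup>2 * (real (c u) ^ c u / exp (real (c u)))"
      using c_le by (intro mult_right_mono power_mono) auto
    finally show "(fact (c u) :: real) \<le> (real l + 1)\<^sup>2 * (real (c u) ^ c u / exp (real (c u)))" .
  qed auto
  also have "(\<Prod>u\<in>UNIV. (real l + 1)\<^sup>2 * (real (c u) ^ c u / exp (real (c u))))
      = (real l + 1) ^ (2 * CARD('u)) * ((\<Prod>u\<in>UNIV. real (c u) ^ c u) / exp (real l))"
    by (simp add: prod.distrib prod_dividef power_mult exp_sum[symmetric] of_nat_sum[symmetric] sum_c del: of_nat_sum)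
  finally have "real l ^ l / exp (real l) \<le> real (card (type_seqs l p)) *
      ((real l + 1) ^ (2 * CARD('u)) * ((\<Prod>u\<in>UNIV. real (c u) ^ c u) / exp (real l)))"
    using power_self_le_fact[of l] by linarith
  then have "real l ^ l \<le> real (card (type_seqs l p)) *
      ((real l + 1) ^ (2 * CARD('u)) * (\<Prod>u\<in>UNIV. real (c u) ^ c u))"
    by (simp add: field_simps)
  then have "1 \<le> (real l + 1) ^ (2 * CARD('u)) * (h * real (card (type_seqs l p)))"
    unfolding h_eq using l by (simp add: field_simps)
  with h_pos h show ?thesis using that by blast
qed


text \<open>Entropy as an expectation over the underlying space instead of a sum over values. In
  this form entropies of different variables combine under one sum, and points of probability 0 drop
  out.\<close>

lemma ent_eq_sum:
  fixes P :: "'a::finite \<Rightarrow> real"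
  shows "ent P f = - (\<Sum>x\<in>UNIV. P x * ln (\<Sum>x'\<in>{x'. f x' = f x}. P x'))"
proof -
  have "(\<Sum>b\<in>range f. (\<Sum>x\<in>{x. f x = b}. P x) * ln (\<Sum>x\<in>{x. f x = b}. P x))
      = (\<Sum>b\<in>range f. \<Sum>x\<in>{x \<in> UNIV. f x = b}. P x * ln (\<Sum>x'\<in>{x'. f x' = f x}. P x'))"
    unfolding sum_distrib_right by (intro sum.cong) auto
  also have "\<dots> = (\<Sum>x\<in>UNIV. P x * ln (\<Sum>x'\<in>{x'. f x' = f x}. P x'))"
    by (rule sum.group) auto
  finally show ?thesis unfolding ent_def by simp
qed

lemma mi_ch_eq_sum:
  fixes p :: "'u::finite \<Rightarrow> real" and V :: "'u \<Rightarrow> 'y::finite \<Rightarrow> real"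
  assumes "\<And>u. 0 \<le> p u" "\<And>u y. 0 \<le> V u y" "\<And>u. (\<Sum>y\<in>UNIV. V u y) = 1"
  shows "mi_ch p V = (\<Sum>u\<in>UNIV. \<Sum>y\<in>UNIV. p u * V u y * ln (V u y / (\<Sum>u'\<in>UNIV. p u' * V u' y)))"
proof -
  define J where "J = (\<lambda>(u, y). p u * V u y)"
  have 1: "(\<Sum>x'\<in>{x'. fst x' = fst x}. J x') = p (fst x)" for x
  proof -
    have e: "{x'. fst x' = fst x} = Pair (fst x) ` UNIV" by (auto simp: image_iff)
    show ?thesis
      unfolding e using assms by (simp add: sum.reindex inj_on_def J_def flip: sum_distrib_left)
  qed
  have 2: "(\<Sum>x'\<in>{x'. snd x' = snd x}. J x') = (\<Sum>u'\<in>UNIV. p u' * V u' (snd x))" for x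
  proof -
    have e: "{x'. snd x' = snd x} = (\<lambda>u. (u, snd x)) ` UNIV" by (auto simp: image_iff)
    show ?thesis unfolding e by (simp add: sum.reindex inj_on_def J_def)
  qed
  have "mi_ch p V = (\<Sum>x\<in>UNIV. J x * (ln (J x) - ln (p (fst x)) - ln (\<Sum>u'\<in>UNIV. p u' * V u' (snd x))))"
    unfolding mi_ch_def Let_def J_def[symmetric] ent_eq_sum 1 2
    by (simp add: right_diff_distrib sum_subtractf)
  also have "\<dots> = (\<Sum>x\<in>UNIV. p (fst x) * V (fst x) (snd x) *
      ln (V (fst x) (snd x) / (\<Sum>u'\<in>UNIV. p u' * V u' (snd x))))"
  proof (intro sum.cong refl)
    fix x :: "'u \<times> 'y"
    obtain u y where x: "x = (u, y)" by fastforce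
    show "J x * (ln (J x) - ln (p (fst x)) - ln (\<Sum>u'\<in>UNIV. p u' * V u' (snd x)))
        = p (fst x) * V (fst x) (snd x) * ln (V (fst x) (snd x) / (\<Sum>u'\<in>UNIV. p u' * V u' (snd x)))"
    proof (cases "p u * V u y = 0")
      case False
      then have pos: "0 < p u" "0 < V u y" using assms by (auto simp: order_less_le)
      have "p u * V u y \<le> (\<Sum>u'\<in>UNIV. p u' * V u' y)"
        using assms by (intro member_le_sum) auto
      then have "0 < (\<Sum>u'\<in>UNIV. p u' * V u' y)" using pos by (meson less_le_trans mult_pos_pos)
      then show ?thesis using pos by (simp add: x J_def ln_mult ln_div)
    qed (simp add: x J_def)
  qed
  finally show ?thesis by (simp add: sum.cartesian_product case_prod_unfold)
qed

text \<open>An infimum of reals is a lower bound only for sets bounded below; here this is the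
  nonnegativity of the divergence, obtained from ln x <= x - 1 on the rows that carry
  weight.\<close>

lemma Er_le:
  fixes p :: "'u::finite \<Rightarrow> real" and w :: "'u \<Rightarrow> 'y::finite \<Rightarrow> real"
  assumes p: "is_pmf p" and w: "\<And>u. 0 < p u \<Longrightarrow> is_pmf (w u)"
    and V: "\<And>u. is_pmf (V u)" "\<And>u y. 0 < p u \<Longrightarrow> w u y = 0 \<Longrightarrow> V u y = 0"
  shows "Er R p w \<le> cdiv V w p + max 0 (mi_ch p V - R)"
  unfolding Er_def
proof (rule cInf_lower)
  show "cdiv V w p + max 0 (mi_ch p V - R) \<in> (\<lambda>V. cdiv V w p + max 0 (mi_ch p V - R)) `
      {V. (\<forall>u. is_pmf (V u)) \<and> (\<forall>u y. 0 < p u \<and> w u y = 0 \<longrightarrow> V u y = 0)}"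
    using V by blast
  have "0 \<le> cdiv V w p" if V: "\<forall>u. is_pmf (V u)" "\<forall>u y. 0 < p u \<and> w u y = 0 \<longrightarrow> V u y = 0" for V
    unfolding cdiv_def
  proof (intro sum_nonneg)
    fix u
    show "0 \<le> p u * (\<Sum>y\<in>UNIV. V u y * ln (V u y / w u y))"
    proof (cases "p u = 0")
      case False
      then have pu: "0 < p u" using p by (simp add: is_pmf_def order_less_le)
      have "0 = (\<Sum>y\<in>UNIV. V u y - w u y)"
        using V w[OF pu] by (simp add: sum_subtractf is_pmf_def)
      also have "\<dots> \<le> (\<Sum>y\<in>UNIV. V u y * ln (V u y / w u y))"
      proof (rule sum_mono)
        fix y
        have nn: "0 \<le> V u y" "0 \<le> w u y" using V w[OF pu] by (auto simp: is_pmf_def)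
        show "V u y - w u y \<le> V u y * ln (V u y / w u y)"
        proof (cases "V u y = 0")
          case False
          then have pos: "0 < V u y" "0 < w u y" using nn V pu by (auto simp: order_less_le)
          then have "ln (w u y / V u y) \<le> w u y / V u y - 1" by (intro ln_le_minus_one) simp
          then have "V u y * ln (w u y / V u y) \<le> V u y * (w u y / V u y - 1)"
            using pos by (intro mult_left_mono) auto
          then show ?thesis using pos by (simp add: ln_div algebra_simps)
        qed (use nn in simp)
      qed
      finally show ?thesis using pu by simp
    qed simp
  qed
  then show "bdd_below ((\<lambda>V. cdiv V w p + max 0 (mi_ch p V - R)) `
      {V. (\<forall>u. is_pmf (V u)) \<and> (\<forall>u y. 0 < p u \<and> w u y = 0 \<longrightarrow> V u y = 0)})"
    by (intro bdd_belowI2[where m = 0]) (simp add: add_nonneg_nonneg)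
qed

text \<open>This is \<open>exp (l I(x;y))\<close> for the empirical mutual information, the score of the MMI decoder.\<close>
definition emp_mi :: "nat \<Rightarrow> (nat \<Rightarrow> 'u) \<Rightarrow> (nat \<Rightarrow> 'y) \<Rightarrow> real" where
  "emp_mi l x y = (\<Prod>t<l. real (cnt2 l x y (x t) (y t)) / (real (cnt l x (x t)) * (real (cnt l y (y t)) / real l)))"

lemma emp_mi_pos: "0 < emp_mi l x y"
  unfolding emp_mi_def
proof (intro prod_pos)
  fix t assume "t \<in> {..<l}"
  then have "t < l" by simp
  then show "0 < real (cnt2 l x y (x t) (y t)) / (real (cnt l x (x t)) * (real (cnt l y (y t)) / real l))"
    using cnt_pos[of t l x] cnt_pos[of t l y] cnt2_pos[of t l x y] by simp
qed

text \<open>On the type class the counts of \<open>x\<close> are prescribed, so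
  \<open>emp_mi\<close> equals the empirical likelihood of \<open>x\<close> given \<open>y\<close>
  divided by the common probability \<open>h\<close>. The numerators form the Shtarkov sum with the
  roles of \<open>x\<close> and \<open>y\<close> exchanged, and \<open>card_type_seqs_ge\<close>
  converts \<open>1 / h\<close> into the size of the class. Divided by that size, the mean score of
  a random codeword is polynomial.\<close>

lemma sum_emp_mi_le:
  fixes p :: "'u::finite \<Rightarrow> real" and y :: "nat \<Rightarrow> 'y::finite"
  assumes p: "is_pmf p" "is_type l p" and l: "0 < l"
  shows "(\<Sum>x\<in>type_seqs l p. emp_mi l x y)
    \<le> (real l + 1) ^ (2 * CARD('u) + CARD('u) * CARD('y)) * card (type_seqs l p)"
proof -
  obtain h where h: "0 < h" "\<And>x. x \<in> type_seqs l p \<Longrightarrow> (\<Prod>t<l. p (x t)) = h"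
    and h1: "1 \<le> (real l + 1) ^ (2 * CARD('u)) * (h * real (card (type_seqs l p)))"
    using card_type_seqs_ge[OF p l] by blast
  let ?P = "\<lambda>x :: nat \<Rightarrow> 'u. \<Prod>t<l. real (cnt2 l y x (y t) (x t)) / real (cnt l y (y t))"
  have "emp_mi l x y = ?P x / h" if "x \<in> type_seqs l p" for x
  proof -
    have "real (cnt l x (x t)) = real l * p (x t)" for t using that by (simp add: type_seqs_def)
    then have "emp_mi l x y = (\<Prod>t<l. real (cnt2 l y x (y t) (x t)) / real (cnt l y (y t)) / p (x t))"
      unfolding emp_mi_def using l by (intro prod.cong) (auto simp: cnt2_swap[of l x y] field_simps)
    then show ?thesis using h(2)[OF that] by (simp add: prod_dividef prod.distrib)
  qed
  then have "(\<Sum>x\<in>type_seqs l p. emp_mi l x y) = (\<Sum>x\<in>type_seqs l p. ?P x) / h"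
    by (simp add: sum_divide_distrib)
  also have "\<dots> \<le> (\<Sum>x\<in>blocks l. ?P x) / h"
  proof (intro divide_right_mono sum_mono2 prod_nonneg)
    show "type_seqs l p \<subseteq> blocks l" by (auto simp: type_seqs_def)
  qed (use h in auto)
  also have "\<dots> \<le> (real l + 1) ^ (CARD('y) * CARD('u)) / h"
    using h normalized_likelihood_sum[of l y, where 'b = 'u] by (intro divide_right_mono) auto
  also have "\<dots> \<le> (real l + 1) ^ (CARD('y) * CARD('u)) * ((real l + 1) ^ (2 * CARD('u)) * real (card (type_seqs l p)))"
  proof -
    have "1 / h \<le> (real l + 1) ^ (2 * CARD('u)) * real (card (type_seqs l p))"
      using h1 h by (simp add: divide_le_eq mult_ac)
    from mult_left_mono[OF this, of "(real l + 1) ^ (CARD('y) * CARD('u))"] show ?thesis by simp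
  qed
  also have "\<dots> = (real l + 1) ^ (2 * CARD('u) + CARD('u) * CARD('y)) * card (type_seqs l p)"
    by (simp add: power_add mult_ac)
  finally show ?thesis .
qed

text \<open>With \<open>V\<close> the empirical channel from \<open>x\<close> to \<open>y\<close>,
  the probability of \<open>y\<close> under \<open>w\<close> is its probability under
  \<open>V\<close> times exp(-l D(V||w|p)), and the minimum equals exp(-l |I(p;V) - R|^+). The
  exponents add up to one of the values over which \<open>Er\<close> is the infimum.\<close>

lemma channel_emp_mi_le:
  fixes p :: "'u::finite \<Rightarrow> real" and w :: "'u \<Rightarrow> 'y::finite \<Rightarrow> real"
  assumes p: "is_pmf p" and w: "\<And>u. 0 < p u \<Longrightarrow> is_pmf (w u)" and l: "0 < l"
    and x: "x \<in> type_seqs l p"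
  shows "(\<Prod>t<l. w (x t) (y t)) * min 1 (exp (real l * R) / emp_mi l x y)
    \<le> (\<Prod>t<l. real (cnt2 l x y (x t) (y t)) / real (cnt l x (x t))) * exp (- real l * Er R p w)"
proof (cases "\<exists>t<l. w (x t) (y t) = 0")
  case True
  then have z: "(\<Prod>t<l. w (x t) (y t)) = 0" by auto
  show ?thesis unfolding z by (simp add: prod_nonneg)
next
  case False
  have n: "real (cnt l x u) = real l * p u" for u using x by (simp add: type_seqs_def)
  have p0: "0 \<le> p u" for u using p by (simp add: is_pmf_def)
  have pos: "0 < p (x t)" if "t < l" for t
  proof -
    have "0 < real l * p (x t)" using cnt_pos[OF that, of x] unfolding n[symmetric] by simp
    then show ?thesis using l by (simp add: zero_less_mult_iff)
  qed
  have wpos: "0 < w (x t) (y t)" if "t < l" for t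
    using w[OF pos[OF that]] False that by (auto simp: is_pmf_def order_less_le)
  \<comment> \<open>Rows that \<open>x\<close> never visits have no empirical distribution. The
    uniform one makes \<open>V\<close> stochastic and carries no weight in the divergence or the
    mutual information.\<close>
  define V where "V u v = (if p u = 0 then 1 / real CARD('y) else real (cnt2 l x y u v) / real (cnt l x u))" for u v
  have V: "is_pmf (V u)" for u
  proof (cases "p u = 0")
    case False
    then have "real (cnt l x u) \<noteq> 0" using l n by simp
    then show ?thesis using False sum_cnt2_right[of l x y u]
      by (simp add: is_pmf_def V_def flip: sum_divide_distrib of_nat_sum)
  qed (simp add: is_pmf_def V_def)
  have Vx: "V (x t) (y t) = real (cnt2 l x y (x t) (y t)) / real (cnt l x (x t))" if "t < l" for t
    using pos[OF that] by (simp add: V_def)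
  have Vpos: "0 < V (x t) (y t)" if "t < l" for t
    using cnt_pos[OF that, of x] cnt2_pos[OF that, of x y] unfolding Vx[OF that] by simp
  have pV: "real l * (p u * V u v) = real (cnt2 l x y u v)" for u v
  proof (cases "p u = 0")
    case True
    then show ?thesis using n[of u] cnt2_le[of l x y u v] by simp
  next
    case False
    then show ?thesis using n[of u] l by (simp add: V_def)
  qed
  have "Er R p w \<le> cdiv V w p + max 0 (mi_ch p V - R)"
  proof (rule Er_le[OF p w V])
    fix u v assume u: "0 < p u" "w u v = 0"
    have "cnt2 l x y u v = 0"
    proof (rule ccontr)
      assume "cnt2 l x y u v \<noteq> 0"
      then have "{t. t < l \<and> x t = u \<and> y t = v} \<noteq> {}" unfolding cnt2_def by (metis card.empty)
      then obtain t where "t < l" "x t = u" "y t = v" by auto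
      then show False using wpos[of t] u by simp
    qed
    then show "V u v = 0" using u by (simp add: V_def)
  qed
  then have Er: "- real l * (cdiv V w p + max 0 (mi_ch p V - R)) \<le> - real l * Er R p w"
    by (intro mult_left_mono_neg) auto
  have cdiv: "real l * cdiv V w p = (\<Sum>t<l. ln (V (x t) (y t) / w (x t) (y t)))"
    unfolding cdiv_def sum_distrib_left sum_cnt2[where f = "\<lambda>u v. ln (V u v / w u v)"]
    using pV by (intro sum.cong refl) (simp add: mult.assoc[symmetric])
  have mi: "real l * mi_ch p V = ln (emp_mi l x y)"
  proof -
    have marg: "(\<Sum>u\<in>UNIV. p u * V u v) = real (cnt l y v) / real l" for v
    proof -
      have "real l * (\<Sum>u\<in>UNIV. p u * V u v) = real (\<Sum>u\<in>UNIV. cnt2 l y x v u)"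
        unfolding sum_distrib_left pV cnt2_swap[of l y x v] by simp
      then show ?thesis unfolding sum_cnt2_right using l by (simp add: field_simps)
    qed
    have "real l * mi_ch p V = (\<Sum>t<l. ln (V (x t) (y t) / (real (cnt l y (y t)) / real l)))"
      using V unfolding sum_cnt2[where f = "\<lambda>u v. ln (V u v / (real (cnt l y v) / real l))"]
      by (subst mi_ch_eq_sum) (auto simp: p0 is_pmf_def marg sum_distrib_left mult.assoc[symmetric] pV[unfolded mult.assoc[symmetric]])
    also have "\<dots> = ln (\<Prod>t<l. V (x t) (y t) / (real (cnt l y (y t)) / real l))"
      using Vpos[THEN less_imp_neq] l cnt_pos[of _ l y] Vpos by (subst ln_prod) fastforce+
    also have "(\<Prod>t<l. V (x t) (y t) / (real (cnt l y (y t)) / real l)) = emp_mi l x y"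
      unfolding emp_mi_def by (intro prod.cong refl) (simp add: Vx)
    finally show ?thesis .
  qed
  have "(\<Prod>t<l. w (x t) (y t)) = (\<Prod>t<l. V (x t) (y t) * exp (- ln (V (x t) (y t) / w (x t) (y t))))"
  proof (intro prod.cong refl)
    fix t assume "t \<in> {..<l}"
    then show "w (x t) (y t) = V (x t) (y t) * exp (- ln (V (x t) (y t) / w (x t) (y t)))"
      using wpos[of t] Vpos[of t] by (simp add: ln_div exp_diff)
  qed
  also have "\<dots> = (\<Prod>t<l. V (x t) (y t)) * exp (- real l * cdiv V w p)"
    using cdiv by (simp add: prod.distrib exp_sum[symmetric] sum_negf)
  finally have W: "(\<Prod>t<l. w (x t) (y t)) = (\<Prod>t<l. V (x t) (y t)) * exp (- real l * cdiv V w p)" .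
  have "min 1 (exp (real l * R) / emp_mi l x y) = exp (- max 0 (real l * (mi_ch p V - R)))"
  proof -
    have "exp (real l * R) / emp_mi l x y = exp (real l * R - real l * mi_ch p V)"
      using emp_mi_pos[of l x y] by (simp add: exp_diff mi)
    moreover have "- max 0 (real l * (mi_ch p V - R)) = min 0 (real l * R - real l * mi_ch p V)"
      by (simp add: right_diff_distrib max_def min_def)
    moreover have "min 1 (exp a) = exp (min 0 a)" for a :: real
      by (simp add: min_def)
    ultimately show ?thesis by simp
  qed
  also have "max 0 (real l * (mi_ch p V - R)) = real l * max 0 (mi_ch p V - R)"
    using l by (simp add: max_def zero_le_mult_iff)
  finally have "(\<Prod>t<l. w (x t) (y t)) * min 1 (exp (real l * R) / emp_mi l x y)
      = (\<Prod>t<l. V (x t) (y t)) * exp (- real l * (cdiv V w p + max 0 (mi_ch p V - R)))"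
    unfolding W by (simp add: exp_add[symmetric] algebra_simps)
  also have "\<dots> \<le> (\<Prod>t<l. V (x t) (y t)) * exp (- real l * Er R p w)"
    using Er Vpos by (intro mult_left_mono prod_nonneg) (auto intro: less_imp_le)
  finally show ?thesis using Vx by simp
qed


text \<open>Codewords are uniform on the type class and decoded by the largest
  \<open>emp_mi\<close>, so the decoder does not depend on the channel. A competitor has polynomial
  mean score, whence the union bound in terms of \<open>?K / emp_mi\<close>; that polynomial is
  charged to the rate through the hypothesis on \<open>M\<close>, the one in the conclusion comes
  from summing over outputs. The weights \<open>\<pi>\<close> may sum to less than 1, since only
  typical blocks will be counted.\<close>

lemma constant_composition_code:
  fixes p :: "'u::finite \<Rightarrow> real" and w :: "'u \<Rightarrow> 'y::finite \<Rightarrow> real" and \<pi> :: "nat \<Rightarrow> real"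
  assumes p: "is_pmf p" "is_type l p" and w0: "\<And>u y. 0 \<le> w u y" and w: "\<And>u. 0 < p u \<Longrightarrow> is_pmf (w u)" and l: "0 < l"
    and \<pi>: "\<And>i. i < M \<Longrightarrow> 0 \<le> \<pi> i" "(\<Sum>i<M. \<pi> i) \<le> 1"
    and M: "real M * (real l + 1) ^ (2 * CARD('u) + CARD('u) * CARD('y)) \<le> exp (real l * R)"
  shows "\<exists>cw dec. (\<forall>i<M. cw i \<in> type_seqs l p) \<and>
    (\<Sum>i<M. \<pi> i * (\<Sum>y\<in>blocks l. (\<Prod>t<l. w (cw i t) (y t)) * of_bool (dec y \<noteq> i)))
      \<le> (real l + 1) ^ (CARD('u) * CARD('y)) * exp (- real l * Er R p w)"
proof -
  let ?B = "type_seqs l p" and ?A = "{..<M}"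
  let ?K = "real M * (real l + 1) ^ (2 * CARD('u) + CARD('u) * CARD('y))"
  let ?poly = "(real l + 1) ^ (2 * CARD('u) + CARD('u) * CARD('y))"
  let ?rhs = "(real l + 1) ^ (CARD('u) * CARD('y)) * exp (- real l * Er R p w)"
  define \<mu> where "\<mu> = 1 / real (card ?B)"
  let ?mean = "codebook_mean ?A ?B (\<lambda>_ _. \<mu>)"
  have finB: "finite ?B" by (simp add: type_seqs_def)
  have cardB: "0 < card ?B"
  proof (rule ccontr)
    assume "\<not> 0 < card ?B"
    then show False using card_type_seqs_ge[OF p l] by (metis mult_zero_right not_gr_zero not_one_le_zero of_nat_0)
  qed
  have \<mu>: "0 < \<mu>" "(\<Sum>x\<in>?B. \<mu>) = 1" unfolding \<mu>_def using cardB by auto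
  define Wl where "Wl x y = (\<Prod>t<l. w (x t) (y t))" for x :: "nat \<Rightarrow> 'u" and y :: "nat \<Rightarrow> 'y"
  have Wl0: "0 \<le> Wl x y" for x y unfolding Wl_def using w0 by (intro prod_nonneg) auto
  \<comment> \<open>Deciding between 1 and the union bound by \<open>good\<close>, which only depends on the sent codeword,
    keeps the bound \<open>b\<close> linear in the other codewords.\<close>
  define good where "good x y \<longleftrightarrow> ?K \<le> emp_mi l x y" for x :: "nat \<Rightarrow> 'u" and y :: "nat \<Rightarrow> 'y"
  define bad1 where "bad1 x y = Wl x y * of_bool (\<not> good x y)" for x y
  define t where "t x y = Wl x y * (of_bool (good x y) / emp_mi l x y)" for x y
  define b where "b c i y = bad1 (c i) y + t (c i) y * (\<Sum>j\<in>?A - {i}. emp_mi l (c j) y)" for c i y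
  have mean_b: "?mean (\<lambda>c. b c i y) \<le> (\<Sum>x\<in>?B. \<mu> * (\<Prod>t<l. real (cnt2 l x y (x t) (y t)) / real (cnt l x (x t)))) * exp (- real l * Er R p w)"
    if i: "i < M" for i y
  proof -
    have "?mean (\<lambda>c. b c i y) = (\<Sum>x\<in>?B. \<mu> * bad1 x y)
        + (\<Sum>x\<in>?B. \<mu> * t x y) * (\<Sum>j\<in>?A - {i}. \<Sum>x\<in>?B. \<mu> * emp_mi l x y)"
      unfolding b_def codebook_mean_add
      using codebook_mean_at[of ?A ?B i "\<lambda>_ _. \<mu>" "\<lambda>x. bad1 x y"]
        codebook_mean_others[of ?A ?B i "\<lambda>_ _. \<mu>" "\<lambda>x. t x y" "\<lambda>_ x. emp_mi l x y"] finB \<mu> i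
      by simp
    also have "\<dots> \<le> (\<Sum>x\<in>?B. \<mu> * bad1 x y) + (\<Sum>x\<in>?B. \<mu> * t x y) * ?K"
    proof (intro add_left_mono mult_left_mono)
      have "(\<Sum>x\<in>?B. \<mu> * emp_mi l x y) \<le> ?poly"
        using sum_emp_mi_le[OF p l, of y] cardB
        by (simp add: \<mu>_def sum_divide_distrib[symmetric] divide_le_eq)
      then have "(\<Sum>j\<in>?A - {i}. \<Sum>x\<in>?B. \<mu> * emp_mi l x y) \<le> (\<Sum>j\<in>?A - {i}. ?poly)"
        by (intro sum_mono) auto
      also have "\<dots> \<le> (\<Sum>j\<in>?A. ?poly)" by (intro sum_mono2) auto
      finally show "(\<Sum>j\<in>?A - {i}. \<Sum>x\<in>?B. \<mu> * emp_mi l x y) \<le> ?K" by simp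
      show "0 \<le> (\<Sum>x\<in>?B. \<mu> * t x y)"
        unfolding t_def using \<mu> Wl0 emp_mi_pos[of l _ y] by (intro sum_nonneg mult_nonneg_nonneg) (auto intro: less_imp_le)
    qed
    also have "\<dots> = (\<Sum>x\<in>?B. \<mu> * (Wl x y * (of_bool (\<not> good x y) + of_bool (good x y) * (?K / emp_mi l x y))))"
      unfolding bad1_def t_def sum_distrib_right sum.distrib[symmetric]
      by (intro sum.cong refl) (simp add: distrib_left mult_ac)
    also have "\<dots> \<le> (\<Sum>x\<in>?B. \<mu> * ((\<Prod>t<l. real (cnt2 l x y (x t) (y t)) / real (cnt l x (x t))) * exp (- real l * Er R p w)))"
    proof (intro sum_mono mult_left_mono)
      fix x assume x: "x \<in> ?B"
      have "of_bool (\<not> good x y) + of_bool (good x y) * (?K / emp_mi l x y) \<le> min 1 (exp (real l * R) / emp_mi l x y)"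
      proof (cases "good x y")
        case True
        then show ?thesis using M emp_mi_pos[of l x y]
          by (auto simp: good_def divide_le_eq intro!: divide_right_mono)
      next
        case False
        then show ?thesis using M emp_mi_pos[of l x y] by (simp add: good_def le_divide_eq)
      qed
      then have "Wl x y * (of_bool (\<not> good x y) + of_bool (good x y) * (?K / emp_mi l x y))
        \<le> Wl x y * min 1 (exp (real l * R) / emp_mi l x y)"
        using Wl0 by (rule mult_left_mono)
      also have "\<dots> \<le> (\<Prod>t<l. real (cnt2 l x y (x t) (y t)) / real (cnt l x (x t))) * exp (- real l * Er R p w)"
        unfolding Wl_def by (rule channel_emp_mi_le[OF p(1) w l x])
      finally show "Wl x y * (of_bool (\<not> good x y) + of_bool (good x y) * (?K / emp_mi l x y))
        \<le> (\<Prod>t<l. real (cnt2 l x y (x t) (y t)) / real (cnt l x (x t))) * exp (- real l * Er R p w)" .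
    qed (use \<mu> in simp)
    finally show ?thesis by (simp add: sum_distrib_right mult.assoc)
  qed
  have "?mean (\<lambda>c. \<Sum>i<M. \<pi> i * (\<Sum>y\<in>blocks l. b c i y)) = (\<Sum>i<M. \<pi> i * (\<Sum>y\<in>blocks l. ?mean (\<lambda>c. b c i y)))"
    by (simp add: codebook_mean_sum codebook_mean_cmult)
  also have "\<dots> \<le> (\<Sum>i<M. \<pi> i * ?rhs)"
  proof (intro sum_mono mult_left_mono)
    fix i assume "i \<in> {..<M}"
    then have i: "i < M" by simp
    \<comment> \<open>Once the exponent is factored out, the sum over \<open>y\<close> of the
      empirical likelihoods is the Shtarkov sum, and the average over \<open>x\<close> has total
      weight 1.\<close>
    have "(\<Sum>y\<in>blocks l. ?mean (\<lambda>c. b c i y)) \<le>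
        (\<Sum>y\<in>(blocks l :: (nat \<Rightarrow> 'y) set). (\<Sum>x\<in>?B. \<mu> * (\<Prod>t<l. real (cnt2 l x y (x t) (y t)) / real (cnt l x (x t)))) * exp (- real l * Er R p w))"
      by (intro sum_mono mean_b[OF i])
    also have "\<dots> = (\<Sum>x\<in>?B. \<mu> * (\<Sum>y\<in>(blocks l :: (nat \<Rightarrow> 'y) set). \<Prod>t<l. real (cnt2 l x y (x t) (y t)) / real (cnt l x (x t)))) * exp (- real l * Er R p w)"
      unfolding sum_distrib_right[symmetric] by (subst sum.swap) (simp add: sum_distrib_left)
    also have "\<dots> \<le> (\<Sum>x\<in>?B. \<mu> * (real l + 1) ^ (CARD('u) * CARD('y))) * exp (- real l * Er R p w)"
      using \<mu> by (intro mult_right_mono sum_mono mult_left_mono normalized_likelihood_sum) auto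
    also have "\<dots> = ?rhs" using \<mu>(2) by (simp only: sum_distrib_right[symmetric] mult_1)
    finally show "(\<Sum>y\<in>blocks l. ?mean (\<lambda>c. b c i y)) \<le> ?rhs" .
  qed (use \<pi> in auto)
  also have "\<dots> \<le> 1 * ?rhs"
    unfolding sum_distrib_right[symmetric] using \<pi>(2) by (intro mult_right_mono) auto
  finally have mean: "?mean (\<lambda>c. \<Sum>i<M. \<pi> i * (\<Sum>y\<in>blocks l. b c i y)) \<le> ?rhs" by simp
  obtain c where c: "c \<in> ?A \<rightarrow>\<^sub>E ?B" "(\<Sum>i<M. \<pi> i * (\<Sum>y\<in>blocks l. b c i y)) \<le> ?rhs"
    using exists_le_codebook_mean[of ?A ?B "\<lambda>_ _. \<mu>" "\<lambda>c. \<Sum>i<M. \<pi> i * (\<Sum>y\<in>blocks l. b c i y)"] finB \<mu> mean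
    by (force intro: order_trans)
  define dec where "dec y = (SOME i. i < M \<and> (\<forall>j<M. emp_mi l (c j) y \<le> emp_mi l (c i) y))" for y :: "nat \<Rightarrow> 'y"
  \<comment> \<open>A wrongly decoded message has a score at least that of the true one, so the
    ratio is at least 1 in case of an error.\<close>
  have wrong: "of_bool (dec y \<noteq> i) \<le> (\<Sum>j\<in>?A - {i}. emp_mi l (c j) y) / emp_mi l (c i) y" if i: "i < M" for i y
  proof (cases "dec y = i")
    case True
    then show ?thesis using emp_mi_pos[of l _ y, THEN less_imp_le]
      by (auto intro!: divide_nonneg_nonneg sum_nonneg)
  next
    case False
    have "\<exists>i. i < M \<and> (\<forall>j<M. emp_mi l (c j) y \<le> emp_mi l (c i) y)"
    proof -
      have "Max ((\<lambda>j. emp_mi l (c j) y) ` ?A) \<in> (\<lambda>j. emp_mi l (c j) y) ` ?A"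
        using i by (intro Max_in) auto
      then obtain k where "k < M" "Max ((\<lambda>j. emp_mi l (c j) y) ` ?A) = emp_mi l (c k) y" by auto
      then show ?thesis by (metis Max_ge finite_imageI finite_lessThan imageI lessThan_iff)
    qed
    from someI_ex[OF this] have d: "dec y < M" "emp_mi l (c i) y \<le> emp_mi l (c (dec y)) y"
      using i unfolding dec_def by auto
    have "emp_mi l (c (dec y)) y \<le> (\<Sum>j\<in>?A - {i}. emp_mi l (c j) y)"
      using d False emp_mi_pos[of l _ y] by (intro member_le_sum[where f = "\<lambda>j. emp_mi l (c j) y"]) (auto intro: less_imp_le)
    then show ?thesis using d False emp_mi_pos[of l "c i" y] by (simp add: le_divide_eq)
  qed
  have "(\<Sum>i<M. \<pi> i * (\<Sum>y\<in>blocks l. (\<Prod>t<l. w (c i t) (y t)) * of_bool (dec y \<noteq> i)))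
    \<le> (\<Sum>i<M. \<pi> i * (\<Sum>y\<in>blocks l. b c i y))"
  proof (intro sum_mono mult_left_mono)
    fix i and y :: "nat \<Rightarrow> 'y" assume "i \<in> ?A"
    then have i: "i < M" by simp
    have "of_bool (dec y \<noteq> i) \<le> of_bool (\<not> good (c i) y) + of_bool (good (c i) y) / emp_mi l (c i) y * (\<Sum>j\<in>?A - {i}. emp_mi l (c j) y)"
      using wrong[OF i, of y] by (cases "good (c i) y") auto
    from mult_left_mono[OF this Wl0[of "c i" y]]
    show "(\<Prod>t<l. w (c i t) (y t)) * of_bool (dec y \<noteq> i) \<le> b c i y"
      unfolding b_def bad1_def t_def Wl_def by (simp add: algebra_simps)
  qed (use \<pi> in auto)
  then show ?thesis using c by (intro exI[of _ c] exI[of _ dec]) (auto simp: PiE_iff)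
qed

section \<open>The constant composition layer\<close>

lemma sum_cnt_gt_le:
  fixes p :: "'k::finite \<Rightarrow> real"
  assumes p: "is_pmf p" and \<delta>: "0 < \<delta>"
  shows "(\<Sum>k\<in>blocks l. (\<Prod>t<l. p (k t)) * of_bool (real l * (1 + \<delta>) * p b < real (cnt l k b)))
    \<le> exp (- 2 * \<delta>\<^sup>2 * (p b)\<^sup>2 * real l)"
proof -
  \<comment> \<open>Hoeffding's lemma gives the exponent s^2/8 - s * \<delta> * p b per letter; this
    \<open>s\<close> minimises it, with value -2 * \<delta>^2 * (p b)^2.\<close>
  define s where "s = 4 * \<delta> * p b"
  define c where "c = exp (- s * (real l * (1 + \<delta>) * p b))"
  have p0: "0 \<le> p k" for k using p by (simp add: is_pmf_def)
  have s0: "0 \<le> s" using \<delta> p0 by (simp add: s_def)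
  have "(\<Sum>k\<in>blocks l. (\<Prod>t<l. p (k t)) * of_bool (real l * (1 + \<delta>) * p b < real (cnt l k b)))
     \<le> (\<Sum>k\<in>blocks l. (\<Prod>t<l. p (k t)) * (c * (\<Prod>t<l. exp (s * of_bool (k t = b)))))"
  proof (intro sum_mono mult_left_mono prod_nonneg)
    fix k :: "nat \<Rightarrow> 'k"
    have "(\<Sum>t<l. of_bool (k t = b)) = real (cnt l k b)"
      using sum_cnt[of "\<lambda>x. of_bool (x = b)" k l]
      by (simp add: of_bool_def if_distrib[where f = "(*) _"] cong: if_cong)
    then have "(\<Prod>t<l. exp (s * of_bool (k t = b))) = exp (s * real (cnt l k b))"
      by (simp only: exp_sum[OF finite_lessThan, symmetric] sum_distrib_left[symmetric])
    then have "c * (\<Prod>t<l. exp (s * of_bool (k t = b))) = exp (s * (real (cnt l k b) - real l * (1 + \<delta>) * p b))"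
      by (simp add: c_def exp_add[symmetric] algebra_simps)
    then show "of_bool (real l * (1 + \<delta>) * p b < real (cnt l k b)) \<le> c * (\<Prod>t<l. exp (s * of_bool (k t = b)))"
      using s0 by (auto simp: of_bool_def)
  qed (use p0 in auto)
  also have "\<dots> = c * (\<Sum>k\<in>blocks l. \<Prod>t<l. p (k t) * exp (s * of_bool (k t = b)))"
    by (simp add: sum_distrib_left prod.distrib mult_ac)
  also have "\<dots> = c * (\<Sum>x\<in>UNIV. p x * exp (s * of_bool (x = b))) ^ l"
    by (subst sum_blocks_prod) simp
  also have "(\<Sum>x\<in>UNIV. p x * exp (s * of_bool (x = b))) = 1 + p b * (exp s - 1)"
  proof -
    have "(\<Sum>x\<in>UNIV. p x * exp (s * of_bool (x = b))) = (\<Sum>x\<in>UNIV. p x + (if x = b then p b * (exp s - 1) else 0))"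
      by (intro sum.cong) (auto simp: algebra_simps)
    then show ?thesis using p by (simp add: sum.distrib is_pmf_def)
  qed
  also have "c * (1 + p b * (exp s - 1)) ^ l \<le> c * exp (s * p b + s\<^sup>2 / 8) ^ l"
  proof (intro mult_left_mono power_mono)
    have pos: "0 < 1 + p b * (exp s - 1)" using p0 s0 by (intro add_pos_nonneg mult_nonneg_nonneg) auto
    have "ln (1 + p b * (exp s - 1)) \<le> s * p b + s\<^sup>2 / 8"
      using Hoeffdings_lemma_aux[OF s0 p0[of b]] by (simp add: algebra_simps)
    then show "1 + p b * (exp s - 1) \<le> exp (s * p b + s\<^sup>2 / 8)"
      using pos by (metis exp_le_cancel_iff exp_ln)
    show "0 \<le> 1 + p b * (exp s - 1)" using pos by simp
  qed (simp add: c_def)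
  also have "\<dots> = exp (- 2 * \<delta>\<^sup>2 * (p b)\<^sup>2 * real l)"
    by (simp add: c_def s_def exp_of_nat_mult[symmetric] exp_add[symmetric] power2_eq_square algebra_simps)
  finally show ?thesis .
qed

text \<open>Defined through probabilities rather than letter frequencies, so that the bound on the
  cardinality is immediate; the sum of \<open>p ln p\<close> is the negative entropy.\<close>
definition typical :: "nat \<Rightarrow> real \<Rightarrow> ('k::finite \<Rightarrow> real) \<Rightarrow> (nat \<Rightarrow> 'k) set" where
  "typical l \<delta> p = {k \<in> blocks l. exp (real l * (1 + \<delta>) * (\<Sum>b\<in>UNIV. p b * ln (p b))) \<le> (\<Prod>t<l. p (k t))}"

lemma card_typical:
  fixes p :: "'k::finite \<Rightarrow> real"
  assumes p: "is_pmf p"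
  shows "real (card (typical l \<delta> p)) \<le> exp (- real l * (1 + \<delta>) * (\<Sum>b\<in>UNIV. p b * ln (p b)))"
proof -
  let ?e = "exp (real l * (1 + \<delta>) * (\<Sum>b\<in>UNIV. p b * ln (p b)))"
  have "real (card (typical l \<delta> p)) * ?e \<le> (\<Sum>k\<in>typical l \<delta> p. \<Prod>t<l. p (k t))"
    using sum_bounded_below[of "typical l \<delta> p" ?e "\<lambda>k. \<Prod>t<l. p (k t)"] by (simp add: typical_def)
  also have "\<dots> \<le> (\<Sum>k\<in>blocks l. \<Prod>t<l. p (k t))"
    using p by (intro sum_mono2 prod_nonneg) (auto simp: typical_def is_pmf_def)
  also have "\<dots> = 1" using p by (subst sum_blocks_prod) (simp add: is_pmf_def)
  finally have "real (card (typical l \<delta> p)) \<le> inverse ?e"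
    by (simp only: inverse_eq_divide pos_le_divide_eq[OF exp_gt_zero])
  then show ?thesis by (simp only: exp_minus[symmetric] mult_minus_left)
qed

text \<open>Since \<open>ln (p b) \<le> 0\<close>, a block whose counts are all at most
  \<open>l * (1 + \<delta>) * p b\<close> is likely enough to be typical. An atypical block of
  positive probability thus has some letter in excess, and a union bound over the letters applies;
  the least positive probability gives the largest of the bounds.\<close>

lemma sum_not_typical_le:
  fixes p :: "'k::finite \<Rightarrow> real"
  assumes p: "is_pmf p" and \<delta>: "0 < \<delta>"
  shows "(\<Sum>k\<in>blocks l - typical l \<delta> p. \<Prod>t<l. p (k t))
    \<le> real CARD('k) * exp (- 2 * \<delta>\<^sup>2 * (Min {q. 0 < q \<and> (\<exists>k. q = p k)})\<^sup>2 * real l)"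
proof -
  let ?m = "Min {q. 0 < q \<and> (\<exists>k. q = p k)}"
  let ?S = "{b. 0 < p b}"
  have p0: "0 \<le> p k" for k using p by (simp add: is_pmf_def)
  have p1: "p k \<le> 1" for k
    using p member_le_sum[of k UNIV p] by (simp add: is_pmf_def)
  have finm: "finite {q. 0 < q \<and> (\<exists>k. q = p k)}"
    by (rule finite_subset[of _ "range p"]) auto
  have m: "0 < ?m" "?m \<le> p b" if b: "0 < p b" for b
  proof -
    have "?m \<in> {q. 0 < q \<and> (\<exists>k. q = p k)}" using finm b by (intro Min_in) auto
    then show "0 < ?m" by simp
    show "?m \<le> p b" using finm b by (intro Min_le) auto
  qed
  have "(\<Sum>k\<in>blocks l - typical l \<delta> p. \<Prod>t<l. p (k t))
     \<le> (\<Sum>k\<in>blocks l - typical l \<delta> p. \<Sum>b\<in>?S. (\<Prod>t<l. p (k t)) * of_bool (real l * (1 + \<delta>) * p b < real (cnt l k b)))"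
  proof (intro sum_mono)
    fix k assume "k \<in> blocks l - typical l \<delta> p"
    then have k: "(\<Prod>t<l. p (k t)) < exp (real l * (1 + \<delta>) * (\<Sum>b\<in>UNIV. p b * ln (p b)))"
      by (auto simp: typical_def)
    have P0: "0 \<le> (\<Prod>t<l. p (k t))" using p0 by (intro prod_nonneg) auto
    show "(\<Prod>t<l. p (k t)) \<le> (\<Sum>b\<in>?S. (\<Prod>t<l. p (k t)) * of_bool (real l * (1 + \<delta>) * p b < real (cnt l k b)))"
    proof (cases "(\<Prod>t<l. p (k t)) = 0")
      case False
      then have pos: "0 < p (k t)" if "t < l" for t using that p0 by (auto simp: order_less_le)
      have "\<exists>b\<in>?S. real l * (1 + \<delta>) * p b < real (cnt l k b)"
      proof (rule ccontr)
        assume "\<not> ?thesis"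
        then have le: "real (cnt l k b) \<le> real l * (1 + \<delta>) * p b" if "0 < p b" for b
          using that by force
        have zero: "cnt l k b = 0" if "p b = 0" for b
          using pos that by (force simp: cnt_def)
        have "real l * (1 + \<delta>) * (\<Sum>b\<in>UNIV. p b * ln (p b)) = (\<Sum>b\<in>UNIV. real l * (1 + \<delta>) * p b * ln (p b))"
          by (simp add: sum_distrib_left mult_ac)
        also have "\<dots> \<le> (\<Sum>b\<in>UNIV. real (cnt l k b) * ln (p b))"
        proof (intro sum_mono)
          fix b
          show "real l * (1 + \<delta>) * p b * ln (p b) \<le> real (cnt l k b) * ln (p b)"
          proof (cases "p b = 0")
            case False
            then have "0 < p b" using p0[of b] by simp
            then show ?thesis using le p1[of b] by (intro mult_right_mono_neg) auto
          qed (simp add: zero)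
        qed
        also have "\<dots> = (\<Sum>t<l. ln (p (k t)))" by (rule sum_cnt[symmetric])
        also have "\<dots> = ln (\<Prod>t<l. p (k t))" using pos by (subst ln_prod) fastforce+
        finally have "exp (real l * (1 + \<delta>) * (\<Sum>b\<in>UNIV. p b * ln (p b))) \<le> (\<Prod>t<l. p (k t))"
          using False P0 by (metis exp_le_cancel_iff exp_ln order_less_le)
        then show False using k by simp
      qed
      then obtain b where b: "b \<in> ?S" "real l * (1 + \<delta>) * p b < real (cnt l k b)" by blast
      have "(\<Prod>t<l. p (k t)) * of_bool (real l * (1 + \<delta>) * p b < real (cnt l k b))
          \<le> (\<Sum>b\<in>?S. (\<Prod>t<l. p (k t)) * of_bool (real l * (1 + \<delta>) * p b < real (cnt l k b)))"
        using b P0 by (intro member_le_sum[where f = "\<lambda>b. (\<Prod>t<l. p (k t)) * of_bool (real l * (1 + \<delta>) * p b < real (cnt l k b))"]) auto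
      then show ?thesis using b by simp
    qed (simp only: mult_zero_left sum.neutral_const order.refl)
  qed
  also have "\<dots> = (\<Sum>b\<in>?S. \<Sum>k\<in>blocks l - typical l \<delta> p. (\<Prod>t<l. p (k t)) * of_bool (real l * (1 + \<delta>) * p b < real (cnt l k b)))"
    by (rule sum.swap)
  also have "\<dots> \<le> (\<Sum>b\<in>?S. exp (- 2 * \<delta>\<^sup>2 * ?m\<^sup>2 * real l))"
  proof (intro sum_mono)
    fix b assume b: "b \<in> ?S"
    have "(\<Sum>k\<in>blocks l - typical l \<delta> p. (\<Prod>t<l. p (k t)) * of_bool (real l * (1 + \<delta>) * p b < real (cnt l k b)))
      \<le> (\<Sum>k\<in>blocks l. (\<Prod>t<l. p (k t)) * of_bool (real l * (1 + \<delta>) * p b < real (cnt l k b)))"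
      using p0 by (intro sum_mono2 mult_nonneg_nonneg prod_nonneg) auto
    also have "\<dots> \<le> exp (- 2 * \<delta>\<^sup>2 * (p b)\<^sup>2 * real l)" by (rule sum_cnt_gt_le[OF p \<delta>])
    also have "\<dots> \<le> exp (- 2 * \<delta>\<^sup>2 * ?m\<^sup>2 * real l)"
    proof -
      have "?m\<^sup>2 \<le> (p b)\<^sup>2" using m[of b] b by (intro power_mono) auto
      then have "\<delta>\<^sup>2 * ?m\<^sup>2 * real l \<le> \<delta>\<^sup>2 * (p b)\<^sup>2 * real l" by (intro mult_right_mono mult_left_mono) auto
      then show ?thesis by simp
    qed
    finally show "(\<Sum>k\<in>blocks l - typical l \<delta> p. (\<Prod>t<l. p (k t)) * of_bool (real l * (1 + \<delta>) * p b < real (cnt l k b)))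
      \<le> exp (- 2 * \<delta>\<^sup>2 * ?m\<^sup>2 * real l)" .
  qed
  also have "\<dots> = real (card ?S) * exp (- 2 * \<delta>\<^sup>2 * ?m\<^sup>2 * real l)" by simp
  also have "\<dots> \<le> real CARD('k) * exp (- 2 * \<delta>\<^sup>2 * ?m\<^sup>2 * real l)"
    by (intro mult_right_mono of_nat_mono card_mono) auto
  finally show ?thesis .
qed

text \<open>Two things need proof: the set under \<open>LEAST\<close> is nonempty, because the
  exponential outgrows the polynomial, and the inequality at the least element carries over to every
  larger \<open>l\<close>.\<close>

lemma lstar_properties:
  assumes A: "0 < A" and \<rho>: "0 < \<rho>" and l: "lstar A B \<rho> \<le> l"
  shows "0 < l" "2 * (real l + 1) ^ (2 * A + 2 * A * B) \<le> exp (real l * \<rho> / 2)"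
proof -
  let ?N = "2 * A + 2 * A * B"
  let ?ok = "\<lambda>l::nat. 2 * (real l + 1) ^ ?N \<le> exp (real l * \<rho> / 2)"
  \<comment> \<open>Chosen so that \<open>x ^ ?N / exp x < c\<close> at x = (l + 1) * \<rho> / 2
    becomes the wanted inequality at \<open>l\<close>; the factor \<open>exp (- \<rho> / 2)\<close>
    compensates the shift from \<open>l\<close> to l + 1.\<close>
  define c where "c = exp (- \<rho> / 2) / (2 * (2 / \<rho>) ^ ?N)"
  have c: "0 < c" unfolding c_def using \<rho> by simp
  have "\<forall>\<^sub>F x :: real in at_top. x ^ ?N / exp x < c"
    using c by (intro order_tendstoD(2)[OF tendsto_power_div_exp_0]) auto
  then obtain X where X: "\<And>x. X \<le> x \<Longrightarrow> x ^ ?N / exp x < c" by (auto simp: eventually_at_top_linorder)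
  obtain l1 :: nat where "2 * X / \<rho> \<le> real l1" using real_arch_simple by blast
  then have "X \<le> (real l1 + 1) * (\<rho> / 2)" using \<rho> by (simp add: field_simps)
  then have l1: "((real l1 + 1) * (\<rho> / 2)) ^ ?N / exp ((real l1 + 1) * (\<rho> / 2)) < c" by (rule X)
  have "?ok l1"
  proof -
    have "((real l1 + 1) * (\<rho> / 2)) ^ ?N < c * exp ((real l1 + 1) * (\<rho> / 2))"
      using l1 by (simp add: divide_less_eq)
    also have "c * exp ((real l1 + 1) * (\<rho> / 2)) = exp (real l1 * \<rho> / 2) / (2 * (2 / \<rho>) ^ ?N)"
      by (simp add: c_def exp_add[symmetric] add_divide_distrib[symmetric] algebra_simps)
    finally have "((real l1 + 1) * (\<rho> / 2)) ^ ?N * (2 * (2 / \<rho>) ^ ?N) < exp (real l1 * \<rho> / 2)"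
      using \<rho> by (simp add: less_divide_eq)
    moreover have "((real l1 + 1) * (\<rho> / 2)) ^ ?N * (2 * (2 / \<rho>) ^ ?N) = 2 * (real l1 + 1) ^ ?N"
    proof -
      have "((real l1 + 1) * (\<rho> / 2)) ^ ?N * (2 / \<rho>) ^ ?N = (real l1 + 1) ^ ?N"
        unfolding power_mult_distrib[symmetric] using \<rho> by simp
      then show ?thesis by simp
    qed
    ultimately show ?thesis by simp
  qed
  then have ok: "?ok (lstar A B \<rho>)"
    unfolding lstar_def by (rule LeastI[where P = ?ok])
  \<comment> \<open>\<open>x \<rho> / 2 - N ln (x + 1)\<close> is convex and vanishes at 0, so the inequality persists from \<open>lstar\<close> on.\<close>
  define l0 where "l0 = lstar A B \<rho>"
  have l0: "0 < l0"
    using ok unfolding l0_def by (cases "lstar A B \<rho> = 0") auto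
  show "0 < l" using l l0 by (simp add: l0_def)
  have ln0: "real ?N * ln (real l0 + 1) + ln 2 \<le> real l0 * \<rho> / 2"
  proof -
    have "ln (2 * (real l0 + 1) ^ ?N) \<le> real l0 * \<rho> / 2"
      using ok unfolding l0_def[symmetric] by (metis ln_exp ln_mono exp_gt_zero mult_pos_pos zero_less_power zero_less_numeral of_nat_0_le_iff add_nonneg_pos zero_less_one)
    then show ?thesis by (simp add: ln_mult ln_realpow)
  qed
  \<comment> \<open>With this weight, l0 + 1 is the convex combination of 1 and l + 1, at which
    concavity of the logarithm is applied.\<close>
  define \<theta> where "\<theta> = real l0 / real l"
  have \<theta>: "0 < \<theta>" "\<theta> \<le> 1" "\<theta> * real l = real l0"
    using l l0 unfolding \<theta>_def l0_def by auto
  have concave: "\<theta> * ln (real l + 1) \<le> ln (real l0 + 1)"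
  proof -
    let ?m = "real l0 + 1"
    have "ln (1 / ?m) \<le> 1 / ?m - 1" "ln ((real l + 1) / ?m) \<le> (real l + 1) / ?m - 1"
      by (intro ln_le_minus_one; simp)+
    then have "(1 - \<theta>) * ln (1 / ?m) + \<theta> * ln ((real l + 1) / ?m)
       \<le> (1 - \<theta>) * (1 / ?m - 1) + \<theta> * ((real l + 1) / ?m - 1)"
      using \<theta> by (intro add_mono mult_left_mono) auto
    also have "\<dots> = ((1 - \<theta>) + \<theta> * (real l + 1)) / ?m - 1"
      by (simp add: add_divide_distrib diff_divide_distrib algebra_simps)
    also have "\<dots> = 0" using \<theta>(3) by (simp add: algebra_simps)
    finally show ?thesis by (simp add: ln_div algebra_simps)
  qed
  have "\<theta> * (real ?N * ln (real l + 1) + ln 2) \<le> \<theta> * (real l * \<rho> / 2)"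
  proof -
    have "\<theta> * (real ?N * ln (real l + 1)) \<le> real ?N * ln (real l0 + 1)"
      using mult_left_mono[OF concave, of "real ?N"] by (simp add: algebra_simps)
    moreover have "\<theta> * ln 2 \<le> ln 2" using \<theta> by (simp add: mult_le_cancel_right1)
    moreover have "\<theta> * (real l * \<rho> / 2) = real l0 * \<rho> / 2" unfolding \<theta>(3)[symmetric] by simp
    ultimately show ?thesis using ln0 unfolding distrib_left by linarith
  qed
  then have "real ?N * ln (real l + 1) + ln 2 \<le> real l * \<rho> / 2" using \<theta>(1) by simp
  then have "exp (real ?N * ln (real l + 1) + ln 2) \<le> exp (real l * \<rho> / 2)" by simp
  moreover have "exp (real ?N * ln (real l + 1) + ln 2) = 2 * (real l + 1) ^ ?N"
    by (simp only: exp_add exp_of_nat_mult) simp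
  ultimately show "2 * (real l + 1) ^ ?N \<le> exp (real l * \<rho> / 2)" by linarith
qed


lemma sum_blocks_pmf:
  fixes p :: "nat \<Rightarrow> 'a::finite \<Rightarrow> real"
  assumes "\<And>t. t < l \<Longrightarrow> is_pmf (p t)"
  shows "(\<Sum>z\<in>blocks l. \<Prod>t<l. p t (z t)) = 1"
  using assms by (subst sum_blocks_prod) (simp add: is_pmf_def)

text \<open>Codewords only use letters \<open>u\<close> of positive probability, and only there is
  \<open>pYgU\<close> a stochastic row.\<close>

lemma type_seqs_pos:
  assumes "x \<in> type_seqs l p" "t < l"
  shows "0 < p (x t)"
proof -
  have "0 < real l * p (x t)"
    using assms(1) cnt_pos[OF assms(2), of x] by (simp add: type_seqs_def) (metis of_nat_0_less_iff)
  then show ?thesis by (simp add: zero_less_mult_iff)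
qed

text \<open>There are about exp(l(\<alpha>+\<beta>)) typical K-blocks. The code resolves them up to
  groups of size exp(l \<beta>), which needs only the rate \<alpha>, and a whole group is returned
  as the list. The surplus \<rho> pays for rounding and for polynomial factors.\<close>

theorem inner_layer:
  fixes pK :: "'k::finite \<Rightarrow> real" and p :: "'u::finite \<Rightarrow> real" and w :: "'u \<Rightarrow> 'y::finite \<Rightarrow> real"
  assumes pK: "is_pmf pK" and p: "is_pmf p" "is_type l p"
    and w0: "\<And>u y. 0 \<le> w u y" and w: "\<And>u. 0 < p u \<Longrightarrow> is_pmf (w u)"
    and par: "0 \<le> \<alpha>" "0 \<le> \<beta>" "0 < \<rho>" "0 < \<delta>"
    and l: "lstar CARD('u) CARD('y) \<rho> \<le> l"
    and H: "(1 + \<delta>) * (- (\<Sum>k\<in>UNIV. pK k * ln (pK k))) \<le> \<alpha> + \<beta>"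
  shows "\<exists>enc L. (\<forall>k. enc k \<in> type_seqs l p) \<and> (\<forall>z. L z \<subseteq> blocks l \<and> real (card (L z)) \<le> exp (real l * \<beta>)) \<and>
    (\<Sum>k\<in>blocks l. (\<Prod>t<l. pK (k t)) * (\<Sum>z\<in>blocks l. (\<Prod>t<l. w (enc k t) (z t)) * of_bool (k \<notin> L z)))
    \<le> (real l + 1) ^ (2 * CARD('u) * CARD('y)) * exp (- real l * Er (\<alpha> + \<rho>) p w)
      + real CARD('k) * exp (- 2 * \<delta>\<^sup>2 * (Min {q. 0 < q \<and> (\<exists>k. q = pK k)})\<^sup>2 * real l)"
proof -
  have l0: "0 < l" and lexp: "2 * (real l + 1) ^ (2 * CARD('u) + 2 * CARD('u) * CARD('y)) \<le> exp (real l * \<rho> / 2)"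
    using lstar_properties[OF _ par(3) l] by auto
  let ?T = "typical l \<delta> pK" and ?PK = "\<lambda>k. \<Prod>t<l. pK (k t)"
  have finT: "finite ?T" by (simp add: typical_def)
  have PK0: "0 \<le> ?PK k" for k using pK by (intro prod_nonneg) (simp add: is_pmf_def)
  \<comment> \<open>The group size must be an integer not above the allowed list size. As
    \<open>exp (real l * \<beta>) \<ge> 1\<close>, rounding down loses at most a factor 2.\<close>
  define J where "J = nat \<lfloor>exp (real l * \<beta>)\<rfloor>"
  have one_le: "1 \<le> exp (real l * \<beta>)" using par by simp
  have J: "1 \<le> J" "real J \<le> exp (real l * \<beta>)" "exp (real l * \<beta>) \<le> 2 * real J"
  proof -
    have f: "1 \<le> \<lfloor>exp (real l * \<beta>)\<rfloor>" using one_le by simp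
    then have r: "real J = of_int \<lfloor>exp (real l * \<beta>)\<rfloor>" by (simp add: J_def)
    show "1 \<le> J" using f r by linarith
    show "real J \<le> exp (real l * \<beta>)" unfolding r by simp
    have "exp (real l * \<beta>) \<le> real J + 1" unfolding r by linarith
    then show "exp (real l * \<beta>) \<le> 2 * real J" using \<open>1 \<le> J\<close> by simp
  qed
  define M where "M = card ?T div J + 1"
  obtain e where e: "bij_betw e ?T {0..<card ?T}" using ex_bij_betw_finite_nat[OF finT] by blast
  \<comment> \<open>Typical blocks are numbered by \<open>e\<close>; the quotient by \<open>J\<close> selects the codeword, and the
    remainder is left unresolved by the list \<open>L\<close>.\<close>
  define idx where "idx k = (if k \<in> ?T then e k div J else 0)" for k
  have idx_less: "idx k < M" for k
  proof (cases "k \<in> ?T")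
    case True
    then have "e k < card ?T" using e by (auto simp: bij_betw_def)
    then have "e k div J \<le> card ?T div J" by (intro div_le_mono) simp
    then show ?thesis by (simp add: idx_def M_def)
  qed (simp add: idx_def M_def)
  define \<pi> where "\<pi> i = (\<Sum>k\<in>{k \<in> ?T. idx k = i}. ?PK k)" for i
  have \<pi>0: "0 \<le> \<pi> i" for i unfolding \<pi>_def using PK0 by (rule sum_nonneg)
  have group: "(\<Sum>i<M. \<pi> i * G i) = (\<Sum>k\<in>?T. ?PK k * G (idx k))" for G :: "nat \<Rightarrow> real"
  proof -
    have "(\<Sum>i<M. \<pi> i * G i) = (\<Sum>i<M. \<Sum>k\<in>{k \<in> ?T. idx k = i}. ?PK k * G (idx k))"
      unfolding \<pi>_def sum_distrib_right by (intro sum.cong) auto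
    also have "\<dots> = (\<Sum>k\<in>?T. ?PK k * G (idx k))"
      using finT idx_less by (intro sum.group) auto
    finally show ?thesis .
  qed
  have \<pi>1: "(\<Sum>i<M. \<pi> i) \<le> 1"
  proof -
    have "(\<Sum>i<M. \<pi> i) = (\<Sum>k\<in>?T. ?PK k)" using group[of "\<lambda>_. 1"] by simp
    also have "\<dots> \<le> (\<Sum>k\<in>blocks l. ?PK k)"
      using PK0 by (intro sum_mono2) (auto simp: typical_def)
    also have "\<dots> = 1" using pK by (rule sum_blocks_pmf)
    finally show ?thesis .
  qed
  \<comment> \<open>The quotient of \<open>card ?T\<close> by \<open>J\<close> is at most 2 exp(l
    \<alpha>), and the additional index turns 2 into 3. The two bounds 2 * poly <= exp(l \<rho>/2)
    and 2 <= exp(l \<rho>/2) multiply to 4 * poly <= exp(l \<rho>), which absorbs the 3.\<close>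
  have M_le: "real M * (real l + 1) ^ (2 * CARD('u) + CARD('u) * CARD('y)) \<le> exp (real l * (\<alpha> + \<rho>))"
  proof -
    have "real l * ((1 + \<delta>) * (- (\<Sum>b\<in>UNIV. pK b * ln (pK b)))) \<le> real l * (\<alpha> + \<beta>)"
      using H by (intro mult_left_mono) auto
    then have "real (card ?T) \<le> exp (real l * (\<alpha> + \<beta>))"
      using card_typical[OF pK, of l \<delta>] by (intro order_trans[OF card_typical[OF pK]]) (simp add: mult.assoc)
    also have "\<dots> \<le> exp (real l * \<alpha>) * (2 * real J)"
      using J by (simp add: distrib_left exp_add)
    finally have "real (card ?T) / real J \<le> 2 * exp (real l * \<alpha>)"
      using J by (simp add: divide_le_eq mult_ac)
    moreover have "real (card ?T div J) \<le> real (card ?T) / real J" by (rule of_nat_div_le_of_nat)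
    moreover have "1 \<le> exp (real l * \<alpha>)" using par by simp
    ultimately have M3: "real M \<le> 3 * exp (real l * \<alpha>)"
      unfolding M_def of_nat_add of_nat_1 by linarith
    have "1 \<le> (real l + 1) ^ (2 * CARD('u) + 2 * CARD('u) * CARD('y))"
      by (rule one_le_power) simp
    then have two: "2 \<le> exp (real l * \<rho> / 2)" using lexp by linarith
    have "(real l + 1) ^ (2 * CARD('u) + CARD('u) * CARD('y)) \<le> (real l + 1) ^ (2 * CARD('u) + 2 * CARD('u) * CARD('y))"
      by (intro power_increasing) auto
    then have "2 * (real l + 1) ^ (2 * CARD('u) + CARD('u) * CARD('y)) \<le> exp (real l * \<rho> / 2)"
      using lexp by linarith
    then have "2 * (2 * (real l + 1) ^ (2 * CARD('u) + CARD('u) * CARD('y))) \<le> exp (real l * \<rho> / 2) * exp (real l * \<rho> / 2)"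
      using two by (intro mult_mono) auto
    also have "\<dots> = exp (real l * \<rho>)" by (simp add: exp_add[symmetric])
    finally have "3 * (real l + 1) ^ (2 * CARD('u) + CARD('u) * CARD('y)) \<le> exp (real l * \<rho>)"
      by (smt (verit) of_nat_0_le_iff zero_le_power)
    then have "exp (real l * \<alpha>) * (3 * (real l + 1) ^ (2 * CARD('u) + CARD('u) * CARD('y))) \<le> exp (real l * \<alpha>) * exp (real l * \<rho>)"
      by (intro mult_left_mono) auto
    moreover have "real M * (real l + 1) ^ (2 * CARD('u) + CARD('u) * CARD('y))
        \<le> 3 * exp (real l * \<alpha>) * (real l + 1) ^ (2 * CARD('u) + CARD('u) * CARD('y))"
      using M3 by (intro mult_right_mono) auto
    moreover have "exp (real l * (\<alpha> + \<rho>)) = exp (real l * \<alpha>) * exp (real l * \<rho>)"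
      by (simp add: distrib_left exp_add)
    ultimately show ?thesis by (simp only: mult.assoc mult.left_commute)
  qed
  obtain cw dec where cw: "\<forall>i<M. cw i \<in> type_seqs l p"
    and err: "(\<Sum>i<M. \<pi> i * (\<Sum>y\<in>blocks l. (\<Prod>t<l. w (cw i t) (y t)) * of_bool (dec y \<noteq> i)))
      \<le> (real l + 1) ^ (CARD('u) * CARD('y)) * exp (- real l * Er (\<alpha> + \<rho>) p w)"
    using constant_composition_code[where w = w, OF p w0 w l0 \<pi>0 \<pi>1 M_le] by blast
  \<comment> \<open>Atypical blocks share codeword number 0, so that \<open>enc\<close> always
    yields a sequence of type \<open>p\<close>; they belong to no list and count as misses in
    full.\<close>
  define enc where "enc k = cw (idx k)" for k
  define L where "L z = {k \<in> ?T. idx k = dec z}" for z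
  have enc: "enc k \<in> type_seqs l p" for k unfolding enc_def using cw idx_less by blast
  have "real (card (L z)) \<le> exp (real l * \<beta>)" for z
  proof -
    have "card (L z) \<le> card {dec z * J..<dec z * J + J}"
    proof (rule card_inj_on_le)
      show "inj_on e (L z)" using e unfolding L_def bij_betw_def by (auto intro: inj_on_subset)
      show "e ` L z \<subseteq> {dec z * J..<dec z * J + J}"
      proof (intro image_subsetI)
        fix k assume "k \<in> L z"
        then have "e k div J = dec z" by (auto simp: L_def idx_def)
        moreover have "e k mod J < J" using J(1) by simp
        ultimately show "e k \<in> {dec z * J..<dec z * J + J}"
          using div_mult_mod_eq[of "e k" J] by (metis add_less_cancel_left atLeastLessThan_iff le_add1)
      qed
    qed simp
    then show ?thesis using J(2) by simp
  qed
  moreover have "L z \<subseteq> blocks l" for z by (auto simp: L_def typical_def)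
  moreover have "(\<Sum>k\<in>blocks l. ?PK k * (\<Sum>z\<in>blocks l. (\<Prod>t<l. w (enc k t) (z t)) * of_bool (k \<notin> L z)))
    \<le> (real l + 1) ^ (2 * CARD('u) * CARD('y)) * exp (- real l * Er (\<alpha> + \<rho>) p w)
      + real CARD('k) * exp (- 2 * \<delta>\<^sup>2 * (Min {q. 0 < q \<and> (\<exists>k. q = pK k)})\<^sup>2 * real l)"
  proof -
    let ?S = "\<lambda>k. \<Sum>z\<in>blocks l. (\<Prod>t<l. w (enc k t) (z t)) * of_bool (k \<notin> L z)"
    have "(\<Sum>k\<in>blocks l. ?PK k * ?S k) = (\<Sum>k\<in>?T. ?PK k * ?S k) + (\<Sum>k\<in>blocks l - ?T. ?PK k * ?S k)"
      by (rule sum.subset_diff[THEN trans, OF _ _ add.commute]) (auto simp: typical_def)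
    also have "(\<Sum>k\<in>?T. ?PK k * ?S k) = (\<Sum>i<M. \<pi> i * (\<Sum>y\<in>blocks l. (\<Prod>t<l. w (cw i t) (y t)) * of_bool (dec y \<noteq> i)))"
      unfolding group enc_def by (intro sum.cong refl arg_cong2[where f = "(*)"]) (auto simp: L_def)
    also have "\<dots> \<le> (real l + 1) ^ (2 * CARD('u) * CARD('y)) * exp (- real l * Er (\<alpha> + \<rho>) p w)"
    proof -
      have "(real l + 1) ^ (CARD('u) * CARD('y)) \<le> (real l + 1) ^ (2 * CARD('u) * CARD('y))"
        by (intro power_increasing) auto
      then show ?thesis using err by (meson exp_ge_zero mult_right_mono order_trans)
    qed
    also have "(\<Sum>k\<in>blocks l - ?T. ?PK k * ?S k) \<le> (\<Sum>k\<in>blocks l - ?T. ?PK k * 1)"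
    proof (intro sum_mono mult_left_mono PK0)
      fix k
      have "is_pmf (w (enc k t))" if "t < l" for t
        using type_seqs_pos[OF enc that] by (rule w)
      then have "(\<Sum>z\<in>blocks l. \<Prod>t<l. w (enc k t) (z t)) = 1" by (rule sum_blocks_pmf)
      moreover have "?S k \<le> (\<Sum>z\<in>blocks l. \<Prod>t<l. w (enc k t) (z t))"
        using w0 by (intro sum_mono) (auto intro!: prod_nonneg)
      ultimately show "?S k \<le> 1" by simp
    qed
    also have "(\<Sum>k\<in>blocks l - ?T. ?PK k * 1)
      \<le> real CARD('k) * exp (- 2 * \<delta>\<^sup>2 * (Min {q. 0 < q \<and> (\<exists>k. q = pK k)})\<^sup>2 * real l)"
      using sum_not_typical_le[OF pK par(4), of l] by simp
    finally show ?thesis by simp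
  qed
  ultimately show ?thesis using enc by (intro exI[of _ enc] exI[of _ L]) blast
qed

section \<open>Letterwise expectations over a block\<close>

text \<open>Linearity of the mean: in the summand for position \<open>i\<close>, all other positions
  integrate to 1. The laws may vary with the position because the u-letter does.\<close>

lemma sum_blocks3_additive:
  fixes F h :: "nat \<Rightarrow> 'a::finite \<Rightarrow> 'b::finite \<Rightarrow> 'c::finite \<Rightarrow> real"
  assumes "\<And>t. t < l \<Longrightarrow> (\<Sum>x\<in>UNIV. \<Sum>y\<in>UNIV. \<Sum>z\<in>UNIV. F t x y z) = 1"
  shows "(\<Sum>a\<in>blocks l. \<Sum>b\<in>blocks l. \<Sum>c\<in>blocks l.
      (\<Prod>t<l. F t (a t) (b t) (c t)) * (\<Sum>t<l. h t (a t) (b t) (c t)))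
    = (\<Sum>t<l. \<Sum>x\<in>UNIV. \<Sum>y\<in>UNIV. \<Sum>z\<in>UNIV. F t x y z * h t x y z)"
proof -
  let ?G = "\<lambda>i t x y z. F t x y z * (if t = i then h t x y z else 1)"
  have prod3: "(\<Sum>a\<in>blocks l. \<Sum>b\<in>blocks l. \<Sum>c\<in>blocks l. \<Prod>t<l. G t (a t) (b t) (c t))
     = (\<Prod>t<l. \<Sum>x\<in>UNIV. \<Sum>y\<in>UNIV. \<Sum>z\<in>UNIV. G t x y z)"
    for G :: "nat \<Rightarrow> 'a \<Rightarrow> 'b \<Rightarrow> 'c \<Rightarrow> real"
    unfolding blocks_def by (simp add: prod_sum_PiE)
  have "(\<Sum>a\<in>blocks l. \<Sum>b\<in>blocks l. \<Sum>c\<in>blocks l.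
      (\<Prod>t<l. F t (a t) (b t) (c t)) * (\<Sum>t<l. h t (a t) (b t) (c t)))
    = (\<Sum>a\<in>blocks l. \<Sum>b\<in>blocks l. \<Sum>c\<in>blocks l. \<Sum>i<l. \<Prod>t<l. ?G i t (a t) (b t) (c t))"
    unfolding sum_distrib_left prod.distrib by (intro sum.cong refl) simp
  also have "\<dots> = (\<Sum>a\<in>blocks l. \<Sum>b\<in>blocks l. \<Sum>i<l. \<Sum>c\<in>blocks l. \<Prod>t<l. ?G i t (a t) (b t) (c t))"
    by (intro sum.cong refl sum.swap)
  also have "\<dots> = (\<Sum>a\<in>blocks l. \<Sum>i<l. \<Sum>b\<in>blocks l. \<Sum>c\<in>blocks l. \<Prod>t<l. ?G i t (a t) (b t) (c t))"
    by (intro sum.cong refl sum.swap)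
  also have "\<dots> = (\<Sum>i<l. \<Sum>a\<in>blocks l. \<Sum>b\<in>blocks l. \<Sum>c\<in>blocks l. \<Prod>t<l. ?G i t (a t) (b t) (c t))"
    by (rule sum.swap)
  also have "\<dots> = (\<Sum>i<l. \<Prod>t<l. \<Sum>x\<in>UNIV. \<Sum>y\<in>UNIV. \<Sum>z\<in>UNIV. ?G i t x y z)"
    by (intro sum.cong refl) (rule prod3)
  also have "\<dots> = (\<Sum>i<l. \<Prod>t<l. if t = i then (\<Sum>x\<in>UNIV. \<Sum>y\<in>UNIV. \<Sum>z\<in>UNIV. F t x y z * h t x y z) else 1)"
    using assms by (intro sum.cong prod.cong refl) simp
  also have "\<dots> = (\<Sum>t<l. \<Sum>x\<in>UNIV. \<Sum>y\<in>UNIV. \<Sum>z\<in>UNIV. F t x y z * h t x y z)"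
    by (intro sum.cong refl) simp
  finally show ?thesis .
qed

lemma sum_blocks_additive:
  fixes F h :: "'a::finite \<Rightarrow> 'b::finite \<Rightarrow> real"
  assumes "(\<Sum>x\<in>UNIV. \<Sum>y\<in>UNIV. F x y) = 1"
  shows "(\<Sum>a\<in>blocks l. \<Sum>b\<in>blocks l. (\<Prod>t<l. F (a t) (b t)) * (\<Sum>t<l. h (a t) (b t)))
    = real l * (\<Sum>x\<in>UNIV. \<Sum>y\<in>UNIV. F x y * h x y)"
proof -
  show ?thesis
    \<comment> \<open>The third alphabet is collapsed to \<open>unit\<close>, over which there is
      exactly one block.\<close>
    using sum_blocks3_additive[of l "\<lambda>t x y (z::unit). F x y" "\<lambda>t x y z. h x y"] assms
    by (simp add: card_blocks)
qed

lemma entropy_le_ln_card: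
  fixes p :: "'a::finite \<Rightarrow> real"
  assumes "is_pmf p"
  shows "- (\<Sum>x\<in>UNIV. p x * ln (p x)) \<le> ln (real CARD('a))"
proof -
  let ?N = "real CARD('a)"
  have N: "0 < ?N" by simp
  have "(\<Sum>x\<in>UNIV. p x * (- ln (p x) - ln ?N)) \<le> (\<Sum>x\<in>UNIV. 1 / ?N - p x)"
  proof (rule sum_mono)
    fix x
    show "p x * (- ln (p x) - ln ?N) \<le> 1 / ?N - p x"
    proof (cases "p x = 0")
      case False
      then have px: "0 < p x" using assms by (simp add: is_pmf_def order_less_le)
      have "ln (1 / (?N * p x)) \<le> 1 / (?N * p x) - 1" using px N by (intro ln_le_minus_one) simp
      then have "p x * ln (1 / (?N * p x)) \<le> p x * (1 / (?N * p x) - 1)"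
        using px by (intro mult_left_mono) auto
      then show ?thesis using px N by (simp add: ln_div ln_mult algebra_simps)
    qed simp
  qed
  also have "\<dots> = 0" using assms by (simp add: sum_subtractf is_pmf_def)
  finally show ?thesis
    using assms by (simp add: is_pmf_def right_diff_distrib sum_subtractf sum_negf flip: sum_distrib_right)
qed

text \<open>The right-hand side is affine in \<open>q\<close> with slope
  \<open>ln \<phi> - ln (1 - \<phi>)\<close>, negative for \<open>\<phi> < 1/2\<close>, so the worst
  case is \<open>q = \<phi>\<close>. A guess designed for error probability \<open>\<phi>\<close> is
  therefore safe for every smaller one.\<close>

lemma binary_cross_entropy_ge:
  assumes "0 \<le> q" "q \<le> \<phi>" "0 < \<phi>" "\<phi> < 1/2"
  shows "- hb \<phi> \<le> (1 - q) * ln (1 - \<phi>) + q * ln \<phi>"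
proof -
  have "0 \<le> (\<phi> - q) * (ln (1 - \<phi>) - ln \<phi>)"
    using assms by (intro mult_nonneg_nonneg) auto
  then show ?thesis by (simp add: hb_def algebra_simps)
qed

lemma xi_nonneg:
  assumes "is_pmf WS"
  shows "0 \<le> xi l WS f1 f2"
proof -
  have "(\<Sum>s\<in>{s. f1 (fst s) \<noteq> f2 (snd s)}. WS s) \<le> sum WS UNIV"
    using assms by (intro sum_mono2) (auto simp: is_pmf_def)
  moreover have "0 \<le> (\<Sum>s\<in>{s. f1 (fst s) \<noteq> f2 (snd s)}. WS s)"
    using assms by (intro sum_nonneg) (auto simp: is_pmf_def)
  ultimately show ?thesis using assms unfolding xi_def is_pmf_def by (simp add: power_le_one)
qed

section \<open>The test channel and the random code of one block\<close>

locale mac_input =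
  fixes W :: "'x1::finite \<Rightarrow> 'x2::finite \<Rightarrow> 'y::finite \<Rightarrow> real"
    and pU :: "'u::finite \<Rightarrow> real" and pV1 :: "'v1::finite \<Rightarrow> real" and pV2 :: "'v2::finite \<Rightarrow> real"
    and pX1 :: "'u \<Rightarrow> 'v1 \<Rightarrow> 'x1 \<Rightarrow> real" and pX2 :: "'u \<Rightarrow> 'v2 \<Rightarrow> 'x2 \<Rightarrow> real"
  assumes W: "\<And>x1 x2. is_pmf (W x1 x2)"
    and pU: "is_pmf pU" and pV1: "is_pmf pV1" and pV2: "is_pmf pV2"
    and pX1: "\<And>u v. is_pmf (pX1 u v)" and pX2: "\<And>u v. is_pmf (pX2 u v)"
begin

lemma nonneg [simp]: "0 \<le> W x1 x2 y" "0 \<le> pU u" "0 \<le> pV1 v1" "0 \<le> pV2 v2"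
  "0 \<le> pX1 u v1 x1" "0 \<le> pX2 u v2 x2"
  using W pU pV1 pV2 pX1 pX2 unfolding is_pmf_def by blast+

lemma sums [simp]: "sum (W x1 x2) UNIV = 1" "sum pU UNIV = 1" "sum pV1 UNIV = 1"
  "sum pV2 UNIV = 1" "sum (pX1 u v1) UNIV = 1" "sum (pX2 u v2) UNIV = 1"
  using W pU pV1 pV2 pX1 pX2 unfolding is_pmf_def by blast+

lemma sum_VX: "(\<Sum>x\<in>UNIV. pV1 (fst x) * pX1 u (fst x) (snd x)) = 1"
  "(\<Sum>x\<in>UNIV. pV2 (fst x) * pX2 u (fst x) (snd x)) = 1"
  by (simp_all add: sum_UNIV_pair[symmetric, where f = "\<lambda>v x. pV1 v * pX1 u v x"]
      sum_UNIV_pair[symmetric, where f = "\<lambda>v x. pV2 v * pX2 u v x"] flip: sum_distrib_left)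

end

text \<open>\<open>fk\<close> plays the role of \<open>K_a\<close>: the assumption on it covers both values of \<open>a\<close>.\<close>
locale two_user_code = mac_input W pU pV1 pV2 pX1 pX2
  for W :: "'x1::finite \<Rightarrow> 'x2::finite \<Rightarrow> 'y::finite \<Rightarrow> real"
    and pU :: "'u::finite \<Rightarrow> real" and pV1 :: "'v1::finite \<Rightarrow> real" and pV2 :: "'v2::finite \<Rightarrow> real"
    and pX1 :: "'u \<Rightarrow> 'v1 \<Rightarrow> 'x1 \<Rightarrow> real" and pX2 :: "'u \<Rightarrow> 'v2 \<Rightarrow> 'x2 \<Rightarrow> real" +
  fixes WS :: "'s1::finite \<times> 's2::finite \<Rightarrow> real"
    and f1 :: "'s1 \<Rightarrow> 'k::finite" and f2 :: "'s2 \<Rightarrow> 'k" and fk :: "'s1 \<times> 's2 \<Rightarrow> 'k"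
    and enc :: "(nat \<Rightarrow> 'k) \<Rightarrow> nat \<Rightarrow> 'u" and l :: nat and \<phi> :: real
  assumes WS: "is_pmf WS"
    and enc: "\<And>k. enc k \<in> type_seqs l pU" and l: "0 < l" and \<phi>: "0 < \<phi>" "\<phi> < 1/2"
    and fk: "\<And>s1 s2. f1 s1 = f2 s2 \<Longrightarrow> fk (s1, s2) = f1 s1"
    and mismatch: "xi l WS f1 f2 \<le> \<phi>"
begin

lemma WS_nonneg [simp]: "0 \<le> WS s" and WS_sum [simp]: "sum WS UNIV = 1"
  using WS unfolding is_pmf_def by blast+

definition kseq :: "('s \<Rightarrow> 'k) \<Rightarrow> (nat \<Rightarrow> 's) \<Rightarrow> nat \<Rightarrow> 'k" where
  "kseq f a = (\<lambda>t\<in>{..<l}. f (a t))"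

lemma kseq_in [simp]: "kseq f a \<in> blocks l"
  by (simp add: kseq_def blocks_def)

lemma kseq_eq_iff: "kseq f a = kseq g b \<longleftrightarrow> (\<forall>t<l. f (a t) = g (b t))"
  by (auto simp: kseq_def fun_eq_iff restrict_def)

definition ka :: "(nat \<Rightarrow> 's1) \<Rightarrow> (nat \<Rightarrow> 's2) \<Rightarrow> nat \<Rightarrow> 'k" where
  "ka a1 a2 = kseq fk (\<lambda>t. (a1 t, a2 t))"

definition same :: "(nat \<Rightarrow> 's1) \<Rightarrow> (nat \<Rightarrow> 's2) \<Rightarrow> bool" where
  "same a1 a2 \<longleftrightarrow> kseq f1 a1 = kseq f2 a2"

lemma same_ka: "same a1 a2 \<Longrightarrow> ka a1 a2 = kseq f1 a1"
  unfolding same_def ka_def kseq_eq_iff by (simp add: fk)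

definition Q :: "(nat \<Rightarrow> 's1) \<Rightarrow> (nat \<Rightarrow> 's2) \<Rightarrow> real" where
  "Q a1 a2 = (\<Prod>t<l. WS (a1 t, a2 t))"

text \<open>A codeword consists of pairs of a V-letter and an X-letter: the channel reads the second
  component, the weights read the first. The u-block is computed from the user's own
  K-block.\<close>

definition p1 :: "(nat \<Rightarrow> 's1) \<Rightarrow> (nat \<Rightarrow> 'v1 \<times> 'x1) \<Rightarrow> real" where
  "p1 a b = (\<Prod>t<l. pV1 (fst (b t)) * pX1 (enc (kseq f1 a) t) (fst (b t)) (snd (b t)))"

definition p2 :: "(nat \<Rightarrow> 's2) \<Rightarrow> (nat \<Rightarrow> 'v2 \<times> 'x2) \<Rightarrow> real" where
  "p2 a b = (\<Prod>t<l. pV2 (fst (b t)) * pX2 (enc (kseq f2 a) t) (fst (b t)) (snd (b t)))"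

definition T :: "(nat \<Rightarrow> 'v1 \<times> 'x1) \<Rightarrow> (nat \<Rightarrow> 'v2 \<times> 'x2) \<Rightarrow> (nat \<Rightarrow> 'y) \<Rightarrow> real" where
  "T b1 b2 z = (\<Prod>t<l. W (snd (b1 t)) (snd (b2 t)) (z t))"

lemma Q_nonneg [simp]: "0 \<le> Q a1 a2" and p1_nonneg [simp]: "0 \<le> p1 a1 b1"
  and p2_nonneg [simp]: "0 \<le> p2 a2 b2" and T_nonneg [simp]: "0 \<le> T b1 b2 z"
  unfolding Q_def p1_def p2_def T_def by (auto intro!: prod_nonneg)

lemma sum_p1 [simp]: "(\<Sum>b\<in>blocks l. p1 a b) = 1" and sum_p2 [simp]: "(\<Sum>b\<in>blocks l. p2 a' b) = 1"
  and sum_T [simp]: "(\<Sum>z\<in>blocks l. T b1 b2 z) = 1"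
  unfolding p1_def p2_def T_def
    sum_blocks_prod[where f = "\<lambda>t x. pV1 (fst x) * pX1 (enc (kseq f1 a) t) (fst x) (snd x)"]
    sum_blocks_prod[where f = "\<lambda>t x. pV2 (fst x) * pX2 (enc (kseq f2 a') t) (fst x) (snd x)"]
    sum_blocks_prod[where f = "\<lambda>t. W (snd (b1 t)) (snd (b2 t))"]
  by (simp_all add: sum_VX)

lemma sum_Q: "(\<Sum>a1\<in>blocks l. \<Sum>a2\<in>blocks l. Q a1 a2) = 1"
  unfolding Q_def sum_blocks2_prod[where f = "\<lambda>t x y. WS (x, y)"] sum_UNIV_pair by simp

lemma sum_Q_additive:
  "(\<Sum>a1\<in>blocks l. \<Sum>a2\<in>blocks l. Q a1 a2 * (\<Sum>t<l. h (a1 t) (a2 t)))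
    = real l * (\<Sum>s\<in>UNIV. WS s * h (fst s) (snd s))"
  unfolding Q_def
  using sum_blocks_additive[of "\<lambda>x y. WS (x, y)" l h]
  by (simp add: sum_UNIV_pair)

text \<open>Agreement of the K-blocks is agreement at each position and the source is memoryless, so
  its probability is the \<open>l\<close>-th power that appears in \<open>xi\<close>.\<close>

lemma sum_Q_same:
  "(\<Sum>a1\<in>blocks l. \<Sum>a2\<in>blocks l. Q a1 a2 * of_bool (same a1 a2)) = 1 - xi l WS f1 f2"
proof -
  have "Q a1 a2 * of_bool (same a1 a2) = (\<Prod>t<l. WS (a1 t, a2 t) * of_bool (f1 (a1 t) = f2 (a2 t)))" for a1 a2
  proof (cases "same a1 a2")
    case True
    then show ?thesis by (simp add: Q_def same_def kseq_eq_iff)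
  next
    case False
    then have "\<exists>t\<in>{..<l}. WS (a1 t, a2 t) * of_bool (f1 (a1 t) = f2 (a2 t)) = 0"
      unfolding same_def kseq_eq_iff by auto
    then have "(\<Prod>t<l. WS (a1 t, a2 t) * of_bool (f1 (a1 t) = f2 (a2 t))) = 0"
      by (intro prod_zero) auto
    then show ?thesis using False by simp
  qed
  then have "(\<Sum>a1\<in>blocks l. \<Sum>a2\<in>blocks l. Q a1 a2 * of_bool (same a1 a2))
      = (\<Sum>x\<in>UNIV. \<Sum>y\<in>UNIV. WS (x, y) * of_bool (f1 x = f2 y)) ^ l"
    by (simp only: sum_blocks2_prod[where f = "\<lambda>t x y. WS (x, y) * of_bool (f1 x = f2 y)"] prod_constant card_lessThan)
  also have "(\<Sum>x\<in>UNIV. \<Sum>y\<in>UNIV. WS (x, y) * of_bool (f1 x = f2 y))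
      = (\<Sum>s\<in>UNIV. WS s * of_bool (f1 (fst s) = f2 (snd s)))"
    unfolding sum_UNIV_pair by simp
  also have "(\<Sum>s\<in>UNIV. WS s * of_bool (f1 (fst s) = f2 (snd s)))
      = (\<Sum>s\<in>UNIV. WS s - (if f1 (fst s) \<noteq> f2 (snd s) then WS s else 0))"
    by (intro sum.cong) auto
  also have "\<dots> = 1 - (\<Sum>s\<in>{s. f1 (fst s) \<noteq> f2 (snd s)}. WS s)"
    by (simp add: sum_subtractf sum.If_cases)
  finally show ?thesis by (simp add: xi_def)
qed

definition E :: "((nat \<Rightarrow> 's1) \<Rightarrow> (nat \<Rightarrow> 's2) \<Rightarrow> (nat \<Rightarrow> 'v1 \<times> 'x1) \<Rightarrow> (nat \<Rightarrow> 'v2 \<times> 'x2) \<Rightarrow> (nat \<Rightarrow> 'y) \<Rightarrow> real) \<Rightarrow> real" where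
  "E f = (\<Sum>a1\<in>blocks l. \<Sum>a2\<in>blocks l. \<Sum>b1\<in>blocks l. \<Sum>b2\<in>blocks l. \<Sum>z\<in>blocks l.
      Q a1 a2 * p1 a1 b1 * p2 a2 b2 * T b1 b2 z * f a1 a2 b1 b2 z)"

lemma E_add: "E (\<lambda>a1 a2 b1 b2 z. f a1 a2 b1 b2 z + g a1 a2 b1 b2 z) = E f + E g"
  unfolding E_def by (simp add: distrib_left sum.distrib)

lemma E_cmult: "E (\<lambda>a1 a2 b1 b2 z. c * f a1 a2 b1 b2 z) = c * E f"
  unfolding E_def by (simp add: sum_distrib_left mult_ac)

text \<open>The comparison is asked for on the support only: the bounds on logarithms of weights
  fail where a weight may be 0.\<close>

lemma E_mono:
  assumes "\<And>a1 a2 b1 b2 z. Q a1 a2 \<noteq> 0 \<Longrightarrow> p1 a1 b1 \<noteq> 0 \<Longrightarrow> p2 a2 b2 \<noteq> 0 \<Longrightarrow> T b1 b2 z \<noteq> 0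
    \<Longrightarrow> f a1 a2 b1 b2 z \<le> g a1 a2 b1 b2 z"
  shows "E f \<le> E g"
  unfolding E_def
proof (intro sum_mono)
  fix a1 a2 b1 b2 z
  show "Q a1 a2 * p1 a1 b1 * p2 a2 b2 * T b1 b2 z * f a1 a2 b1 b2 z
    \<le> Q a1 a2 * p1 a1 b1 * p2 a2 b2 * T b1 b2 z * g a1 a2 b1 b2 z"
  proof (cases "Q a1 a2 = 0 \<or> p1 a1 b1 = 0 \<or> p2 a2 b2 = 0 \<or> T b1 b2 z = 0")
    case True
    then show ?thesis by fastforce
  next
    case False
    then show ?thesis using assms[of a1 a2 b1 b2 z] by (intro mult_left_mono) auto
  qed
qed

lemma E_source: "E (\<lambda>a1 a2 b1 b2 z. h a1 a2) = (\<Sum>a1\<in>blocks l. \<Sum>a2\<in>blocks l. Q a1 a2 * h a1 a2)"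
proof -
  have "(\<Sum>b1\<in>blocks l. \<Sum>b2\<in>blocks l. \<Sum>z\<in>blocks l. Q a1 a2 * p1 a1 b1 * p2 a2 b2 * T b1 b2 z * h a1 a2)
     = Q a1 a2 * h a1 a2" for a1 a2
  proof -
    have "(\<Sum>b1\<in>blocks l. \<Sum>b2\<in>blocks l. \<Sum>z\<in>blocks l. Q a1 a2 * p1 a1 b1 * p2 a2 b2 * T b1 b2 z * h a1 a2)
       = (\<Sum>b1\<in>blocks l. \<Sum>b2\<in>blocks l. Q a1 a2 * p1 a1 b1 * p2 a2 b2 * h a1 a2)"
      by (simp flip: sum_distrib_left sum_distrib_right)
    also have "\<dots> = (\<Sum>b1\<in>blocks l. Q a1 a2 * p1 a1 b1 * h a1 a2)"
      by (simp flip: sum_distrib_left sum_distrib_right)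
    also have "\<dots> = Q a1 a2 * h a1 a2"
      by (simp flip: sum_distrib_left sum_distrib_right)
    finally show ?thesis .
  qed
  then show ?thesis unfolding E_def by simp
qed

lemma E_const: "E (\<lambda>a1 a2 b1 b2 z. c) = c"
  using sum_Q by (simp add: E_source flip: sum_distrib_right)

text \<open>When the K-blocks agree, both users follow the same u-block and the letters obey the
  test channel given \<open>u\<close>. As every u-block has type \<open>pU\<close> exactly, the sum
  over positions is \<open>l\<close> times the single-letter mean for every message, with no
  fluctuation to control.\<close>

lemma E_same_additive:
  fixes i :: "'u \<Rightarrow> 'v1 \<times> 'x1 \<Rightarrow> 'v2 \<times> 'x2 \<Rightarrow> 'y \<Rightarrow> real"
  shows "E (\<lambda>a1 a2 b1 b2 z. of_bool (same a1 a2) * (\<Sum>t<l. i (enc (kseq f1 a1) t) (b1 t) (b2 t) (z t)))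
    = (1 - xi l WS f1 f2) * (real l * (\<Sum>u\<in>UNIV. pU u * (\<Sum>b1\<in>UNIV. \<Sum>b2\<in>UNIV. \<Sum>y\<in>UNIV.
      pV1 (fst b1) * pX1 u (fst b1) (snd b1) * (pV2 (fst b2) * pX2 u (fst b2) (snd b2)) * W (snd b1) (snd b2) y * i u b1 b2 y)))"
proof -
  let ?F = "\<lambda>u b1 b2 y. pV1 (fst b1) * pX1 u (fst b1) (snd b1) * (pV2 (fst b2) * pX2 u (fst b2) (snd b2)) * W (snd b1) (snd b2) y"
  let ?I = "\<lambda>u. \<Sum>b1\<in>UNIV. \<Sum>b2\<in>UNIV. \<Sum>y\<in>UNIV. ?F u b1 b2 y * i u b1 b2 y"
  have F1: "(\<Sum>b1\<in>UNIV. \<Sum>b2\<in>UNIV. \<Sum>y\<in>UNIV. ?F u b1 b2 y) = 1" for u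
    by (simp add: sum_VX flip: sum_distrib_left)
  have "(\<Sum>b1\<in>blocks l. \<Sum>b2\<in>blocks l. \<Sum>z\<in>blocks l. Q a1 a2 * p1 a1 b1 * p2 a2 b2 * T b1 b2 z *
      (of_bool (same a1 a2) * (\<Sum>t<l. i (enc (kseq f1 a1) t) (b1 t) (b2 t) (z t))))
     = Q a1 a2 * of_bool (same a1 a2) * (real l * (\<Sum>u\<in>UNIV. pU u * ?I u))" for a1 a2
  proof (cases "same a1 a2")
    case True
    let ?u = "enc (kseq f1 a1)"
    have p2: "p2 a2 b2 = (\<Prod>t<l. pV2 (fst (b2 t)) * pX2 (?u t) (fst (b2 t)) (snd (b2 t)))" for b2
      using True by (simp add: p2_def same_def)
    have "(\<Sum>b1\<in>blocks l. \<Sum>b2\<in>blocks l. \<Sum>z\<in>blocks l. Q a1 a2 * p1 a1 b1 * p2 a2 b2 * T b1 b2 z *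
      (of_bool (same a1 a2) * (\<Sum>t<l. i (?u t) (b1 t) (b2 t) (z t))))
      = Q a1 a2 * (\<Sum>b1\<in>blocks l. \<Sum>b2\<in>blocks l. \<Sum>z\<in>blocks l. (\<Prod>t<l. ?F (?u t) (b1 t) (b2 t) (z t)) *
         (\<Sum>t<l. i (?u t) (b1 t) (b2 t) (z t)))"
      using True unfolding sum_distrib_left[of "Q a1 a2"] p1_def p2 T_def prod.distrib
      by (intro sum.cong refl) (simp add: mult_ac)
    also have "\<dots> = Q a1 a2 * (\<Sum>t<l. ?I (?u t))"
      using sum_blocks3_additive[where F = "\<lambda>t. ?F (?u t)" and h = "\<lambda>t. i (?u t)" and l = l] F1 by simp
    also have "(\<Sum>t<l. ?I (?u t)) = (\<Sum>u\<in>UNIV. real l * pU u * ?I u)"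
      unfolding sum_cnt[where f = ?I] using enc[of "kseq f1 a1"] by (simp add: type_seqs_def)
    also have "\<dots> = real l * (\<Sum>u\<in>UNIV. pU u * ?I u)" by (simp add: sum_distrib_left mult.assoc)
    finally show ?thesis using True by simp
  qed simp
  then have "E (\<lambda>a1 a2 b1 b2 z. of_bool (same a1 a2) * (\<Sum>t<l. i (enc (kseq f1 a1) t) (b1 t) (b2 t) (z t)))
     = (\<Sum>a1\<in>blocks l. \<Sum>a2\<in>blocks l. Q a1 a2 * of_bool (same a1 a2)) * (real l * (\<Sum>u\<in>UNIV. pU u * ?I u))"
    unfolding E_def sum_distrib_right by simp
  then show ?thesis unfolding sum_Q_same .
qed

end

lemma prod_of_bool: "(\<Prod>t<l. of_bool (P t) :: real) = of_bool (\<forall>t<(l::nat). P t)"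
  by (induction l) (auto simp: less_Suc_eq)

lemma divide_self_le_1: "(x::real) / x \<le> 1"
  by (cases "x = 0") auto

text \<open>Common shape of all weights: a guess constant \<open>c\<close>, source factors
  \<open>q\<close>, and channel factors \<open>r\<close> that are present only in case
  \<open>S\<close>.\<close>

lemma ln_weight:
  fixes c :: real and q r :: "nat \<Rightarrow> real"
  assumes c: "0 < c" and q: "\<And>t. t < l \<Longrightarrow> 0 < q t" and r: "\<And>t. t < l \<Longrightarrow> S \<Longrightarrow> 0 < r t"
  shows "c * (\<Prod>t<l. q t) * (if S then \<Prod>t<l. r t else 1) \<noteq> 0"
    and "ln (c * (\<Prod>t<l. q t) * (if S then \<Prod>t<l. r t else 1))
      = ln c + (\<Sum>t<l. ln (q t)) + of_bool S * (\<Sum>t<l. ln (r t))"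
proof -
  have P: "0 < (\<Prod>t<l. q t)" using q by (intro prod_pos) auto
  have lnP: "ln (\<Prod>t<l. q t) = (\<Sum>t<l. ln (q t))"
    using q by (subst ln_prod) fastforce+
  have R: "0 < (\<Prod>t<l. r t)" "ln (\<Prod>t<l. r t) = (\<Sum>t<l. ln (r t))" if S
    using r[OF _ that] by (auto intro!: prod_pos) (subst ln_prod, fastforce+)
  show "c * (\<Prod>t<l. q t) * (if S then \<Prod>t<l. r t else 1) \<noteq> 0"
    using c q r by (cases S) fastforce+
  show "ln (c * (\<Prod>t<l. q t) * (if S then \<Prod>t<l. r t else 1))
      = ln c + (\<Sum>t<l. ln (q t)) + of_bool S * (\<Sum>t<l. ln (r t))"
  proof (cases S)
    case True
    then show ?thesis using c P R(1) by (simp add: ln_mult_pos lnP R(2))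
  qed (use c P in \<open>simp add: ln_mult_pos lnP\<close>)
qed

section \<open>Channel laws and informations of the test channel\<close>

context mac_input
begin

text \<open>\<open>wv\<close>, \<open>w2\<close> and \<open>wy\<close> are p(y|u,v1,v2), p(y|u,v2)
  and p(y|u). Independence of U, V1 and V2 makes them plain averages, with no division that could
  fail.\<close>

definition wv :: "'u \<Rightarrow> 'v1 \<Rightarrow> 'v2 \<Rightarrow> 'y \<Rightarrow> real" where
  "wv u v1 v2 y = (\<Sum>x1\<in>UNIV. \<Sum>x2\<in>UNIV. pX1 u v1 x1 * pX2 u v2 x2 * W x1 x2 y)"

definition w2 :: "'u \<Rightarrow> 'v2 \<Rightarrow> 'y \<Rightarrow> real" where
  "w2 u v2 y = (\<Sum>v1\<in>UNIV. pV1 v1 * wv u v1 v2 y)"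

definition wy :: "'u \<Rightarrow> 'y \<Rightarrow> real" where
  "wy u y = (\<Sum>v1\<in>UNIV. \<Sum>v2\<in>UNIV. pV1 v1 * pV2 v2 * wv u v1 v2 y)"

definition F :: "'u \<Rightarrow> 'v1 \<times> 'x1 \<Rightarrow> 'v2 \<times> 'x2 \<Rightarrow> 'y \<Rightarrow> real" where
  "F u b1 b2 y = pV1 (fst b1) * pX1 u (fst b1) (snd b1) * (pV2 (fst b2) * pX2 u (fst b2) (snd b2)) * W (snd b1) (snd b2) y"

text \<open>\<open>info1\<close> is I(V1;Y|U,V2) and \<open>info12\<close> below is I(V1,V2;Y|U), in
  the form in which they arise from log likelihood ratios; \<open>cmi_1\<close> and
  \<open>cmi_12\<close> identify them with \<open>cmi\<close>.\<close>

definition info1 :: real where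
  "info1 = (\<Sum>u\<in>UNIV. pU u * (\<Sum>b1\<in>UNIV. \<Sum>b2\<in>UNIV. \<Sum>y\<in>UNIV.
    F u b1 b2 y * ln (wv u (fst b1) (fst b2) y / w2 u (fst b2) y)))"

definition info12 :: real where
  "info12 = (\<Sum>u\<in>UNIV. pU u * (\<Sum>b1\<in>UNIV. \<Sum>b2\<in>UNIV. \<Sum>y\<in>UNIV.
    F u b1 b2 y * ln (wv u (fst b1) (fst b2) y / wy u y)))"

lemma wv_nonneg [simp]: "0 \<le> wv u v1 v2 y" and w2_nonneg [simp]: "0 \<le> w2 u v2 y"
  and wy_nonneg [simp]: "0 \<le> wy u y" and F_nonneg [simp]: "0 \<le> F u b1 b2 y"
  unfolding wv_def w2_def wy_def F_def by (auto intro!: sum_nonneg mult_nonneg_nonneg)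

lemma wv_ge: "pX1 u v1 x1 * pX2 u v2 x2 * W x1 x2 y \<le> wv u v1 v2 y"
proof -
  have "pX1 u v1 x1 * pX2 u v2 x2 * W x1 x2 y \<le> (\<Sum>x2\<in>UNIV. pX1 u v1 x1 * pX2 u v2 x2 * W x1 x2 y)"
    by (rule member_le_sum[where f = "\<lambda>x2. pX1 u v1 x1 * pX2 u v2 x2 * W x1 x2 y"]) auto
  also have "\<dots> \<le> wv u v1 v2 y"
    unfolding wv_def
    by (rule member_le_sum[where f = "\<lambda>x1. \<Sum>x2\<in>UNIV. pX1 u v1 x1 * pX2 u v2 x2 * W x1 x2 y"])
      (auto intro!: sum_nonneg)
  finally show ?thesis .
qed

lemma w2_ge: "pV1 v1 * wv u v1 v2 y \<le> w2 u v2 y"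
  unfolding w2_def by (rule member_le_sum[where f = "\<lambda>v1. pV1 v1 * wv u v1 v2 y"]) auto

lemma wy_ge: "pV1 v1 * pV2 v2 * wv u v1 v2 y \<le> wy u y"
proof -
  have "pV1 v1 * pV2 v2 * wv u v1 v2 y \<le> (\<Sum>v2\<in>UNIV. pV1 v1 * pV2 v2 * wv u v1 v2 y)"
    by (rule member_le_sum[where f = "\<lambda>v2. pV1 v1 * pV2 v2 * wv u v1 v2 y"]) auto
  also have "\<dots> \<le> wy u y"
    unfolding wy_def
    by (rule member_le_sum[where f = "\<lambda>v1. \<Sum>v2\<in>UNIV. pV1 v1 * pV2 v2 * wv u v1 v2 y"])
      (auto intro!: sum_nonneg)
  finally show ?thesis .
qed

lemma F_pos_imp:
  assumes "F u b1 b2 y \<noteq> 0"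
  shows "0 < pV1 (fst b1)" "0 < pV2 (fst b2)" "0 < wv u (fst b1) (fst b2) y" "0 < w2 u (fst b2) y" "0 < wy u y"
proof -
  have *: "0 < pV1 (fst b1)" "0 < pV2 (fst b2)" "0 < pX1 u (fst b1) (snd b1)" "0 < pX2 u (fst b2) (snd b2)" "0 < W (snd b1) (snd b2) y"
    using assms unfolding F_def by (auto simp: order_less_le)
  show "0 < pV1 (fst b1)" "0 < pV2 (fst b2)" using * by auto
  have "0 < pX1 u (fst b1) (snd b1) * pX2 u (fst b2) (snd b2) * W (snd b1) (snd b2) y" using * by simp
  then show wv: "0 < wv u (fst b1) (fst b2) y" using wv_ge less_le_trans by blast
  have "0 < pV1 (fst b1) * wv u (fst b1) (fst b2) y" using wv * by simp
  then show "0 < w2 u (fst b2) y" using w2_ge less_le_trans by blast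
  have "0 < pV1 (fst b1) * pV2 (fst b2) * wv u (fst b1) (fst b2) y" using wv * by simp
  then show "0 < wy u y" using wy_ge less_le_trans by blast
qed

lemma sum_F_left: "(\<Sum>b1\<in>UNIV. \<Sum>b2\<in>UNIV. \<Sum>y\<in>UNIV. F u b1 b2 y * g (fst b1)) = (\<Sum>v\<in>UNIV. pV1 v * g v)"
proof -
  have "(\<Sum>b1\<in>UNIV. \<Sum>b2\<in>UNIV. \<Sum>y\<in>UNIV. F u b1 b2 y * g (fst b1))
     = (\<Sum>b1\<in>UNIV. pV1 (fst b1) * pX1 u (fst b1) (snd b1) * g (fst b1))"
    unfolding F_def by (simp add: sum_VX flip: sum_distrib_left sum_distrib_right)
  also have "\<dots> = (\<Sum>v\<in>UNIV. \<Sum>x\<in>UNIV. pV1 v * pX1 u v x * g v)"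
    by (rule sum_UNIV_pair[symmetric])
  also have "\<dots> = (\<Sum>v\<in>UNIV. pV1 v * g v)"
    by (simp flip: sum_distrib_left sum_distrib_right)
  finally show ?thesis .
qed

lemma sum_F_right: "(\<Sum>b1\<in>UNIV. \<Sum>b2\<in>UNIV. \<Sum>y\<in>UNIV. F u b1 b2 y * g (fst b2)) = (\<Sum>v\<in>UNIV. pV2 v * g v)"
proof -
  have "(\<Sum>b1\<in>UNIV. \<Sum>b2\<in>UNIV. \<Sum>y\<in>UNIV. F u b1 b2 y * g (fst b2))
     = (\<Sum>b2\<in>UNIV. \<Sum>b1\<in>UNIV. \<Sum>y\<in>UNIV. F u b1 b2 y * g (fst b2))" by (rule sum.swap)
  also have "\<dots> = (\<Sum>b2\<in>UNIV. pV2 (fst b2) * pX2 u (fst b2) (snd b2) * g (fst b2))"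
    unfolding F_def by (simp add: sum_VX flip: sum_distrib_left sum_distrib_right)
  also have "\<dots> = (\<Sum>v\<in>UNIV. \<Sum>x\<in>UNIV. pV2 v * pX2 u v x * g v)"
    by (rule sum_UNIV_pair[symmetric])
  also have "\<dots> = (\<Sum>v\<in>UNIV. pV2 v * g v)"
    by (simp flip: sum_distrib_left sum_distrib_right)
  finally show ?thesis .
qed

text \<open>\<open>w2\<close> contains the term \<open>pV1 v1 * wv u v1 v2 y\<close>, so the
  likelihood ratio is at most \<open>1 / pV1 v1\<close> and its mean logarithm at most H(V1). This
  caps what is lost in a block without channel part.\<close>

lemma info1_le: "info1 \<le> ln (real CARD('v1))"
proof -
  have "info1 \<le> (\<Sum>u\<in>UNIV. pU u * (\<Sum>b1\<in>UNIV. \<Sum>b2\<in>UNIV. \<Sum>y\<in>UNIV. F u b1 b2 y * (- ln (pV1 (fst b1)))))"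
    unfolding info1_def
  proof (rule sum_mono, rule mult_left_mono, rule sum_mono, rule sum_mono, rule sum_mono)
    fix u b1 b2 y
    show "F u b1 b2 y * ln (wv u (fst b1) (fst b2) y / w2 u (fst b2) y) \<le> F u b1 b2 y * - ln (pV1 (fst b1))"
    proof (cases "F u b1 b2 y = 0")
      case False
      note pos = F_pos_imp[OF False]
      have "wv u (fst b1) (fst b2) y / w2 u (fst b2) y \<le> 1 / pV1 (fst b1)"
        using pos w2_ge[of "fst b1" u "fst b2" y] by (simp add: field_simps)
      then have "ln (wv u (fst b1) (fst b2) y / w2 u (fst b2) y) \<le> ln (1 / pV1 (fst b1))"
        using pos by (intro ln_mono) auto
      then show ?thesis using pos by (intro mult_left_mono) (auto simp: ln_div)
    qed simp
  qed simp
  also have "\<dots> = - (\<Sum>v\<in>UNIV. pV1 v * ln (pV1 v))"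
    unfolding sum_F_left[where g = "\<lambda>v. - ln (pV1 v)"] by (simp add: sum_negf flip: sum_distrib_right)
  also have "\<dots> \<le> ln (real CARD('v1))" by (rule entropy_le_ln_card[OF pV1])
  finally show ?thesis .
qed

lemma info12_le: "info12 \<le> ln (real (CARD('v1) * CARD('v2)))"
proof -
  have "info12 \<le> (\<Sum>u\<in>UNIV. pU u * (\<Sum>b1\<in>UNIV. \<Sum>b2\<in>UNIV. \<Sum>y\<in>UNIV.
      F u b1 b2 y * (- ln (pV1 (fst b1))) + F u b1 b2 y * (- ln (pV2 (fst b2)))))"
    unfolding info12_def
  proof (intro sum_mono mult_left_mono)
    fix u b1 b2 y
    show "F u b1 b2 y * ln (wv u (fst b1) (fst b2) y / wy u y)
      \<le> F u b1 b2 y * - ln (pV1 (fst b1)) + F u b1 b2 y * - ln (pV2 (fst b2))"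
    proof (cases "F u b1 b2 y = 0")
      case False
      note pos = F_pos_imp[OF False]
      have "wv u (fst b1) (fst b2) y / wy u y \<le> 1 / (pV1 (fst b1) * pV2 (fst b2))"
        using pos wy_ge[of "fst b1" "fst b2" u y] by (simp add: field_simps)
      then have "ln (wv u (fst b1) (fst b2) y / wy u y) \<le> ln (1 / (pV1 (fst b1) * pV2 (fst b2)))"
        using pos by (intro ln_mono) auto
      also have "\<dots> = - ln (pV1 (fst b1)) - ln (pV2 (fst b2))" using pos by (simp add: ln_div ln_mult)
      finally have "F u b1 b2 y * ln (wv u (fst b1) (fst b2) y / wy u y)
        \<le> F u b1 b2 y * (- ln (pV1 (fst b1)) - ln (pV2 (fst b2)))"
        by (intro mult_left_mono) auto
      then show ?thesis by (simp add: algebra_simps)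
    qed simp
  qed simp
  also have "\<dots> = - (\<Sum>v\<in>UNIV. pV1 v * ln (pV1 v)) - (\<Sum>v\<in>UNIV. pV2 v * ln (pV2 v))"
    unfolding sum.distrib sum_F_left[where g = "\<lambda>v. - ln (pV1 v)"] sum_F_right[where g = "\<lambda>v. - ln (pV2 v)"]
    by (simp add: sum_negf flip: sum_distrib_right)
  also have "\<dots> \<le> ln (real CARD('v1)) + ln (real CARD('v2))"
    using entropy_le_ln_card[OF pV1] entropy_le_ln_card[OF pV2] by simp
  also have "\<dots> = ln (real (CARD('v1) * CARD('v2)))" by (simp add: ln_mult)
  finally show ?thesis .
qed

end

section \<open>The weights and the means of their logarithms\<close>

context two_user_code
begin

text \<open>The conditional probability of s1 given s2 and the letter of K; \<open>Q12\<close>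
  conditions on the letter of K alone. A class of mass 0 yields 0 by the convention for
  division.\<close>

definition Q1 :: "'s1 \<Rightarrow> 's2 \<Rightarrow> real" where
  "Q1 s1 s2 = WS (s1, s2) / (\<Sum>s\<in>UNIV. of_bool (fk (s, s2) = fk (s1, s2)) * WS (s, s2))"

definition Q12 :: "'s1 \<Rightarrow> 's2 \<Rightarrow> real" where
  "Q12 s1 s2 = WS (s1, s2) / (\<Sum>s\<in>UNIV. of_bool (fk s = fk (s1, s2)) * WS s)"

lemma Q1_nonneg [simp]: "0 \<le> Q1 s1 s2" and Q12_nonneg [simp]: "0 \<le> Q12 s1 s2"
  unfolding Q1_def Q12_def by (auto intro!: divide_nonneg_nonneg sum_nonneg)

lemma Q1_denominator_ge: "WS (s1, s2) \<le> (\<Sum>s\<in>UNIV. of_bool (fk (s, s2) = fk (s1, s2)) * WS (s, s2))"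
  using member_le_sum[of s1 UNIV "\<lambda>s. of_bool (fk (s, s2) = fk (s1, s2)) * WS (s, s2)"] by simp

lemma Q12_denominator_ge: "WS (s1, s2) \<le> (\<Sum>s\<in>UNIV. of_bool (fk s = fk (s1, s2)) * WS s)"
  using member_le_sum[of "(s1, s2)" UNIV "\<lambda>s. of_bool (fk s = fk (s1, s2)) * WS s"] by simp

lemma Q1_pos: "WS (s1, s2) \<noteq> 0 \<Longrightarrow> 0 < Q1 s1 s2"
  using Q1_denominator_ge[of s1 s2] WS_nonneg[of "(s1, s2)"] unfolding Q1_def
  by (intro divide_pos_pos) linarith+

lemma Q12_pos: "WS (s1, s2) \<noteq> 0 \<Longrightarrow> 0 < Q12 s1 s2"
  using Q12_denominator_ge[of s1 s2] WS_nonneg[of "(s1, s2)"] unfolding Q12_def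
  by (intro divide_pos_pos) linarith+

lemma Q1_le_1: "Q1 s1 s2 \<le> 1"
  unfolding Q1_def using Q1_denominator_ge[of s1 s2] WS_nonneg[of "(s1, s2)"]
  by (intro divide_le_eq_1[THEN iffD2]) linarith

lemma Q12_le_1: "Q12 s1 s2 \<le> 1"
  unfolding Q12_def using Q12_denominator_ge[of s1 s2] WS_nonneg[of "(s1, s2)"]
  by (intro divide_le_eq_1[THEN iffD2]) linarith

text \<open>The sum is 1 if the pair of \<open>s2\<close> and \<open>k\<close> has positive mass and
  0 otherwise; the weights need only the upper bound.\<close>

lemma sum_Q1_le: "(\<Sum>s1\<in>UNIV. of_bool (fk (s1, s2) = k) * Q1 s1 s2) \<le> 1"
proof -
  let ?D = "\<Sum>s\<in>UNIV. of_bool (fk (s, s2) = k) * WS (s, s2)"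
  have "(\<Sum>s1\<in>UNIV. of_bool (fk (s1, s2) = k) * Q1 s1 s2) = (\<Sum>s1\<in>UNIV. of_bool (fk (s1, s2) = k) * WS (s1, s2) / ?D)"
    by (intro sum.cong refl) (auto simp: Q1_def)
  also have "\<dots> = ?D / ?D" by (rule sum_divide_distrib[symmetric])
  finally show ?thesis using divide_self_le_1[of ?D] by simp
qed

lemma sum_Q12_le: "(\<Sum>s\<in>UNIV. of_bool (fk s = k) * Q12 (fst s) (snd s)) \<le> 1"
proof -
  let ?D = "\<Sum>s\<in>UNIV. of_bool (fk s = k) * WS s"
  have "(\<Sum>s\<in>UNIV. of_bool (fk s = k) * Q12 (fst s) (snd s)) = (\<Sum>s\<in>UNIV. of_bool (fk s = k) * WS s / ?D)"
    by (intro sum.cong refl) (auto simp: Q12_def)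
  also have "\<dots> = ?D / ?D" by (rule sum_divide_distrib[symmetric])
  finally show ?thesis using divide_self_le_1[of ?D] by simp
qed

lemma ka_eq_iff: "k \<in> blocks l \<Longrightarrow> ka a1 a2 = k \<longleftrightarrow> (\<forall>t<l. fk (a1 t, a2 t) = k t)"
  unfolding ka_def kseq_def blocks_def by (auto simp: fun_eq_iff restrict_def PiE_iff extensional_def)

lemma of_bool_ka_prod:
  "k \<in> blocks l \<Longrightarrow> of_bool (ka a1 a2 = k) * (\<Prod>t<l. h (a1 t) (a2 t)) = (\<Prod>t<l. of_bool (fk (a1 t, a2 t) = k t) * (h (a1 t) (a2 t) :: real))"
  by (simp add: ka_eq_iff prod.distrib prod_of_bool)

lemma sum_ka_prod:
  assumes "k \<in> blocks l"
  shows "(\<Sum>a1\<in>blocks l. \<Sum>a2\<in>blocks l. of_bool (ka a1 a2 = k) * (\<Prod>t<l. h (a1 t) (a2 t)))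
    = (\<Prod>t<l. \<Sum>s\<in>UNIV. of_bool (fk s = k t) * (h (fst s) (snd s) :: real))"
  unfolding of_bool_ka_prod[OF assms] sum_blocks2_prod[where f = "\<lambda>t x y. of_bool (fk (x, y) = k t) * h x y"] sum_UNIV_pair
  by simp

text \<open>The first factor guesses the \<open>K\<close>-block (\<open>kseq f2 a2\<close> with weight \<open>1 - \<phi>\<close>, anything with
  weight \<open>\<phi>\<close>), the second the source letters given it; the third one is the likelihood ratio of the
  channel for a correct \<open>u\<close>-block.\<close>
definition lam1 :: "(nat \<Rightarrow> 's1) \<Rightarrow> (nat \<Rightarrow> 's2) \<Rightarrow> (nat \<Rightarrow> 'v1 \<times> 'x1) \<Rightarrow> (nat \<Rightarrow> 'v2 \<times> 'x2) \<Rightarrow> (nat \<Rightarrow> 'y) \<Rightarrow> real" where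
  "lam1 a1 a2 b1 b2 z = ((1 - \<phi>) * of_bool (ka a1 a2 = kseq f2 a2) + \<phi> / real CARD('s1) ^ l) * (\<Prod>t<l. Q1 (a1 t) (a2 t)) *
    (if same a1 a2 then \<Prod>t<l. wv (enc (kseq f1 a1) t) (fst (b1 t)) (fst (b2 t)) (z t) / w2 (enc (kseq f1 a1) t) (fst (b2 t)) (z t) else 1)"

text \<open>Now no user's K is known. Each member of the list gets weight
  \<open>(1 - \<phi>) / exp (real l * \<beta>)\<close>, hence the whole list at most
  \<open>1 - \<phi>\<close>; the remaining \<open>\<phi>\<close> is spread over all source blocks
  and keeps the weight positive when the list misses.\<close>

definition lam12 :: "real \<Rightarrow> ((nat \<Rightarrow> 'y) \<Rightarrow> (nat \<Rightarrow> 'k) set) \<Rightarrow> (nat \<Rightarrow> 's1) \<Rightarrow> (nat \<Rightarrow> 's2) \<Rightarrow> (nat \<Rightarrow> 'v1 \<times> 'x1) \<Rightarrow> (nat \<Rightarrow> 'v2 \<times> 'x2) \<Rightarrow> (nat \<Rightarrow> 'y) \<Rightarrow> real" where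
  "lam12 \<beta> L a1 a2 b1 b2 z = ((1 - \<phi>) / exp (real l * \<beta>) * of_bool (ka a1 a2 \<in> L z) + \<phi> / real (CARD('s1) * CARD('s2)) ^ l)
    * (\<Prod>t<l. Q12 (a1 t) (a2 t)) *
    (if same a1 a2 then \<Prod>t<l. wv (enc (kseq f1 a1) t) (fst (b1 t)) (fst (b2 t)) (z t) / wy (enc (kseq f1 a1) t) (z t) else 1)"

lemma lam_nonneg: "0 \<le> lam1 a1 a2 b1 b2 z" "0 \<le> lam12 \<beta> L a1 a2 b1 b2 z"
  unfolding lam1_def lam12_def using \<phi>
  by (auto intro!: mult_nonneg_nonneg add_nonneg_nonneg prod_nonneg divide_nonneg_nonneg)

lemma support_letters:
  assumes "Q a1 a2 \<noteq> 0" "p1 a1 b1 \<noteq> 0" "p2 a2 b2 \<noteq> 0" "T b1 b2 z \<noteq> 0" "t < l"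
  shows "WS (a1 t, a2 t) \<noteq> 0" and "same a1 a2 \<Longrightarrow> F (enc (kseq f1 a1) t) (b1 t) (b2 t) (z t) \<noteq> 0"
proof -
  have *: "WS (a1 t, a2 t) \<noteq> 0" "pV1 (fst (b1 t)) \<noteq> 0" "pX1 (enc (kseq f1 a1) t) (fst (b1 t)) (snd (b1 t)) \<noteq> 0"
    "pV2 (fst (b2 t)) \<noteq> 0" "pX2 (enc (kseq f2 a2) t) (fst (b2 t)) (snd (b2 t)) \<noteq> 0" "W (snd (b1 t)) (snd (b2 t)) (z t) \<noteq> 0"
    using assms unfolding Q_def p1_def p2_def T_def by auto
  then show "WS (a1 t, a2 t) \<noteq> 0" by simp
  show "F (enc (kseq f1 a1) t) (b1 t) (b2 t) (z t) \<noteq> 0" if "same a1 a2"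
    using * that unfolding F_def same_def by simp
qed

text \<open>One of the two summands of the guess is kept: the one with \<open>1 - \<phi>\<close> if
  the K-blocks agree, since then the guess is right, and the uniform one otherwise.\<close>

lemma ln_lam1_ge:
  assumes "Q a1 a2 \<noteq> 0" "p1 a1 b1 \<noteq> 0" "p2 a2 b2 \<noteq> 0" "T b1 b2 z \<noteq> 0"
  shows "lam1 a1 a2 b1 b2 z \<noteq> 0"
    and "(if same a1 a2 then ln (1 - \<phi>) else ln \<phi> - real l * ln (real CARD('s1))) + (\<Sum>t<l. ln (Q1 (a1 t) (a2 t)))
      + of_bool (same a1 a2) * (\<Sum>t<l. ln (wv (enc (kseq f1 a1) t) (fst (b1 t)) (fst (b2 t)) (z t) / w2 (enc (kseq f1 a1) t) (fst (b2 t)) (z t)))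
    \<le> ln (lam1 a1 a2 b1 b2 z)"
proof -
  let ?c = "(1 - \<phi>) * of_bool (ka a1 a2 = kseq f2 a2) + \<phi> / real CARD('s1) ^ l"
  let ?r = "\<lambda>t. wv (enc (kseq f1 a1) t) (fst (b1 t)) (fst (b2 t)) (z t) / w2 (enc (kseq f1 a1) t) (fst (b2 t)) (z t)"
  have cpos: "0 < \<phi> / real CARD('s1) ^ l" using \<phi> by simp
  then have c: "0 < ?c" using \<phi> by (intro add_nonneg_pos) auto
  have Qt: "0 < Q1 (a1 t) (a2 t)" if "t < l" for t
    using support_letters(1)[OF assms that] by (rule Q1_pos)
  have rt: "0 < ?r t" if "t < l" "same a1 a2" for t
    using F_pos_imp[OF support_letters(2)[OF assms that]] by simp
  note w = ln_weight[where q = "\<lambda>t. Q1 (a1 t) (a2 t)" and r = ?r and l = l and S = "same a1 a2", OF c Qt rt]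
  show "lam1 a1 a2 b1 b2 z \<noteq> 0" unfolding lam1_def by (rule w(1))
  have "ln (lam1 a1 a2 b1 b2 z) = ln ?c + (\<Sum>t<l. ln (Q1 (a1 t) (a2 t))) + of_bool (same a1 a2) * (\<Sum>t<l. ln (?r t))"
    unfolding lam1_def by (rule w(2))
  moreover have "(if same a1 a2 then ln (1 - \<phi>) else ln \<phi> - real l * ln (real CARD('s1))) \<le> ln ?c"
  proof (cases "same a1 a2")
    case True
    then have "ka a1 a2 = kseq f2 a2" using same_ka by (simp add: same_def)
    then have "1 - \<phi> \<le> ?c" using cpos by simp
    then show ?thesis using True \<phi> c by (simp add: ln_mono)
  next
    case False
    have "\<phi> / real CARD('s1) ^ l \<le> ?c" using \<phi> by simp
    then have "ln (\<phi> / real CARD('s1) ^ l) \<le> ln ?c" using cpos by (intro ln_mono)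
    then show ?thesis using False \<phi> by (simp add: ln_div ln_realpow)
  qed
  ultimately show "(if same a1 a2 then ln (1 - \<phi>) else ln \<phi> - real l * ln (real CARD('s1))) + (\<Sum>t<l. ln (Q1 (a1 t) (a2 t)))
      + of_bool (same a1 a2) * (\<Sum>t<l. ln (?r t)) \<le> ln (lam1 a1 a2 b1 b2 z)"
    by linarith
qed

lemma xi_bounds: "0 \<le> xi l WS f1 f2" "xi l WS f1 f2 \<le> \<phi>"
  using xi_nonneg[OF WS] mismatch by auto

text \<open>The channel part is missing with probability \<open>xi\<close>, which is at most
  \<open>\<phi>\<close>, and an information is worth at most \<open>ln N\<close>; this is the origin
  of the terms \<open>\<phi> * ln (real N)\<close> for the V-alphabets.\<close>

lemma weighted_info_ge:
  assumes "I \<le> ln (real N)" "1 \<le> N"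
  shows "I - \<phi> * ln (real N) \<le> (1 - xi l WS f1 f2) * I"
proof -
  have "xi l WS f1 f2 * I \<le> xi l WS f1 f2 * ln (real N)" using assms xi_bounds by (intro mult_left_mono) auto
  also have "\<dots> \<le> \<phi> * ln (real N)" using assms xi_bounds by (intro mult_right_mono) auto
  finally show ?thesis by (simp add: algebra_simps)
qed

lemma hb_nonneg: "0 \<le> hb \<phi>"
proof -
  have "\<phi> * ln \<phi> \<le> 0" "(1 - \<phi>) * ln (1 - \<phi>) \<le> 0" using \<phi> by (auto intro!: mult_nonneg_nonpos)
  then show ?thesis by (simp add: hb_def)
qed

text \<open>Per block, the guess costs at most \<open>hb \<phi>\<close> plus
  \<open>\<phi> * l * ln\<close> of the source alphabet, the letters cost l H(S1|S2,K), and the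
  channel returns at least \<open>l * (info1 - \<phi> * ln (real CARD('v1)))\<close>. The rate
  condition times \<open>l\<close> makes the balance positive.\<close>

lemma E_ln_lam1_pos:
  assumes "- (\<Sum>s\<in>UNIV. WS s * ln (Q1 (fst s) (snd s))) + LL l \<phi> CARD('s1) < info1 - LL 1 \<phi> CARD('v1)"
  shows "0 < E (\<lambda>a1 a2 b1 b2 z. ln (lam1 a1 a2 b1 b2 z))"
proof -
  let ?H = "\<Sum>s\<in>UNIV. WS s * ln (Q1 (fst s) (snd s))"
  let ?x = "xi l WS f1 f2" and ?N = "real CARD('s1)"
  let ?i = "\<lambda>u b1 b2 y. ln (wv u (fst b1) (fst b2) y / w2 u (fst b2) y)"
  have 1: "E (\<lambda>a1 a2 b1 b2 z. if same a1 a2 then ln (1 - \<phi>) else ln \<phi> - real l * ln ?N)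
     = (1 - ?x) * ln (1 - \<phi>) + ?x * (ln \<phi> - real l * ln ?N)"
  proof -
    have "E (\<lambda>a1 a2 b1 b2 z. if same a1 a2 then ln (1 - \<phi>) else ln \<phi> - real l * ln ?N)
      = E (\<lambda>a1 a2 b1 b2 z. (ln (1 - \<phi>) - (ln \<phi> - real l * ln ?N)) * of_bool (same a1 a2) + (ln \<phi> - real l * ln ?N))"
      by (rule arg_cong[where f = E]) (auto simp: fun_eq_iff)
    also have "\<dots> = (ln (1 - \<phi>) - (ln \<phi> - real l * ln ?N)) * (1 - ?x) + (ln \<phi> - real l * ln ?N)"
      unfolding E_add E_cmult E_const E_source sum_Q_same ..
    finally show ?thesis by (simp add: algebra_simps)
  qed
  have 2: "E (\<lambda>a1 a2 b1 b2 z. \<Sum>t<l. ln (Q1 (a1 t) (a2 t))) = real l * ?H"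
    unfolding E_source by (rule sum_Q_additive[where h = "\<lambda>x y. ln (Q1 x y)"])
  have 3: "E (\<lambda>a1 a2 b1 b2 z. of_bool (same a1 a2) * (\<Sum>t<l. ?i (enc (kseq f1 a1) t) (b1 t) (b2 t) (z t)))
     = (1 - ?x) * (real l * info1)"
    unfolding E_same_additive[where i = ?i] info1_def F_def ..
  have "((1 - ?x) * ln (1 - \<phi>) + ?x * (ln \<phi> - real l * ln ?N)) + real l * ?H + (1 - ?x) * (real l * info1)
     \<le> E (\<lambda>a1 a2 b1 b2 z. ln (lam1 a1 a2 b1 b2 z))"
    unfolding 1[symmetric] 2[symmetric] 3[symmetric] E_add[symmetric] by (rule E_mono) (rule ln_lam1_ge(2))
  moreover have "- hb \<phi> \<le> (1 - ?x) * ln (1 - \<phi>) + ?x * ln \<phi>"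
    using xi_bounds \<phi> by (intro binary_cross_entropy_ge) auto
  moreover have "?x * (real l * ln ?N) \<le> \<phi> * (real l * ln ?N)"
    using xi_bounds by (intro mult_right_mono mult_nonneg_nonneg) (auto simp: Suc_leI)
  moreover have "real l * (info1 - \<phi> * ln (real CARD('v1))) \<le> real l * ((1 - ?x) * info1)"
    using weighted_info_ge[OF info1_le] by (intro mult_left_mono) (auto simp: Suc_leI)
  moreover have "real l * (- ?H + LL l \<phi> CARD('s1)) < real l * (info1 - LL 1 \<phi> CARD('v1))"
    using assms l by (intro mult_strict_left_mono) auto
  then have "- (real l * ?H) + hb \<phi> + \<phi> * (real l * ln ?N) < real l * (info1 - \<phi> * ln (real CARD('v1))) - real l * hb \<phi>"
    using l by (simp add: LL_def algebra_simps)
  moreover have "0 \<le> real l * hb \<phi>" using hb_nonneg by simp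
  ultimately show ?thesis by (simp add: algebra_simps)
qed

end

section \<open>Entropies and mutual informations of the test channel\<close>

text \<open>Invariance under relabelling of the sample space; it turns the rate condition of user 2
  into that of user 1 in the system with users exchanged.\<close>

lemma ent_reindex:
  fixes P :: "'a::finite \<Rightarrow> real" and g :: "'b::finite \<Rightarrow> 'a"
  assumes g: "bij g"
  shows "ent (\<lambda>x. P (g x)) (\<lambda>x. f (g x)) = ent P f"
proof -
  have inner: "(\<Sum>x'\<in>{x'. f (g x') = b}. P (g x')) = (\<Sum>x'\<in>{x'. f x' = b}. P x')" for b
    using bij_betw_Collect[of g UNIV UNIV "\<lambda>x. f x = b" "\<lambda>x. f (g x) = b"] g
    by (intro sum.reindex_bij_betw) simp
  show ?thesis
    unfolding ent_eq_sum inner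
    using sum.reindex_bij_betw[of g UNIV UNIV "\<lambda>x. P x * ln (\<Sum>x'\<in>{x'. f x' = f x}. P x')"] g
    by simp
qed

lemma cent_reindex:
  fixes P :: "'a::finite \<Rightarrow> real" and g :: "'b::finite \<Rightarrow> 'a"
  shows "bij g \<Longrightarrow> cent (\<lambda>x. P (g x)) (\<lambda>x. fa (g x)) (\<lambda>x. fb (g x)) = cent P fa fb"
  unfolding cent_def
  using ent_reindex[of g P "\<lambda>x. (fa x, fb x)"] ent_reindex[of g P fb] by simp

lemma cmi_reindex:
  fixes P :: "'a::finite \<Rightarrow> real" and g :: "'b::finite \<Rightarrow> 'a"
  shows "bij g \<Longrightarrow> cmi (\<lambda>x. P (g x)) (\<lambda>x. fa (g x)) (\<lambda>x. fb (g x)) (\<lambda>x. fc (g x)) = cmi P fa fb fc"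
  unfolding cmi_def
  using ent_reindex[of g P "\<lambda>x. (fa x, fc x)"] ent_reindex[of g P "\<lambda>x. (fb x, fc x)"]
    ent_reindex[of g P "\<lambda>x. (fa x, fb x, fc x)"] ent_reindex[of g P fc] by simp

lemma cmi_eq_sum:
  fixes P :: "'a::finite \<Rightarrow> real"
  shows "cmi P fa fb fc = (\<Sum>x\<in>UNIV. P x * (ln (\<Sum>x'\<in>{x'. (fa x', fb x', fc x') = (fa x, fb x, fc x)}. P x')
      + ln (\<Sum>x'\<in>{x'. fc x' = fc x}. P x') - ln (\<Sum>x'\<in>{x'. (fa x', fc x') = (fa x, fc x)}. P x')
      - ln (\<Sum>x'\<in>{x'. (fb x', fc x') = (fb x, fc x)}. P x')))"
  unfolding cmi_def ent_eq_sum by (simp add: distrib_left right_diff_distrib sum.distrib sum_subtractf)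

text \<open>The information density needs to be known on the support only, where the marginals are
  positive and logarithms of products split.\<close>

lemma cmi_eqI:
  fixes P :: "'a::finite \<Rightarrow> real"
  assumes "\<And>x. P x \<noteq> 0 \<Longrightarrow> ln (\<Sum>x'\<in>{x'. (fa x', fb x', fc x') = (fa x, fb x, fc x)}. P x')
      + ln (\<Sum>x'\<in>{x'. fc x' = fc x}. P x') - ln (\<Sum>x'\<in>{x'. (fa x', fc x') = (fa x, fc x)}. P x')
      - ln (\<Sum>x'\<in>{x'. (fb x', fc x') = (fb x, fc x)}. P x') = g x"
  shows "cmi P fa fb fc = (\<Sum>x\<in>UNIV. P x * g x)"
  unfolding cmi_eq_sum
proof (intro sum.cong refl, goal_cases)
  case (1 x)
  show ?case
  proof (cases "P x = 0")
    case False
    show ?thesis unfolding assms[OF False] ..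
  qed (simp only: mult_zero_left)
qed

lemma sum_tuple6:
  "(\<Sum>z\<in>UNIV. G z) = (\<Sum>u\<in>UNIV. \<Sum>v1\<in>UNIV. \<Sum>v2\<in>UNIV. \<Sum>x1\<in>UNIV. \<Sum>x2\<in>UNIV. \<Sum>y\<in>UNIV. G (u, v1, v2, x1, x2, y))"
  by (simp add: sum.cartesian_product case_prod_unfold)

lemma sum_pair: "(\<Sum>b\<in>UNIV. G b) = (\<Sum>x\<in>UNIV. \<Sum>y\<in>UNIV. G (x, y))"
  by (simp add: sum.cartesian_product)

lemma sum_if_const: "(\<Sum>x\<in>A. if c then f x else 0) = (if c then \<Sum>x\<in>A. f x else (0::real))"
  by simp

lemma sum_Collect_if: "(\<Sum>x\<in>{x::'a::finite. R x}. P x) = (\<Sum>x\<in>UNIV. if R x then P x else (0::real))"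
  by (simp add: sum.If_cases)

context mac_input
begin

text \<open>All marginals that occur in \<open>cmi_1\<close>, \<open>cmi_12\<close> and
  \<open>pYgU\<close>. The indicator of the event is distributed over the nested sums, after which
  the free variables integrate to 1.\<close>

lemma joint6_marginals:
  fixes u :: 'u and v1 :: 'v1 and v2 :: 'v2 and y :: 'y
  defines "P \<equiv> joint6 pU pV1 pV2 pX1 pX2 W"
  shows "(\<Sum>z\<in>{(u', v1', v2', x1, x2, y'). u' = u}. P z) = pU u"
    and "(\<Sum>z\<in>{(u', v1', v2', x1, x2, y'). u' = u \<and> v2' = v2}. P z) = pU u * pV2 v2"
    and "(\<Sum>z\<in>{(u', v1', v2', x1, x2, y'). u' = u \<and> v1' = v1 \<and> v2' = v2}. P z) = pU u * pV1 v1 * pV2 v2"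
    and "(\<Sum>z\<in>{(u', v1', v2', x1, x2, y'). u' = u \<and> y' = y}. P z) = pU u * wy u y"
    and "(\<Sum>z\<in>{(u', v1', v2', x1, x2, y'). u' = u \<and> v2' = v2 \<and> y' = y}. P z) = pU u * pV2 v2 * w2 u v2 y"
    and "(\<Sum>z\<in>{(u', v1', v2', x1, x2, y'). u' = u \<and> v1' = v1 \<and> v2' = v2 \<and> y' = y}. P z)
      = pU u * pV1 v1 * pV2 v2 * wv u v1 v2 y"
  unfolding P_def sum_Collect_if sum_tuple6 joint6_def prod.case if_if_eq_conj[symmetric] sum_if_const
  by (simp_all add: sum_if_const wy_def w2_def wv_def mult.assoc flip: sum_distrib_left)
    ((simp flip: sum_distrib_right; fail) | (simp add: sum_distrib_left mult_ac))+


lemma sum_joint6_log: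
  "(\<Sum>z\<in>UNIV. joint6 pU pV1 pV2 pX1 pX2 W z * (case z of (u, v1, v2, x1, x2, y) \<Rightarrow> g u v1 v2 y))
    = (\<Sum>u\<in>UNIV. pU u * (\<Sum>b1\<in>UNIV. \<Sum>b2\<in>UNIV. \<Sum>y\<in>UNIV. F u b1 b2 y * g u (fst b1) (fst b2) y))"
proof -
  have "(\<Sum>b1\<in>UNIV. \<Sum>b2\<in>UNIV. \<Sum>y\<in>UNIV. F u b1 b2 y * g u (fst b1) (fst b2) y)
     = (\<Sum>v1\<in>UNIV. \<Sum>v2\<in>UNIV. \<Sum>x1\<in>UNIV. \<Sum>x2\<in>UNIV. \<Sum>y\<in>UNIV.
        pV1 v1 * pX1 u v1 x1 * (pV2 v2 * pX2 u v2 x2) * W x1 x2 y * g u v1 v2 y)" for u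
  proof -
    have "(\<Sum>b1\<in>UNIV. \<Sum>b2\<in>UNIV. \<Sum>y\<in>UNIV. F u b1 b2 y * g u (fst b1) (fst b2) y)
      = (\<Sum>v1\<in>UNIV. \<Sum>x1\<in>UNIV. \<Sum>v2\<in>UNIV. \<Sum>x2\<in>UNIV. \<Sum>y\<in>UNIV.
        pV1 v1 * pX1 u v1 x1 * (pV2 v2 * pX2 u v2 x2) * W x1 x2 y * g u v1 v2 y)"
      unfolding sum_pair F_def fst_conv snd_conv ..
    also have "\<dots> = (\<Sum>v1\<in>UNIV. \<Sum>v2\<in>UNIV. \<Sum>x1\<in>UNIV. \<Sum>x2\<in>UNIV. \<Sum>y\<in>UNIV.
        pV1 v1 * pX1 u v1 x1 * (pV2 v2 * pX2 u v2 x2) * W x1 x2 y * g u v1 v2 y)"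
      by (intro sum.cong refl sum.swap)
    finally show ?thesis .
  qed
  then show ?thesis
    unfolding sum_tuple6 joint6_def by (simp add: sum_distrib_left mult_ac)
qed

lemma joint6_pos_imp:
  assumes "joint6 pU pV1 pV2 pX1 pX2 W (u, v1, v2, x1, x2, y) \<noteq> 0"
  shows "0 < pU u" "0 < pV1 v1" "0 < pV2 v2" "0 < wv u v1 v2 y" "0 < w2 u v2 y" "0 < wy u y"
proof -
  have *: "pU u \<noteq> 0" "pV1 v1 \<noteq> 0" "pV2 v2 \<noteq> 0" "F u (v1, x1) (v2, x2) y \<noteq> 0"
    using assms unfolding joint6_def F_def by auto
  show "0 < pU u" using *(1) by (simp add: order_less_le)
  show "0 < pV1 v1" "0 < pV2 v2" "0 < wv u v1 v2 y" "0 < w2 u v2 y" "0 < wy u y"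
    using F_pos_imp[OF *(4)] by simp_all
qed

text \<open>In the information density the factors \<open>pU u\<close>, \<open>pV1 v1\<close> and
  \<open>pV2 v2\<close> of the four marginals cancel, by independence, and leave the ratio of
  \<open>wv\<close> and \<open>w2\<close>.\<close>

lemma cmi_1: "cmi (joint6 pU pV1 pV2 pX1 pX2 W) (\<lambda>(u,v1,v2,x1,x2,y). v1) (\<lambda>(u,v1,v2,x1,x2,y). y)
    (\<lambda>(u,v1,v2,x1,x2,y). (u, v2)) = info1"
proof -
  have "cmi (joint6 pU pV1 pV2 pX1 pX2 W) (\<lambda>(u,v1,v2,x1,x2,y). v1) (\<lambda>(u,v1,v2,x1,x2,y). y)
      (\<lambda>(u,v1,v2,x1,x2,y). (u, v2))
    = (\<Sum>z\<in>UNIV. joint6 pU pV1 pV2 pX1 pX2 W z * (case z of (u, v1, v2, x1, x2, y) \<Rightarrow> ln (wv u v1 v2 y / w2 u v2 y)))"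
  proof (rule cmi_eqI, goal_cases)
    case (1 z)
    obtain u v1 v2 x1 x2 y where z: "z = (u, v1, v2, x1, x2, y)" by (metis prod_cases6)
    have s: "{z'. ((case z' of (u,v1,v2,x1,x2,y) \<Rightarrow> v1), (case z' of (u,v1,v2,x1,x2,y) \<Rightarrow> y), (case z' of (u,v1,v2,x1,x2,y) \<Rightarrow> (u, v2)))
        = ((case z of (u,v1,v2,x1,x2,y) \<Rightarrow> v1), (case z of (u,v1,v2,x1,x2,y) \<Rightarrow> y), (case z of (u,v1,v2,x1,x2,y) \<Rightarrow> (u, v2)))}
        = {(u', v1', v2', x1, x2, y'). u' = u \<and> v1' = v1 \<and> v2' = v2 \<and> y' = y}"
      "{z'. (case z' of (u,v1,v2,x1,x2,y) \<Rightarrow> (u, v2)) = (case z of (u,v1,v2,x1,x2,y) \<Rightarrow> (u, v2))}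
        = {(u', v1', v2', x1, x2, y'). u' = u \<and> v2' = v2}"
      "{z'. ((case z' of (u,v1,v2,x1,x2,y) \<Rightarrow> v1), (case z' of (u,v1,v2,x1,x2,y) \<Rightarrow> (u, v2)))
        = ((case z of (u,v1,v2,x1,x2,y) \<Rightarrow> v1), (case z of (u,v1,v2,x1,x2,y) \<Rightarrow> (u, v2)))}
        = {(u', v1', v2', x1, x2, y'). u' = u \<and> v1' = v1 \<and> v2' = v2}"
      "{z'. ((case z' of (u,v1,v2,x1,x2,y) \<Rightarrow> y), (case z' of (u,v1,v2,x1,x2,y) \<Rightarrow> (u, v2)))
        = ((case z of (u,v1,v2,x1,x2,y) \<Rightarrow> y), (case z of (u,v1,v2,x1,x2,y) \<Rightarrow> (u, v2)))}
        = {(u', v1', v2', x1, x2, y'). u' = u \<and> v2' = v2 \<and> y' = y}"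
      unfolding z by auto
    show ?case
      unfolding s joint6_marginals
      using joint6_pos_imp[OF 1[unfolded z]] by (simp add: z ln_mult ln_div)
  qed
  then show ?thesis unfolding sum_joint6_log info1_def .
qed

lemma cmi_12: "cmi (joint6 pU pV1 pV2 pX1 pX2 W) (\<lambda>(u,v1,v2,x1,x2,y). (v1, v2)) (\<lambda>(u,v1,v2,x1,x2,y). y)
    (\<lambda>(u,v1,v2,x1,x2,y). u) = info12"
proof -
  have "cmi (joint6 pU pV1 pV2 pX1 pX2 W) (\<lambda>(u,v1,v2,x1,x2,y). (v1, v2)) (\<lambda>(u,v1,v2,x1,x2,y). y)
      (\<lambda>(u,v1,v2,x1,x2,y). u)
    = (\<Sum>z\<in>UNIV. joint6 pU pV1 pV2 pX1 pX2 W z * (case z of (u, v1, v2, x1, x2, y) \<Rightarrow> ln (wv u v1 v2 y / wy u y)))"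
  proof (rule cmi_eqI, goal_cases)
    case (1 z)
    obtain u v1 v2 x1 x2 y where z: "z = (u, v1, v2, x1, x2, y)" by (metis prod_cases6)
    have s: "{z'. ((case z' of (u,v1,v2,x1,x2,y) \<Rightarrow> (v1, v2)), (case z' of (u,v1,v2,x1,x2,y) \<Rightarrow> y), (case z' of (u,v1,v2,x1,x2,y) \<Rightarrow> u))
        = ((case z of (u,v1,v2,x1,x2,y) \<Rightarrow> (v1, v2)), (case z of (u,v1,v2,x1,x2,y) \<Rightarrow> y), (case z of (u,v1,v2,x1,x2,y) \<Rightarrow> u))}
        = {(u', v1', v2', x1, x2, y'). u' = u \<and> v1' = v1 \<and> v2' = v2 \<and> y' = y}"
      "{z'. (case z' of (u,v1,v2,x1,x2,y) \<Rightarrow> u) = (case z of (u,v1,v2,x1,x2,y) \<Rightarrow> u)}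
        = {(u', v1', v2', x1, x2, y'). u' = u}"
      "{z'. ((case z' of (u,v1,v2,x1,x2,y) \<Rightarrow> (v1, v2)), (case z' of (u,v1,v2,x1,x2,y) \<Rightarrow> u))
        = ((case z of (u,v1,v2,x1,x2,y) \<Rightarrow> (v1, v2)), (case z of (u,v1,v2,x1,x2,y) \<Rightarrow> u))}
        = {(u', v1', v2', x1, x2, y'). u' = u \<and> v1' = v1 \<and> v2' = v2}"
      "{z'. ((case z' of (u,v1,v2,x1,x2,y) \<Rightarrow> y), (case z' of (u,v1,v2,x1,x2,y) \<Rightarrow> u))
        = ((case z of (u,v1,v2,x1,x2,y) \<Rightarrow> y), (case z of (u,v1,v2,x1,x2,y) \<Rightarrow> u))}
        = {(u', v1', v2', x1, x2, y'). u' = u \<and> y' = y}"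
      unfolding z by auto
    show ?case
      unfolding s joint6_marginals
      using joint6_pos_imp[OF 1[unfolded z]] by (simp add: z ln_mult ln_div)
  qed
  then show ?thesis unfolding sum_joint6_log info12_def .
qed

text \<open>For \<open>pU u = 0\<close> the two differ: \<open>pYgU\<close> is 0 there while
  \<open>wy u\<close> is still a distribution. Hence the inner layer asks for stochastic rows only
  where \<open>pU\<close> is positive.\<close>

lemma pYgU_joint6: "0 < pU u \<Longrightarrow> pYgU (joint6 pU pV1 pV2 pX1 pX2 W) u y = wy u y"
proof -
  have e: "{z :: 'u \<times> 'v1 \<times> 'v2 \<times> 'x1 \<times> 'x2 \<times> 'y. fst z = u \<and> snd (snd (snd (snd (snd z)))) = y}
      = {(u', v1', v2', x1, x2, y'). u' = u \<and> y' = y}"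
    "{z :: 'u \<times> 'v1 \<times> 'v2 \<times> 'x1 \<times> 'x2 \<times> 'y. fst z = u} = {(u', v1', v2', x1, x2, y'). u' = u}"
    by auto
  assume "0 < pU u"
  then show ?thesis unfolding pYgU_def e joint6_marginals by simp
qed

lemma sum_wv: "(\<Sum>y\<in>UNIV. wv u v1 v2 y) = 1"
proof -
  have "(\<Sum>y\<in>UNIV. wv u v1 v2 y) = (\<Sum>x1\<in>UNIV. \<Sum>x2\<in>UNIV. \<Sum>y\<in>UNIV. pX1 u v1 x1 * pX2 u v2 x2 * W x1 x2 y)"
    unfolding wv_def by (subst sum.swap, intro sum.cong refl) (rule sum.swap)
  also have "\<dots> = 1" by (simp flip: sum_distrib_left)
  finally show ?thesis .
qed

lemma pmf_wy: "is_pmf (wy u)"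
proof -
  have "(\<Sum>y\<in>UNIV. wy u y) = (\<Sum>v1\<in>UNIV. \<Sum>v2\<in>UNIV. \<Sum>y\<in>UNIV. pV1 v1 * pV2 v2 * wv u v1 v2 y)"
    unfolding wy_def by (subst sum.swap, intro sum.cong refl) (rule sum.swap)
  also have "\<dots> = 1" by (simp add: sum_wv flip: sum_distrib_left)
  finally show ?thesis by (simp add: is_pmf_def)
qed

end

context two_user_code
begin

lemma cent_1: "cent WS fst (\<lambda>s. (snd s, fk s)) = - (\<Sum>s\<in>UNIV. WS s * ln (Q1 (fst s) (snd s)))"
proof -
  have "cent WS fst (\<lambda>s. (snd s, fk s)) = - (\<Sum>s\<in>UNIV. WS s *
      (ln (\<Sum>s'\<in>{s'. (fst s', snd s', fk s') = (fst s, snd s, fk s)}. WS s') - ln (\<Sum>s'\<in>{s'. (snd s', fk s') = (snd s, fk s)}. WS s')))"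
    unfolding cent_def ent_eq_sum by (simp add: right_diff_distrib sum_subtractf)
  also have "\<dots> = - (\<Sum>s\<in>UNIV. WS s * ln (Q1 (fst s) (snd s)))"
  proof (intro arg_cong[where f = uminus] sum.cong refl)
    fix s :: "'s1 \<times> 's2"
    obtain s1 s2 where s: "s = (s1, s2)" by fastforce
    \<comment> \<open>K is a function of the source pair, so adding it to the pair does not enlarge
      the event.\<close>
    have 1: "{s'. (fst s', snd s', fk s') = (fst s, snd s, fk s)} = {s}" by (auto intro: prod_eqI)
    let ?D = "\<Sum>x\<in>UNIV. of_bool (fk (x, s2) = fk (s1, s2)) * WS (x, s2)"
    have 2: "(\<Sum>s'\<in>{s'. (snd s', fk s') = (snd s, fk s)}. WS s') = ?D"
    proof -
      have "(\<Sum>s'\<in>{s'. (snd s', fk s') = (snd s, fk s)}. WS s')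
         = (\<Sum>x\<in>UNIV. \<Sum>y\<in>UNIV. if y = s2 then of_bool (fk (x, y) = fk (s1, s2)) * WS (x, y) else 0)"
        unfolding sum_Collect_if sum_UNIV_pair by (intro sum.cong) (auto simp: s)
      then show ?thesis by simp
    qed
    show "WS s * (ln (\<Sum>s'\<in>{s'. (fst s', snd s', fk s') = (fst s, snd s, fk s)}. WS s') - ln (\<Sum>s'\<in>{s'. (snd s', fk s') = (snd s, fk s)}. WS s'))
      = WS s * ln (Q1 (fst s) (snd s))"
    proof (cases "WS s = 0")
      case False
      then have "0 < WS s" by (simp add: order_less_le)
      moreover have "WS s \<le> ?D" unfolding s by (rule Q1_denominator_ge)
      ultimately have "ln (Q1 s1 s2) = ln (WS s) - ln ?D"
        unfolding Q1_def by (subst ln_div) (auto simp: s)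
      then show ?thesis unfolding 1 2 by (simp add: s)
    qed simp
  qed
  finally show ?thesis .
qed

lemma cent_12: "cent WS id fk = - (\<Sum>s\<in>UNIV. WS s * ln (Q12 (fst s) (snd s)))"
proof -
  have "cent WS id fk = - (\<Sum>s\<in>UNIV. WS s *
      (ln (\<Sum>s'\<in>{s'. (id s', fk s') = (id s, fk s)}. WS s') - ln (\<Sum>s'\<in>{s'. fk s' = fk s}. WS s')))"
    unfolding cent_def ent_eq_sum by (simp add: right_diff_distrib sum_subtractf)
  also have "\<dots> = - (\<Sum>s\<in>UNIV. WS s * ln (Q12 (fst s) (snd s)))"
  proof (intro arg_cong[where f = uminus] sum.cong refl)
    fix s :: "'s1 \<times> 's2"
    obtain s1 s2 where s: "s = (s1, s2)" by fastforce
    have 1: "{s'. (id s', fk s') = (id s, fk s)} = {s}" by auto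
    let ?D = "\<Sum>x\<in>UNIV. of_bool (fk x = fk (s1, s2)) * WS x"
    have 2: "(\<Sum>s'\<in>{s'. fk s' = fk s}. WS s') = ?D"
      unfolding sum_Collect_if by (intro sum.cong) (auto simp: s)
    show "WS s * (ln (\<Sum>s'\<in>{s'. (id s', fk s') = (id s, fk s)}. WS s') - ln (\<Sum>s'\<in>{s'. fk s' = fk s}. WS s'))
      = WS s * ln (Q12 (fst s) (snd s))"
    proof (cases "WS s = 0")
      case False
      then have "0 < WS s" by (simp add: order_less_le)
      moreover have "WS s \<le> ?D" unfolding s by (rule Q12_denominator_ge)
      ultimately have "ln (Q12 s1 s2) = ln (WS s) - ln ?D"
        unfolding Q12_def by (subst ln_div) (auto simp: s)
      then show ?thesis unfolding 1 2 by (simp add: s)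
    qed simp
  qed
  finally show ?thesis .
qed

end

section \<open>Normalisation of the weights and the list decoding error\<close>

context two_user_code
begin

text \<open>\<open>w2\<close> is the mean of \<open>wv\<close> over V1, so the ratio has mean 1, or
  0 where \<open>w2\<close> vanishes. If the K-blocks differ, the factor is 1 and only the total
  mass of \<open>p1\<close> is left.\<close>

lemma sum_p1_ratio_le:
  "(\<Sum>b1\<in>blocks l. p1 a1 b1 * (if same a1 a2 then \<Prod>t<l. wv (enc (kseq f1 a1) t) (fst (b1 t)) (fst (b2 t)) (z t)
      / w2 (enc (kseq f1 a1) t) (fst (b2 t)) (z t) else 1)) \<le> 1"
proof (cases "same a1 a2")
  case True
  let ?f = "\<lambda>t x. pV1 (fst x) * pX1 (enc (kseq f1 a1) t) (fst x) (snd x) *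
      (wv (enc (kseq f1 a1) t) (fst x) (fst (b2 t)) (z t) / w2 (enc (kseq f1 a1) t) (fst (b2 t)) (z t))"
  have "(\<Sum>b1\<in>blocks l. p1 a1 b1 * (if same a1 a2 then \<Prod>t<l. wv (enc (kseq f1 a1) t) (fst (b1 t)) (fst (b2 t)) (z t)
      / w2 (enc (kseq f1 a1) t) (fst (b2 t)) (z t) else 1)) = (\<Sum>b1\<in>blocks l. \<Prod>t<l. ?f t (b1 t))"
    unfolding p1_def prod.distrib using True by simp
  also have "\<dots> = (\<Prod>t<l. \<Sum>x\<in>UNIV. ?f t x)" by (rule sum_blocks_prod)
  also have "\<dots> \<le> 1"
  proof (intro prod_le_1 conjI)
    fix t
    show "0 \<le> (\<Sum>x\<in>UNIV. ?f t x)" by (intro sum_nonneg) simp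
    let ?u = "enc (kseq f1 a1) t" and ?v2 = "fst (b2 t)"
    have "(\<Sum>x\<in>UNIV. ?f t x) = (\<Sum>v\<in>UNIV. \<Sum>x\<in>UNIV. pV1 v * (wv ?u v ?v2 (z t) / w2 ?u ?v2 (z t)) * pX1 ?u v x)"
      unfolding sum_pair fst_conv snd_conv by (simp add: mult_ac)
    also have "\<dots> = (\<Sum>v\<in>UNIV. pV1 v * (wv ?u v ?v2 (z t) / w2 ?u ?v2 (z t)))"
      unfolding sum_distrib_left[symmetric] sums by simp
    also have "\<dots> = w2 ?u ?v2 (z t) / w2 ?u ?v2 (z t)"
      unfolding times_divide_eq_right sum_divide_distrib[symmetric] w2_def[symmetric] ..
    finally show "(\<Sum>x\<in>UNIV. ?f t x) \<le> 1" using divide_self_le_1[of "w2 ?u ?v2 (z t)"] by simp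
  qed
  finally show ?thesis .
qed simp

text \<open>With user 2's data fixed, the guessed K-block \<open>kseq f2 a2\<close> is fixed too, so
  the conditional laws \<open>Q1\<close> sum to at most 1 over the matching source blocks. The two
  parts of the guess give \<open>1 - \<phi>\<close> and \<open>\<phi>\<close>.\<close>

lemma lam1_normalized: "(\<Sum>a1\<in>blocks l. \<Sum>b1\<in>blocks l. p1 a1 b1 * lam1 a1 a2 b1 b2 z) \<le> 1"
proof -
  let ?N = "real CARD('s1)"
  let ?QQ = "\<lambda>a1. \<Prod>t<l. Q1 (a1 t) (a2 t)"
  let ?c = "\<lambda>a1. (1 - \<phi>) * of_bool (ka a1 a2 = kseq f2 a2) + \<phi> / ?N ^ l"
  let ?R = "\<lambda>a1 b1. if same a1 a2 then \<Prod>t<l. wv (enc (kseq f1 a1) t) (fst (b1 t)) (fst (b2 t)) (z t)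
      / w2 (enc (kseq f1 a1) t) (fst (b2 t)) (z t) else 1"
  have QQ0: "0 \<le> ?QQ a1" for a1 by (intro prod_nonneg) simp
  have "(\<Sum>a1\<in>blocks l. \<Sum>b1\<in>blocks l. p1 a1 b1 * lam1 a1 a2 b1 b2 z)
     = (\<Sum>a1\<in>blocks l. ?c a1 * ?QQ a1 * (\<Sum>b1\<in>blocks l. p1 a1 b1 * ?R a1 b1))"
    unfolding lam1_def sum_distrib_left by (intro sum.cong refl) (simp only: mult.left_commute mult.assoc)
  also have "\<dots> \<le> (\<Sum>a1\<in>blocks l. ?c a1 * ?QQ a1 * 1)"
    using \<phi> QQ0 by (intro sum_mono mult_left_mono sum_p1_ratio_le mult_nonneg_nonneg add_nonneg_nonneg) auto
  also have "\<dots> = (1 - \<phi>) * (\<Sum>a1\<in>blocks l. of_bool (ka a1 a2 = kseq f2 a2) * ?QQ a1)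
      + \<phi> / ?N ^ l * (\<Sum>a1\<in>blocks l. ?QQ a1)"
    by (simp only: distrib_right sum.distrib sum_distrib_left mult_1_right mult.assoc)
  also have "\<dots> \<le> (1 - \<phi>) * 1 + \<phi> / ?N ^ l * ?N ^ l"
  proof (intro add_mono mult_left_mono)
    have "(\<Sum>a1\<in>blocks l. of_bool (ka a1 a2 = kseq f2 a2) * ?QQ a1)
       = (\<Prod>t<l. \<Sum>s1\<in>UNIV. of_bool (fk (s1, a2 t) = kseq f2 a2 t) * Q1 s1 (a2 t))"
      unfolding of_bool_ka_prod[OF kseq_in]
      by (rule sum_blocks_prod[where f = "\<lambda>t s1. of_bool (fk (s1, a2 t) = kseq f2 a2 t) * Q1 s1 (a2 t)"])
    also have "\<dots> \<le> 1" by (intro prod_le_1 conjI sum_nonneg sum_Q1_le) simp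
    finally show "(\<Sum>a1\<in>blocks l. of_bool (ka a1 a2 = kseq f2 a2) * ?QQ a1) \<le> 1" .
    \<comment> \<open>With K left free, the sum of \<open>Q1\<close> over a letter may exceed 1; the
      crude bound by the alphabet size is paid for by dividing \<open>\<phi>\<close> by its
      power.\<close>
    have "(\<Sum>a1\<in>blocks l. ?QQ a1) = (\<Prod>t<l. \<Sum>s1\<in>UNIV. Q1 s1 (a2 t))"
      by (rule sum_blocks_prod[where f = "\<lambda>t s1. Q1 s1 (a2 t)"])
    also have "\<dots> \<le> (\<Prod>t<l. ?N)"
    proof (intro prod_mono conjI sum_nonneg)
      fix t
      have "(\<Sum>s1\<in>UNIV. Q1 s1 (a2 t)) \<le> (\<Sum>s1\<in>(UNIV :: 's1 set). 1)" by (intro sum_mono Q1_le_1)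
      then show "(\<Sum>s1\<in>UNIV. Q1 s1 (a2 t)) \<le> ?N" by simp
    qed simp
    finally show "(\<Sum>a1\<in>blocks l. ?QQ a1) \<le> ?N ^ l" by simp
  qed (use \<phi> in auto)
  also have "\<dots> = 1" by simp
  finally show ?thesis .
qed

text \<open>Equal K-blocks have equal codewords in the u-layer, so the laws of both users refer to
  the same u-sequence and factorise together over the positions.\<close>

lemma sum_p12_channel:
  assumes "same a1 a2"
  shows "(\<Sum>b1\<in>blocks l. \<Sum>b2\<in>blocks l. p1 a1 b1 * p2 a2 b2 * (\<Prod>t<l. h t (b1 t) (b2 t)))
    = (\<Prod>t<l. \<Sum>x\<in>UNIV. \<Sum>y\<in>UNIV. pV1 (fst x) * pX1 (enc (kseq f1 a1) t) (fst x) (snd x)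
        * (pV2 (fst y) * pX2 (enc (kseq f1 a1) t) (fst y) (snd y)) * h t x y)"
proof -
  have p2: "p2 a2 b2 = (\<Prod>t<l. pV2 (fst (b2 t)) * pX2 (enc (kseq f1 a1) t) (fst (b2 t)) (snd (b2 t)))" for b2
    using assms by (simp add: p2_def same_def)
  show ?thesis
    unfolding p1_def p2 prod.distrib[symmetric] by (rule sum_blocks2_prod)
qed

lemma sum_letters:
  "(\<Sum>x\<in>UNIV. \<Sum>y\<in>UNIV. pV1 (fst x) * pX1 u (fst x) (snd x) * (pV2 (fst y) * pX2 u (fst y) (snd y)) * g (fst x) (fst y))
    = (\<Sum>v1\<in>UNIV. \<Sum>v2\<in>UNIV. pV1 v1 * pV2 v2 * g v1 v2)"
  "(\<Sum>x\<in>UNIV. \<Sum>y\<in>UNIV. pV1 (fst x) * pX1 u (fst x) (snd x) * (pV2 (fst y) * pX2 u (fst y) (snd y)) * W (snd x) (snd y) c)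
    = wy u c"
proof -
  have "(\<Sum>x\<in>UNIV. \<Sum>y\<in>UNIV. pV1 (fst x) * pX1 u (fst x) (snd x) * (pV2 (fst y) * pX2 u (fst y) (snd y)) * h (fst x) (fst y) (snd x) (snd y))
     = (\<Sum>v1\<in>UNIV. \<Sum>v2\<in>UNIV. pV1 v1 * pV2 v2 * (\<Sum>x1\<in>UNIV. \<Sum>x2\<in>UNIV. pX1 u v1 x1 * pX2 u v2 x2 * h v1 v2 x1 x2))" for h
  proof -
    have "(\<Sum>x\<in>UNIV. \<Sum>y\<in>UNIV. pV1 (fst x) * pX1 u (fst x) (snd x) * (pV2 (fst y) * pX2 u (fst y) (snd y)) * h (fst x) (fst y) (snd x) (snd y))
      = (\<Sum>v1\<in>UNIV. \<Sum>x1\<in>UNIV. \<Sum>v2\<in>UNIV. \<Sum>x2\<in>UNIV. pV1 v1 * pV2 v2 * (pX1 u v1 x1 * pX2 u v2 x2 * h v1 v2 x1 x2))"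
      unfolding sum_pair fst_conv snd_conv by (simp add: mult_ac)
    also have "\<dots> = (\<Sum>v1\<in>UNIV. \<Sum>v2\<in>UNIV. \<Sum>x1\<in>UNIV. \<Sum>x2\<in>UNIV. pV1 v1 * pV2 v2 * (pX1 u v1 x1 * pX2 u v2 x2 * h v1 v2 x1 x2))"
      by (intro sum.cong refl sum.swap)
    finally show ?thesis by (simp only: sum_distrib_left)
  qed
  note * = this
  show "(\<Sum>x\<in>UNIV. \<Sum>y\<in>UNIV. pV1 (fst x) * pX1 u (fst x) (snd x) * (pV2 (fst y) * pX2 u (fst y) (snd y)) * g (fst x) (fst y))
    = (\<Sum>v1\<in>UNIV. \<Sum>v2\<in>UNIV. pV1 v1 * pV2 v2 * g v1 v2)"
    unfolding *[of "\<lambda>v1 v2 x1 x2. g v1 v2"] by (simp flip: sum_distrib_left sum_distrib_right)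
  show "(\<Sum>x\<in>UNIV. \<Sum>y\<in>UNIV. pV1 (fst x) * pX1 u (fst x) (snd x) * (pV2 (fst y) * pX2 u (fst y) (snd y)) * W (snd x) (snd y) c)
    = wy u c"
    unfolding *[of "\<lambda>v1 v2 x1 x2. W x1 x2 c"] wy_def wv_def ..
qed

lemma sum_p12_ratio_le:
  "(\<Sum>b1\<in>blocks l. \<Sum>b2\<in>blocks l. p1 a1 b1 * p2 a2 b2 * (if same a1 a2 then
      \<Prod>t<l. wv (enc (kseq f1 a1) t) (fst (b1 t)) (fst (b2 t)) (z t) / wy (enc (kseq f1 a1) t) (z t) else 1)) \<le> 1"
proof (cases "same a1 a2")
  case True
  let ?u = "enc (kseq f1 a1)"
  have "(\<Sum>b1\<in>blocks l. \<Sum>b2\<in>blocks l. p1 a1 b1 * p2 a2 b2 * (if same a1 a2 then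
      \<Prod>t<l. wv (?u t) (fst (b1 t)) (fst (b2 t)) (z t) / wy (?u t) (z t) else 1))
    = (\<Prod>t<l. \<Sum>v1\<in>UNIV. \<Sum>v2\<in>UNIV. pV1 v1 * pV2 v2 * (wv (?u t) v1 v2 (z t) / wy (?u t) (z t)))"
    using True sum_p12_channel[OF True, of "\<lambda>t x y. wv (?u t) (fst x) (fst y) (z t) / wy (?u t) (z t)"]
      sum_letters(1)[where g = "\<lambda>v1 v2. wv (?u t) v1 v2 (z t) / wy (?u t) (z t)" for t]
    by simp
  also have "\<dots> = (\<Prod>t<l. wy (?u t) (z t) / wy (?u t) (z t))"
    unfolding times_divide_eq_right sum_divide_distrib[symmetric] wy_def[symmetric] ..
  also have "\<dots> \<le> 1" by (intro prod_le_1 conjI divide_self_le_1) simp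
  finally show ?thesis .
next
  case False
  then show ?thesis by (simp flip: sum_distrib_left sum_distrib_right)
qed

text \<open>The list depends on \<open>z\<close> only, which is fixed here. For each K-block in it
  the source laws given K sum to at most 1, so the list part contributes at most its cardinality,
  which the factor \<open>exp (real l * \<beta>)\<close> cancels.\<close>

lemma lam12_normalized:
  assumes L: "L z \<subseteq> blocks l" "real (card (L z)) \<le> exp (real l * \<beta>)"
  shows "(\<Sum>a1\<in>blocks l. \<Sum>b1\<in>blocks l. \<Sum>a2\<in>blocks l. \<Sum>b2\<in>blocks l.
    p1 a1 b1 * p2 a2 b2 * lam12 \<beta> L a1 a2 b1 b2 z) \<le> 1"
proof -
  let ?N = "real (CARD('s1) * CARD('s2))"
  let ?QQ = "\<lambda>a1 a2. \<Prod>t<l. Q12 (a1 t) (a2 t)"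
  let ?c = "\<lambda>a1 a2. (1 - \<phi>) / exp (real l * \<beta>) * of_bool (ka a1 a2 \<in> L z) + \<phi> / ?N ^ l"
  let ?R = "\<lambda>a1 a2 b1 b2. if same a1 a2 then \<Prod>t<l. wv (enc (kseq f1 a1) t) (fst (b1 t)) (fst (b2 t)) (z t) / wy (enc (kseq f1 a1) t) (z t) else 1"
  have QQ0: "0 \<le> ?QQ a1 a2" for a1 a2 by (intro prod_nonneg) simp
  have finL: "finite (L z)" using L(1) finite_blocks by (rule finite_subset)
  have "(\<Sum>a1\<in>blocks l. \<Sum>b1\<in>blocks l. \<Sum>a2\<in>blocks l. \<Sum>b2\<in>blocks l. p1 a1 b1 * p2 a2 b2 * lam12 \<beta> L a1 a2 b1 b2 z)
    = (\<Sum>a1\<in>blocks l. \<Sum>a2\<in>blocks l. \<Sum>b1\<in>blocks l. \<Sum>b2\<in>blocks l. p1 a1 b1 * p2 a2 b2 * lam12 \<beta> L a1 a2 b1 b2 z)"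
    by (intro sum.cong refl sum.swap)
  also have "\<dots> = (\<Sum>a1\<in>blocks l. \<Sum>a2\<in>blocks l. ?c a1 a2 * ?QQ a1 a2 * (\<Sum>b1\<in>blocks l. \<Sum>b2\<in>blocks l. p1 a1 b1 * p2 a2 b2 * ?R a1 a2 b1 b2))"
    unfolding lam12_def sum_distrib_left by (intro sum.cong refl) (simp only: mult.left_commute mult.assoc)
  also have "\<dots> \<le> (\<Sum>a1\<in>blocks l. \<Sum>a2\<in>blocks l. ?c a1 a2 * ?QQ a1 a2 * 1)"
    using \<phi> QQ0 by (intro sum_mono mult_left_mono sum_p12_ratio_le mult_nonneg_nonneg add_nonneg_nonneg) auto
  also have "\<dots> = (1 - \<phi>) / exp (real l * \<beta>) * (\<Sum>a1\<in>blocks l. \<Sum>a2\<in>blocks l. of_bool (ka a1 a2 \<in> L z) * ?QQ a1 a2)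
      + \<phi> / ?N ^ l * (\<Sum>a1\<in>blocks l. \<Sum>a2\<in>blocks l. ?QQ a1 a2)"
    by (simp only: distrib_right sum.distrib sum_distrib_left mult_1_right mult.assoc)
  also have "\<dots> \<le> (1 - \<phi>) / exp (real l * \<beta>) * exp (real l * \<beta>) + \<phi> / ?N ^ l * ?N ^ l"
  proof (intro add_mono mult_left_mono)
    have "(\<Sum>a1\<in>blocks l. \<Sum>a2\<in>blocks l. of_bool (ka a1 a2 \<in> L z) * ?QQ a1 a2)
      = (\<Sum>a1\<in>blocks l. \<Sum>a2\<in>blocks l. \<Sum>k\<in>L z. of_bool (ka a1 a2 = k) * ?QQ a1 a2)"
    proof (intro sum.cong refl)
      fix a1 a2
      have "(\<Sum>k\<in>L z. of_bool (ka a1 a2 = k)) = (of_bool (ka a1 a2 \<in> L z) :: real)"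
        using finL by (simp add: of_bool_def)
      then show "of_bool (ka a1 a2 \<in> L z) * ?QQ a1 a2 = (\<Sum>k\<in>L z. of_bool (ka a1 a2 = k) * ?QQ a1 a2)"
        by (simp only: sum_distrib_right[symmetric])
    qed
    also have "\<dots> = (\<Sum>a1\<in>blocks l. \<Sum>k\<in>L z. \<Sum>a2\<in>blocks l. of_bool (ka a1 a2 = k) * ?QQ a1 a2)"
      by (intro sum.cong refl sum.swap)
    also have "\<dots> = (\<Sum>k\<in>L z. \<Sum>a1\<in>blocks l. \<Sum>a2\<in>blocks l. of_bool (ka a1 a2 = k) * ?QQ a1 a2)"
      by (rule sum.swap)
    also have "\<dots> \<le> (\<Sum>k\<in>L z. 1)"
    proof (intro sum_mono)
      fix k assume "k \<in> L z"
      then have k: "k \<in> blocks l" using L(1) by blast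
      show "(\<Sum>a1\<in>blocks l. \<Sum>a2\<in>blocks l. of_bool (ka a1 a2 = k) * ?QQ a1 a2) \<le> 1"
        unfolding sum_ka_prod[OF k, of Q12] by (intro prod_le_1 conjI sum_nonneg sum_Q12_le) simp
    qed
    also have "\<dots> \<le> exp (real l * \<beta>)" using L(2) by simp
    finally show "(\<Sum>a1\<in>blocks l. \<Sum>a2\<in>blocks l. of_bool (ka a1 a2 \<in> L z) * ?QQ a1 a2) \<le> exp (real l * \<beta>)" .
    have "(\<Sum>a1\<in>blocks l. \<Sum>a2\<in>blocks l. ?QQ a1 a2) = (\<Prod>t<l. \<Sum>x\<in>UNIV. \<Sum>y\<in>UNIV. Q12 x y)"
      by (rule sum_blocks2_prod)
    also have "\<dots> \<le> (\<Prod>t<l. ?N)"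
    proof (intro prod_mono conjI sum_nonneg)
      fix t :: nat
      have "(\<Sum>x\<in>UNIV. \<Sum>y\<in>UNIV. Q12 x y) \<le> (\<Sum>x\<in>(UNIV :: 's1 set). \<Sum>y\<in>(UNIV :: 's2 set). 1)"
        by (intro sum_mono Q12_le_1)
      then show "(\<Sum>x\<in>UNIV. \<Sum>y\<in>UNIV. Q12 x y) \<le> ?N" by simp
    qed simp
    finally show "(\<Sum>a1\<in>blocks l. \<Sum>a2\<in>blocks l. ?QQ a1 a2) \<le> ?N ^ l" by simp
  qed (use \<phi> in auto)
  also have "\<dots> = 1" by simp
  finally show ?thesis .
qed

lemma ln_lam12_ge:
  assumes "Q a1 a2 \<noteq> 0" "p1 a1 b1 \<noteq> 0" "p2 a2 b2 \<noteq> 0" "T b1 b2 z \<noteq> 0"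
  shows "lam12 \<beta> L a1 a2 b1 b2 z \<noteq> 0"
    and "(if ka a1 a2 \<in> L z then ln (1 - \<phi>) - real l * \<beta> else ln \<phi> - real l * ln (real (CARD('s1) * CARD('s2))))
      + (\<Sum>t<l. ln (Q12 (a1 t) (a2 t)))
      + of_bool (same a1 a2) * (\<Sum>t<l. ln (wv (enc (kseq f1 a1) t) (fst (b1 t)) (fst (b2 t)) (z t) / wy (enc (kseq f1 a1) t) (z t)))
    \<le> ln (lam12 \<beta> L a1 a2 b1 b2 z)"
proof -
  let ?N = "real (CARD('s1) * CARD('s2))"
  let ?c = "(1 - \<phi>) / exp (real l * \<beta>) * of_bool (ka a1 a2 \<in> L z) + \<phi> / ?N ^ l"
  let ?r = "\<lambda>t. wv (enc (kseq f1 a1) t) (fst (b1 t)) (fst (b2 t)) (z t) / wy (enc (kseq f1 a1) t) (z t)"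
  have cpos: "0 < \<phi> / ?N ^ l" using \<phi> by simp
  then have c: "0 < ?c" using \<phi> by (intro add_nonneg_pos) auto
  have Qt: "0 < Q12 (a1 t) (a2 t)" if "t < l" for t
    using support_letters(1)[OF assms that] by (rule Q12_pos)
  have rt: "0 < ?r t" if "t < l" "same a1 a2" for t
    using F_pos_imp[OF support_letters(2)[OF assms that]] by simp
  note w = ln_weight[where q = "\<lambda>t. Q12 (a1 t) (a2 t)" and r = ?r and l = l and S = "same a1 a2", OF c Qt rt]
  show "lam12 \<beta> L a1 a2 b1 b2 z \<noteq> 0" unfolding lam12_def by (rule w(1))
  have "ln (lam12 \<beta> L a1 a2 b1 b2 z) = ln ?c + (\<Sum>t<l. ln (Q12 (a1 t) (a2 t))) + of_bool (same a1 a2) * (\<Sum>t<l. ln (?r t))"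
    unfolding lam12_def by (rule w(2))
  moreover have "(if ka a1 a2 \<in> L z then ln (1 - \<phi>) - real l * \<beta> else ln \<phi> - real l * ln ?N) \<le> ln ?c"
  proof (cases "ka a1 a2 \<in> L z")
    case True
    then have "(1 - \<phi>) / exp (real l * \<beta>) \<le> ?c" using cpos by simp
    then have "ln ((1 - \<phi>) / exp (real l * \<beta>)) \<le> ln ?c" using \<phi> by (intro ln_mono) auto
    then show ?thesis using True \<phi> by (simp add: ln_div)
  next
    case False
    have "\<phi> / ?N ^ l \<le> ?c" using \<phi> by simp
    then have "ln (\<phi> / ?N ^ l) \<le> ln ?c" using cpos by (intro ln_mono)
    moreover have "ln (\<phi> / ?N ^ l) = ln \<phi> - real l * ln ?N" using \<phi> by (subst ln_div) (auto simp: ln_realpow)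
    ultimately show ?thesis using False by simp
  qed
  ultimately show "(if ka a1 a2 \<in> L z then ln (1 - \<phi>) - real l * \<beta> else ln \<phi> - real l * ln ?N)
      + (\<Sum>t<l. ln (Q12 (a1 t) (a2 t))) + of_bool (same a1 a2) * (\<Sum>t<l. ln (?r t)) \<le> ln (lam12 \<beta> L a1 a2 b1 b2 z)"
    by linarith
qed

text \<open>Two error probabilities enter: the guess fails when the list misses (\<open>q\<close>),
  the channel part is absent when the K-blocks differ (\<open>xi\<close>). Both are at most
  \<open>\<phi>\<close>, and \<open>\<beta>\<close> is charged only when the list is right.\<close>

lemma E_ln_lam12_pos:
  assumes miss: "E (\<lambda>a1 a2 b1 b2 z. of_bool (ka a1 a2 \<notin> L z)) \<le> \<phi>" and \<beta>: "0 \<le> \<beta>"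
    and rate: "\<beta> - (\<Sum>s\<in>UNIV. WS s * ln (Q12 (fst s) (snd s))) + LL l \<phi> (CARD('s1) * CARD('s2))
      < info12 - LL 1 \<phi> (CARD('v1) * CARD('v2))"
  shows "0 < E (\<lambda>a1 a2 b1 b2 z. ln (lam12 \<beta> L a1 a2 b1 b2 z))"
proof -
  let ?H = "\<Sum>s\<in>UNIV. WS s * ln (Q12 (fst s) (snd s))"
  let ?x = "xi l WS f1 f2" and ?N = "real (CARD('s1) * CARD('s2))"
  let ?M = "real (CARD('v1) * CARD('v2))"
  define q where "q = E (\<lambda>a1 a2 b1 b2 z. of_bool (ka a1 a2 \<notin> L z))"
  let ?i = "\<lambda>u b1 b2 y. ln (wv u (fst b1) (fst b2) y / wy u y)"
  have q: "0 \<le> q" "q \<le> \<phi>"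
    using miss E_mono[of "\<lambda>_ _ _ _ _. 0" "\<lambda>a1 a2 b1 b2 z. of_bool (ka a1 a2 \<notin> L z)"] unfolding q_def
    by (auto simp: E_const)
  have 1: "E (\<lambda>a1 a2 b1 b2 z. if ka a1 a2 \<in> L z then ln (1 - \<phi>) - real l * \<beta> else ln \<phi> - real l * ln ?N)
     = (1 - q) * (ln (1 - \<phi>) - real l * \<beta>) + q * (ln \<phi> - real l * ln ?N)"
  proof -
    let ?A = "ln (1 - \<phi>) - real l * \<beta>" and ?B = "ln \<phi> - real l * ln ?N"
    have "E (\<lambda>a1 a2 b1 b2 z. if ka a1 a2 \<in> L z then ?A else ?B)
      = E (\<lambda>a1 a2 b1 b2 z. (?B - ?A) * of_bool (ka a1 a2 \<notin> L z) + ?A)"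
      by (rule arg_cong[where f = E]) (auto simp: fun_eq_iff)
    also have "\<dots> = (?B - ?A) * q + ?A"
      unfolding E_add E_cmult E_const q_def ..
    finally show ?thesis by (simp add: algebra_simps)
  qed
  have 2: "E (\<lambda>a1 a2 b1 b2 z. \<Sum>t<l. ln (Q12 (a1 t) (a2 t))) = real l * ?H"
    unfolding E_source by (rule sum_Q_additive[where h = "\<lambda>x y. ln (Q12 x y)"])
  have 3: "E (\<lambda>a1 a2 b1 b2 z. of_bool (same a1 a2) * (\<Sum>t<l. ?i (enc (kseq f1 a1) t) (b1 t) (b2 t) (z t)))
     = (1 - ?x) * (real l * info12)"
    unfolding E_same_additive[where i = ?i] info12_def F_def ..
  have "((1 - q) * (ln (1 - \<phi>) - real l * \<beta>) + q * (ln \<phi> - real l * ln ?N)) + real l * ?H + (1 - ?x) * (real l * info12)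
     \<le> E (\<lambda>a1 a2 b1 b2 z. ln (lam12 \<beta> L a1 a2 b1 b2 z))"
    unfolding 1[symmetric] 2[symmetric] 3[symmetric] E_add[symmetric] by (rule E_mono) (rule ln_lam12_ge(2))
  moreover have "- hb \<phi> \<le> (1 - q) * ln (1 - \<phi>) + q * ln \<phi>"
    using q \<phi> by (intro binary_cross_entropy_ge) auto
  moreover have "q * (real l * ln ?N) \<le> \<phi> * (real l * ln ?N)"
    using q by (intro mult_right_mono mult_nonneg_nonneg) (auto intro!: ln_ge_zero simp: Suc_leI simp flip: of_nat_mult)
  moreover have "0 \<le> q * (real l * \<beta>)" using q \<beta> by simp
  moreover have "real l * (info12 - \<phi> * ln ?M) \<le> real l * ((1 - ?x) * info12)"
    using weighted_info_ge[OF info12_le] by (intro mult_left_mono) (auto simp: Suc_leI)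
  moreover have "real l * (\<beta> - ?H + LL l \<phi> (CARD('s1) * CARD('s2))) < real l * (info12 - LL 1 \<phi> (CARD('v1) * CARD('v2)))"
    using rate l by (intro mult_strict_left_mono) auto
  then have "real l * \<beta> - (real l * ?H) + hb \<phi> + \<phi> * (real l * ln ?N) < real l * (info12 - \<phi> * ln ?M) - real l * hb \<phi>"
    using l by (simp only: LL_def) (simp add: algebra_simps del: of_nat_mult)
  moreover have "0 \<le> real l * hb \<phi>" using hb_nonneg by simp
  ultimately show ?thesis by (simp add: algebra_simps del: of_nat_mult)
qed

text \<open>Blocks with different K-blocks are counted as misses outright, at cost
  \<open>xi\<close>. In the others the V- and X-letters are averaged out and the u-block sees the
  memoryless channel \<open>wy\<close>, so the miss probability of the inner layer applies.\<close>

lemma E_miss_le: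
  "E (\<lambda>a1 a2 b1 b2 z. of_bool (ka a1 a2 \<notin> L z)) \<le> xi l WS f1 f2 +
    (\<Sum>k\<in>blocks l. (\<Prod>t<l. \<Sum>s\<in>{s. fk s = k t}. WS s) * (\<Sum>z\<in>blocks l. (\<Prod>t<l. wy (enc k t) (z t)) * of_bool (k \<notin> L z)))"
proof -
  let ?G = "\<lambda>k. \<Sum>z\<in>blocks l. (\<Prod>t<l. wy (enc k t) (z t)) * of_bool (k \<notin> L z)"
  have G0: "0 \<le> ?G k" for k by (intro sum_nonneg mult_nonneg_nonneg prod_nonneg) auto
  have cond: "(\<Sum>b1\<in>blocks l. \<Sum>b2\<in>blocks l. \<Sum>z\<in>blocks l. Q a1 a2 * p1 a1 b1 * p2 a2 b2 * T b1 b2 z *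
      (of_bool (same a1 a2) * of_bool (ka a1 a2 \<notin> L z))) = Q a1 a2 * (of_bool (same a1 a2) * ?G (ka a1 a2))" for a1 a2
  proof (cases "same a1 a2")
    case True
    let ?u = "enc (kseq f1 a1)" and ?o = "\<lambda>z. of_bool (ka a1 a2 \<notin> L z) :: real"
    have "(\<Sum>b1\<in>blocks l. \<Sum>b2\<in>blocks l. \<Sum>z\<in>blocks l. Q a1 a2 * p1 a1 b1 * p2 a2 b2 * T b1 b2 z * (of_bool (same a1 a2) * ?o z))
       = (\<Sum>b1\<in>blocks l. \<Sum>z\<in>blocks l. \<Sum>b2\<in>blocks l. Q a1 a2 * p1 a1 b1 * p2 a2 b2 * T b1 b2 z * ?o z)"
      by (simp only: True of_bool_eq(2) mult_1_left, intro sum.cong refl sum.swap)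
    also have "\<dots> = (\<Sum>z\<in>blocks l. \<Sum>b1\<in>blocks l. \<Sum>b2\<in>blocks l. Q a1 a2 * p1 a1 b1 * p2 a2 b2 * T b1 b2 z * ?o z)"
      by (rule sum.swap)
    also have "\<dots> = (\<Sum>z\<in>blocks l. Q a1 a2 * ((\<Sum>b1\<in>blocks l. \<Sum>b2\<in>blocks l. p1 a1 b1 * p2 a2 b2 * T b1 b2 z) * ?o z))"
      by (simp add: sum_distrib_left sum_distrib_right mult_ac)
    also have "\<dots> = (\<Sum>z\<in>blocks l. Q a1 a2 * ((\<Prod>t<l. wy (?u t) (z t)) * ?o z))"
      unfolding T_def sum_p12_channel[OF True, where h = "\<lambda>t x y. W (snd x) (snd y) (z t)" for z] sum_letters(2) ..
    also have "\<dots> = Q a1 a2 * ?G (ka a1 a2)"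
      unfolding sum_distrib_left same_ka[OF True] ..
    finally show ?thesis using True by simp
  qed simp
  \<comment> \<open>Transport to the law of the K-block, which is a product law because K is
    computed letter by letter from a memoryless source.\<close>
  have push: "(\<Sum>a1\<in>blocks l. \<Sum>a2\<in>blocks l. Q a1 a2 * ?G (ka a1 a2))
      = (\<Sum>k\<in>blocks l. (\<Prod>t<l. \<Sum>s\<in>{s. fk s = k t}. WS s) * ?G k)"
  proof -
    have "(\<Sum>a1\<in>blocks l. \<Sum>a2\<in>blocks l. Q a1 a2 * ?G (ka a1 a2))
       = (\<Sum>a1\<in>blocks l. \<Sum>a2\<in>blocks l. \<Sum>k\<in>blocks l. of_bool (ka a1 a2 = k) * Q a1 a2 * ?G k)"
    proof (intro sum.cong refl)
      fix a1 a2
      have "(\<Sum>k\<in>blocks l. of_bool (ka a1 a2 = k) * Q a1 a2 * ?G k) = (\<Sum>k\<in>blocks l. if ka a1 a2 = k then Q a1 a2 * ?G k else 0)"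
        by (intro sum.cong) auto
      then show "Q a1 a2 * ?G (ka a1 a2) = (\<Sum>k\<in>blocks l. of_bool (ka a1 a2 = k) * Q a1 a2 * ?G k)"
        by (simp add: ka_def)
    qed
    also have "\<dots> = (\<Sum>a1\<in>blocks l. \<Sum>k\<in>blocks l. \<Sum>a2\<in>blocks l. of_bool (ka a1 a2 = k) * Q a1 a2 * ?G k)"
      by (intro sum.cong refl sum.swap)
    also have "\<dots> = (\<Sum>k\<in>blocks l. \<Sum>a1\<in>blocks l. \<Sum>a2\<in>blocks l. of_bool (ka a1 a2 = k) * Q a1 a2 * ?G k)"
      by (rule sum.swap)
    also have "\<dots> = (\<Sum>k\<in>blocks l. (\<Prod>t<l. \<Sum>s\<in>{s. fk s = k t}. WS s) * ?G k)"
    proof (intro sum.cong refl)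
      fix k :: "nat \<Rightarrow> 'k" assume k: "k \<in> blocks l"
      have "(\<Sum>a1\<in>blocks l. \<Sum>a2\<in>blocks l. of_bool (ka a1 a2 = k) * Q a1 a2 * ?G k)
         = (\<Sum>a1\<in>blocks l. \<Sum>a2\<in>blocks l. of_bool (ka a1 a2 = k) * Q a1 a2) * ?G k"
        by (simp only: sum_distrib_right)
      also have "(\<Sum>a1\<in>blocks l. \<Sum>a2\<in>blocks l. of_bool (ka a1 a2 = k) * Q a1 a2) = (\<Prod>t<l. \<Sum>s\<in>{s. fk s = k t}. WS s)"
        unfolding Q_def sum_ka_prod[OF k, of "\<lambda>x y. WS (x, y)"] sum_Collect_if
        by (intro prod.cong sum.cong refl) auto
      finally show "(\<Sum>a1\<in>blocks l. \<Sum>a2\<in>blocks l. of_bool (ka a1 a2 = k) * Q a1 a2 * ?G k)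
        = (\<Prod>t<l. \<Sum>s\<in>{s. fk s = k t}. WS s) * ?G k" .
    qed
    finally show ?thesis .
  qed
  have "E (\<lambda>a1 a2 b1 b2 z. of_bool (ka a1 a2 \<notin> L z)) \<le> E (\<lambda>a1 a2 b1 b2 z. (1 + (- 1) * of_bool (same a1 a2)) + of_bool (same a1 a2) * of_bool (ka a1 a2 \<notin> L z))"
    by (rule E_mono) auto
  also have "\<dots> = xi l WS f1 f2 + (\<Sum>a1\<in>blocks l. \<Sum>a2\<in>blocks l. Q a1 a2 * (of_bool (same a1 a2) * ?G (ka a1 a2)))"
    unfolding E_add E_cmult E_const E_source sum_Q_same by (simp add: E_def cond)
  \<comment> \<open>Conditioning on agreement would destroy the product law of the K-block. The
    indicator is dropped instead, which only increases the sum.\<close>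
  also have "(\<Sum>a1\<in>blocks l. \<Sum>a2\<in>blocks l. Q a1 a2 * (of_bool (same a1 a2) * ?G (ka a1 a2)))
      \<le> (\<Sum>a1\<in>blocks l. \<Sum>a2\<in>blocks l. Q a1 a2 * ?G (ka a1 a2))"
    using G0 by (intro sum_mono mult_left_mono) auto
  finally show ?thesis unfolding push by simp
qed

end

section \<open>Transmissibility\<close>

theorem theorem13:
  fixes WS :: "'s1::finite \<times> 's2::finite \<Rightarrow> real"
    and W :: "'x1::finite \<Rightarrow> 'x2::finite \<Rightarrow> 'y::finite \<Rightarrow> real"
    and f1 :: "'s1 \<Rightarrow> 'k::finite" and f2 :: "'s2 \<Rightarrow> 'k"
    and pU :: "'u::finite \<Rightarrow> real" and pV1 :: "'v1::finite \<Rightarrow> real" and pV2 :: "'v2::finite \<Rightarrow> real"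
    and pX1 :: "'u \<Rightarrow> 'v1 \<Rightarrow> 'x1 \<Rightarrow> real" and pX2 :: "'u \<Rightarrow> 'v2 \<Rightarrow> 'x2 \<Rightarrow> real"
    and \<alpha> \<beta> \<rho> \<delta> :: real and l :: nat and a :: nat
  assumes WS_pmf: "is_pmf WS"
    and W_chan: "\<forall>x1 x2. is_pmf (W x1 x2)"
    and params: "\<alpha> \<ge> 0" "\<beta> \<ge> 0" "\<rho> > 0" "\<delta> > 0"
    and l_ge: "l \<ge> lstar (card (UNIV::'u set)) (card (UNIV::'y set)) \<rho>"
    and pU_pmf: "is_pmf pU" and pU_type: "is_type l pU"
    and pV1_pmf: "is_pmf pV1" and pV2_pmf: "is_pmf pV2"
    and pX1_pmf: "\<forall>u v1. is_pmf (pX1 u v1)" and pX2_pmf: "\<forall>u v2. is_pmf (pX2 u v2)"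
    and a_in: "a \<in> {1, 2}"
  defines "P \<equiv> joint6 pU pV1 pV2 pX1 pX2 W"
    and "fKa \<equiv> (\<lambda>s. if a = 1 then f1 (fst s) else f2 (snd s))"
  defines "\<phi> \<equiv> (real l + 1) ^ (2 * (card (UNIV::'u set)) * (card (UNIV::'y set)))
                  * exp (- real l * Er (\<alpha> + \<rho>) pU (pYgU P))
               + xi l WS f1 f2 + tau l \<delta> WS fKa"
  assumes c0: "(1 + \<delta>) * ent WS fKa < \<alpha> + \<beta>"
    and c1: "cent WS fst (\<lambda>s. (snd s, fKa s)) + LL l \<phi> (card (UNIV::'s1 set))
             < cmi P (\<lambda>(u,v1,v2,x1,x2,y). v1) (\<lambda>(u,v1,v2,x1,x2,y). y) (\<lambda>(u,v1,v2,x1,x2,y). (u, v2))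
               - LL 1 \<phi> (card (UNIV::'v1 set))"
    and c2: "cent WS snd (\<lambda>s. (fst s, fKa s)) + LL l \<phi> (card (UNIV::'s2 set))
             < cmi P (\<lambda>(u,v1,v2,x1,x2,y). v2) (\<lambda>(u,v1,v2,x1,x2,y). y) (\<lambda>(u,v1,v2,x1,x2,y). (u, v1))
               - LL 1 \<phi> (card (UNIV::'v2 set))"
    and c3: "\<beta> + cent WS id fKa + LL l \<phi> ((card (UNIV::'s1 set)) * (card (UNIV::'s2 set)))
             < cmi P (\<lambda>(u,v1,v2,x1,x2,y). (v1, v2)) (\<lambda>(u,v1,v2,x1,x2,y). y) (\<lambda>(u,v1,v2,x1,x2,y). u)
               - LL 1 \<phi> ((card (UNIV::'v1 set)) * (card (UNIV::'v2 set)))"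
    and phi_range: "0 \<le> \<phi>" "\<phi> < 1/2"
  shows "transmissible WS W"
proof -
  define pK where "pK k = (\<Sum>s\<in>{s. fKa s = k}. WS s)" for k
  let ?m = "Min {q. 0 < q \<and> (\<exists>k. q = pK k)}"
  let ?miss = "real CARD('k) * exp (- 2 * \<delta>\<^sup>2 * ?m\<^sup>2 * real l)"
  let ?g = "(real l + 1) ^ (2 * CARD('u) * CARD('y)) * exp (- real l * Er (\<alpha> + \<rho>) pU (pYgU P))"
  have \<phi>: "\<phi> = ?g + xi l WS f1 f2 + 2 * ?miss"
    unfolding \<phi>_def tau_def Let_def pK_def by simp
  have miss: "0 < ?miss" by simp
  have xi0: "0 \<le> xi l WS f1 f2" by (rule xi_nonneg[OF WS_pmf])
  \<comment> \<open>The guesses take \<open>ln \<phi>\<close>, so 0 has to be excluded; the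
    exponential in \<open>tau\<close> is positive.\<close>
  have \<phi>_pos: "0 < \<phi>" using miss xi0 unfolding \<phi> by (intro add_nonneg_pos add_nonneg_nonneg) auto
  have l: "0 < l" using lstar_properties(1)[OF _ params(3) l_ge] by simp
  have WS0: "0 \<le> WS s" for s using WS_pmf unfolding is_pmf_def by blast
  have pK: "is_pmf pK"
  proof -
    have "(\<Sum>k\<in>UNIV. pK k) = sum WS UNIV"
      unfolding pK_def using sum.group[of UNIV UNIV fKa WS] by simp
    then show ?thesis using WS_pmf WS0 by (auto simp: is_pmf_def pK_def intro!: sum_nonneg)
  qed
  have ent: "ent WS fKa = - (\<Sum>k\<in>UNIV. pK k * ln (pK k))"
  proof -
    have "(\<Sum>k\<in>range fKa. pK k * ln (pK k)) = (\<Sum>k\<in>UNIV. pK k * ln (pK k))"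
    proof (rule sum.mono_neutral_left)
      show "\<forall>k\<in>UNIV - range fKa. pK k * ln (pK k) = 0"
      proof
        fix k assume "k \<in> UNIV - range fKa"
        then have e: "{s. fKa s = k} = {}" by auto
        show "pK k * ln (pK k) = 0" unfolding pK_def e by simp
      qed
    qed auto
    then show ?thesis unfolding ent_def pK_def by simp
  qed
  interpret I: mac_input W pU pV1 pV2 pX1 pX2
    using W_chan pU_pmf pV1_pmf pV2_pmf pX1_pmf pX2_pmf by unfold_locales auto
  have P0: "0 \<le> P z" for z
    by (cases z) (simp add: P_def joint6_def)
  have wP: "pYgU P u = I.wy u" if "0 < pU u" for u
    unfolding P_def using I.pYgU_joint6[OF that] by blast
  \<comment> \<open>The inner code is built for the channel from U to Y seen when both users send
    the same u-block, with the other layers acting as noise.\<close>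
  obtain enc L where enc: "\<And>k. enc k \<in> type_seqs l pU"
    and L: "\<And>z. L z \<subseteq> blocks l" "\<And>z. real (card (L z)) \<le> exp (real l * \<beta>)"
    and err: "(\<Sum>k\<in>blocks l. (\<Prod>t<l. pK (k t)) * (\<Sum>z\<in>blocks l. (\<Prod>t<l. pYgU P (enc k t) (z t)) * of_bool (k \<notin> L z)))
      \<le> ?g + ?miss"
  proof -
    have "(1 + \<delta>) * (- (\<Sum>k\<in>UNIV. pK k * ln (pK k))) \<le> \<alpha> + \<beta>" using c0 unfolding ent by simp
    moreover have "0 \<le> pYgU P u y" for u y
      unfolding pYgU_def using P0 by (intro divide_nonneg_nonneg sum_nonneg)
    moreover have "is_pmf (pYgU P u)" if "0 < pU u" for u
      unfolding wP[OF that] by (rule I.pmf_wy)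
    ultimately show ?thesis
      using inner_layer[OF pK pU_pmf pU_type _ _ params l_ge, where w = "pYgU P"] that by blast
  qed
  interpret C: two_user_code W pU pV1 pV2 pX1 pX2 WS f1 f2 fKa enc l \<phi>
  proof
    show "fKa (s1, s2) = f1 s1" if "f1 s1 = f2 s2" for s1 s2
      using that by (simp add: fKa_def)
    have "0 \<le> ?g" by simp
    then show "xi l WS f1 f2 \<le> \<phi>" using miss unfolding \<phi> by linarith
  qed (use WS_pmf enc l \<phi>_pos phi_range in auto)
  \<comment> \<open>The rate condition of user 2 is that of user 1 after exchanging the users.\<close>
  let ?sw = "prod.swap :: 's2 \<times> 's1 \<Rightarrow> 's1 \<times> 's2"
  have bij_sw: "bij ?sw" by simp
  interpret S: two_user_code "\<lambda>x2 x1. W x1 x2" pU pV2 pV1 pX2 pX1 "\<lambda>s. WS (?sw s)" f2 f1 "\<lambda>s. fKa (?sw s)" enc l \<phi>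
  proof
    show "is_pmf (\<lambda>s. WS (?sw s))"
      using WS_pmf sum.reindex_bij_betw[of ?sw UNIV UNIV WS] bij_sw by (simp add: is_pmf_def)
    have "(\<Sum>s\<in>{s. f2 (fst s) \<noteq> f1 (snd s)}. WS (?sw s)) = (\<Sum>s\<in>{s. f1 (fst s) \<noteq> f2 (snd s)}. WS s)"
      using bij_betw_Collect[of ?sw UNIV UNIV "\<lambda>s. f1 (fst s) \<noteq> f2 (snd s)" "\<lambda>s. f2 (fst s) \<noteq> f1 (snd s)"] bij_sw
      by (intro sum.reindex_bij_betw) (auto simp: eq_commute)
    then show "xi l (\<lambda>s. WS (?sw s)) f2 f1 \<le> \<phi>" using C.mismatch by (simp add: xi_def)
    show "fKa (?sw (s1, s2)) = f2 s1" if "f2 s1 = f1 s2" for s1 s2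
      using that by (simp add: fKa_def)
  qed (use W_chan pU_pmf pV1_pmf pV2_pmf pX1_pmf pX2_pmf enc l \<phi>_pos phi_range in auto)
  \<comment> \<open>The exchanged system describes the same experiment with the arguments in the
    other order, so statements about it can be read as statements about the original code.\<close>
  have swap_eq: "S.Q a2 a1 = C.Q a1 a2" "S.p1 = C.p2" "S.p2 = C.p1" "S.T b2 b1 z = C.T b1 b2 z"
    for a1 a2 b1 b2 z
    unfolding S.Q_def C.Q_def S.p1_def C.p2_def S.p2_def C.p1_def S.T_def C.T_def S.kseq_def C.kseq_def
    by simp_all
  have E_swap: "C.E (\<lambda>a1 a2 b1 b2 z. f a2 a1 b2 b1 z) = S.E f" for f
  proof -
    have "C.E (\<lambda>a1 a2 b1 b2 z. f a2 a1 b2 b1 z) = (\<Sum>a2\<in>blocks l. \<Sum>a1\<in>blocks l. \<Sum>b1\<in>blocks l. \<Sum>b2\<in>blocks l. \<Sum>z\<in>blocks l.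
       C.Q a1 a2 * C.p1 a1 b1 * C.p2 a2 b2 * C.T b1 b2 z * f a2 a1 b2 b1 z)"
      unfolding C.E_def by (rule sum.swap)
    also have "\<dots> = (\<Sum>a2\<in>blocks l. \<Sum>a1\<in>blocks l. \<Sum>b2\<in>blocks l. \<Sum>b1\<in>blocks l. \<Sum>z\<in>blocks l.
       C.Q a1 a2 * C.p1 a1 b1 * C.p2 a2 b2 * C.T b1 b2 z * f a2 a1 b2 b1 z)"
      by (intro sum.cong refl sum.swap)
    also have "\<dots> = S.E f" unfolding S.E_def swap_eq by (simp add: mult_ac)
    finally show ?thesis .
  qed
  have E1: "0 < C.E (\<lambda>a1 a2 b1 b2 z. ln (C.lam1 a1 a2 b1 b2 z))"
    using c1 unfolding C.cent_1 P_def I.cmi_1 by (rule C.E_ln_lam1_pos)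
  have E2: "0 < C.E (\<lambda>a1 a2 b1 b2 z. ln (S.lam1 a2 a1 b2 b1 z))"
  proof -
    have "cent WS snd (\<lambda>s. (fst s, fKa s)) = cent (\<lambda>s. WS (?sw s)) fst (\<lambda>s. (snd s, fKa (?sw s)))"
      using cent_reindex[OF bij_sw, of WS snd "\<lambda>s. (fst s, fKa s)"] by simp
    moreover have "cmi P (\<lambda>(u,v1,v2,x1,x2,y). v2) (\<lambda>(u,v1,v2,x1,x2,y). y) (\<lambda>(u,v1,v2,x1,x2,y). (u, v1))
      = cmi (joint6 pU pV2 pV1 pX2 pX1 (\<lambda>x2 x1. W x1 x2)) (\<lambda>(u,v2,v1,x2,x1,y). v2) (\<lambda>(u,v2,v1,x2,x1,y). y)
          (\<lambda>(u,v2,v1,x2,x1,y). (u, v1))"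
    proof -
      let ?\<pi> = "\<lambda>(u, v2, v1, x2, x1, y). (u, v1, v2, x1, x2, y)"
      have bij: "bij (?\<pi> :: 'u \<times> 'v2 \<times> 'v1 \<times> 'x2 \<times> 'x1 \<times> 'y \<Rightarrow> 'u \<times> 'v1 \<times> 'v2 \<times> 'x1 \<times> 'x2 \<times> 'y)"
        by (rule o_bij[where g = "\<lambda>(u, v1, v2, x1, x2, y). (u, v2, v1, x2, x1, y)"]) auto
      have "joint6 pU pV2 pV1 pX2 pX1 (\<lambda>x2 x1. W x1 x2) = (\<lambda>z. P (?\<pi> z))"
        by (auto simp: joint6_def P_def fun_eq_iff)
      then show ?thesis
        using cmi_reindex[OF bij, of P "\<lambda>(u,v1,v2,x1,x2,y). v2" "\<lambda>(u,v1,v2,x1,x2,y). y" "\<lambda>(u,v1,v2,x1,x2,y). (u, v1)"]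
        by (simp add: case_prod_unfold)
    qed
    ultimately have "0 < S.E (\<lambda>a1 a2 b1 b2 z. ln (S.lam1 a1 a2 b1 b2 z))"
      using c2 unfolding S.cent_1 S.cmi_1 by (intro S.E_ln_lam1_pos) simp
    then show ?thesis unfolding E_swap[of "\<lambda>a1 a2 b1 b2 z. ln (S.lam1 a1 a2 b1 b2 z)"] .
  qed
  have E3: "0 < C.E (\<lambda>a1 a2 b1 b2 z. ln (C.lam12 \<beta> L a1 a2 b1 b2 z))"
  proof (rule C.E_ln_lam12_pos)
    \<comment> \<open>Codewords avoid letters of probability 0, so the channel of the inner layer
      and that of \<open>C.E_miss_le\<close> agree along them.\<close>
    have "(\<Prod>t<l. pYgU P (enc k t) (z t)) = (\<Prod>t<l. I.wy (enc k t) (z t))" for k z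
      using wP type_seqs_pos[OF enc] by (intro prod.cong refl) simp
    then have "C.E (\<lambda>a1 a2 b1 b2 z. of_bool (C.ka a1 a2 \<notin> L z)) \<le> xi l WS f1 f2 + (?g + ?miss)"
      using C.E_miss_le[of L] err unfolding pK_def by simp
    then show "C.E (\<lambda>a1 a2 b1 b2 z. of_bool (C.ka a1 a2 \<notin> L z)) \<le> \<phi>" using miss unfolding \<phi> by linarith
    show "\<beta> - (\<Sum>s\<in>UNIV. WS s * ln (C.Q12 (fst s) (snd s))) + LL l \<phi> (CARD('s1) * CARD('s2))
      < I.info12 - LL 1 \<phi> (CARD('v1) * CARD('v2))"
      using c3 unfolding C.cent_12 P_def I.cmi_12 by simp
  qed (rule params(2))
  show ?thesis
  \<comment> \<open>\<open>snd\<close> extracts the channel inputs from the codewords. The second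
    weight is the one-user weight of the exchanged system, with its arguments exchanged
    back.\<close>
  proof (rule block_coding[where l = l and WS = WS and W = W and ?B1.0 = "blocks l" and ?B2.0 = "blocks l"
        and ?in1.0 = "\<lambda>b t. snd (b t)" and ?in2.0 = "\<lambda>b t. snd (b t)" and ?p1.0 = C.p1 and ?p2.0 = C.p2
        and ?L1.0 = C.lam1 and ?L2.0 = "\<lambda>a1 a2 b1 b2 z. S.lam1 a2 a1 b2 b1 z" and ?L3.0 = "C.lam12 \<beta> L"])
    show "0 \<le> C.lam1 a1 a2 b1 b2 z \<and> 0 \<le> S.lam1 a2 a1 b2 b1 z \<and> 0 \<le> C.lam12 \<beta> L a1 a2 b1 b2 z" for a1 a2 b1 b2 z
      using C.lam_nonneg S.lam_nonneg by blast
    show "C.lam1 a1 a2 b1 b2 z \<noteq> 0 \<and> S.lam1 a2 a1 b2 b1 z \<noteq> 0 \<and> C.lam12 \<beta> L a1 a2 b1 b2 z \<noteq> 0"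
      if "(\<Prod>t<l. WS (a1 t, a2 t)) \<noteq> 0" "C.p1 a1 b1 \<noteq> 0" "C.p2 a2 b2 \<noteq> 0" "(\<Prod>t<l. W (snd (b1 t)) (snd (b2 t)) (z t)) \<noteq> 0"
      for a1 a2 b1 b2 z
    proof -
      note nz = that[folded C.Q_def C.T_def]
      show ?thesis
        using C.ln_lam1_ge(1)[OF nz] C.ln_lam12_ge(1)[OF nz] S.ln_lam1_ge(1)[of a2 a1 b2 b1 z] nz
        unfolding swap_eq by blast
    qed
    show "(\<Sum>a2\<in>blocks l. \<Sum>b2\<in>blocks l. C.p2 a2 b2 * S.lam1 a2 a1 b2 b1 z) \<le> 1" for a1 b1 z
      using S.lam1_normalized[of a1 b1 z] unfolding swap_eq .
    show "(\<Sum>a1\<in>blocks l. \<Sum>b1\<in>blocks l. \<Sum>a2\<in>blocks l. \<Sum>b2\<in>blocks l.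
        C.p1 a1 b1 * C.p2 a2 b2 * C.lam12 \<beta> L a1 a2 b1 b2 z) \<le> 1" for z
      by (rule C.lam12_normalized[OF L])
  qed (use l WS_pmf W_chan C.lam1_normalized E1 E2 E3 in \<open>simp_all add: C.E_def C.Q_def C.T_def\<close>)
qed

end
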